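(* Let $\Omega\subset\mathbb{R}^3$ be a domain, $T>0$, and let $X$, $d=(0,d_0,d_1,d_2)$, $d^\star$, $J$ and $\mathcal{L}=J(d+d^\star)$ with $D(\mathcal{L})=D(d)\cap D(d^\star)$ be as in the context. Assume $D(\mathcal{L})$ is dense in $X$ and the initial condition $U_0=(\lambda_0^0,A_0,g_0,\lambda_3^0)\in D(\mathcal{L})$. Then there exists a unique $U=(\lambda_0,A,g,\lambda_3)\in C^0([0,T];D(\mathcal{L}))\cap C^1([0,T];X)$ with $U(0)=U_0$ and $$\partial_t\lambda_0=d_0^\star A,\qquad \partial_tA=-d_1^\star g-d_0\lambda_0,\qquad \partial_tg=d_1A+d_2^\star\lambda_3,\qquad \partial_t\lambda_3=-d_2g$$ (i.e. $\partial_tU=\mathcal{L}U$), and it satisfies $\max_{t\in[0,T]}\|U(t)\|_X\le\|U_0\|_X$. If moreover the initial conditions satisfy $\lambda_0^0=0$, $\lambda_3^0=0$, $d_0^\star A_0=0$ and $d_2g_0=0$, then $\lambda_0\equiv0$, $\lambda_3\equiv0$, and $(A,g)$ is the unique solution (with $(0,A,g,0)\in C^0([0,T];D(\mathcal{L}))\cap C^1([0,T];X)$ and $(A,g)(0)=(A_0,g_0)$) of $$d_0^\star A=0,\qquad \partial_tA+d_1^\star g=0,\qquad \partial_tg-d_1A=0,\qquad d_2g=0 .$$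
   Context: $\mathbb{S}$: symmetric real $3\times3$ matrices; $\mathbb{T}$: trace-free real $3\times3$ matrices; $\operatorname{dev}M:=M-\tfrac13\operatorname{tr}(M)I$. Differential operators act column-wise in the distributional sense: $(\operatorname{curl}M)_{ij}=\epsilon_{ikl}\partial_kM_{lj}$, $(\operatorname{div}M)_i=\partial_jM_{ji}$, $(\operatorname{grad}v)_{ij}=\partial_iv_j$, $\operatorname{sym}$ the symmetric part, $\operatorname{div}\operatorname{div}\sigma=\operatorname{div}(\operatorname{div}\sigma)$. $X:=L^2(\Omega;\mathbb{R}^3)\oplus L^2(\Omega;\mathbb{T})\oplus L^2(\Omega;\mathbb{S})\oplus L^2(\Omega;\mathbb{R})$ with the $L^2$ inner product. The operators $d_0:=\operatorname{dev}\operatorname{grad}$ with domain $\{v\in L^2(\Omega;\mathbb{R}^3):\operatorname{dev}\operatorname{grad}v\in L^2\}$, $d_1:=\operatorname{sym}\operatorname{curl}$ with domain $\{A\in L^2(\Omega;\mathbb{T}):\operatorname{sym}\operatorname{curl}A\in L^2\}$, $d_2:=\operatorname{div}\operatorname{div}$ with domain $\{\sigma\in L^2(\Omega;\mathbb{S}):\operatorname{div}\operatorname{div}\sigma\in L^2\}$; $d_i^\star$ denotes the Hilbert adjoint of $d_i$ (formally $d_0^\star=-\operatorname{div}$, $d_1^\star=\operatorname{curl}$, $d_2^\star=\operatorname{hess}$). $d(u_0,u_1,u_2,u_3):=(0,d_0u_0,d_1u_1,d_2u_2)$ on $D(d)$ = product of these domains with $L^2(\Omega;\mathbb{R})$; $d^\star$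 is its Hilbert adjoint, $d^\star(w_0,w_1,w_2,w_3)=(d_0^\star w_1,d_1^\star w_2,d_2^\star w_3,0)$. $J:=\operatorname{diag}(1,-1,1,-1)$ acting componentwise; $D(\mathcal{L})$ carries the graph norm. (In the application $g=S\gamma$ with $S(M)=M^\top-\operatorname{tr}(M)I$.) *)

theory Defs
  imports "HOL-Analysis.Analysis"
begin

text \<open>Points of R^3 are of type real^3; a 3x3 matrix M has entries M $ i $ j.
  An element of X is represented pointwise by a quadruple
  (lambda0, A, g, lambda3) :: real^3 \<times> real^3^3 \<times> real^3^3 \<times> real.
  The product norm of this quadruple squared is |lambda0|^2 + |A|_F^2 + |g|_F^2 + lambda3^2,
  so the L2 norm below is exactly the norm of X.\<close>

type_synonym pt = "real^3"
type_synonym mat3 = "(real^3)^3"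
type_synonym xval = "(real^3) \<times> mat3 \<times> mat3 \<times> real"

definition L2 :: "pt set \<Rightarrow> (pt \<Rightarrow> 'b::real_normed_vector) \<Rightarrow> bool" where
  "L2 \<Omega> f \<longleftrightarrow> f \<in> borel_measurable (lebesgue_on \<Omega>) \<and>
     integrable (lebesgue_on \<Omega>) (\<lambda>x. (norm (f x))\<^sup>2)"

definition L2norm :: "pt set \<Rightarrow> (pt \<Rightarrow> 'b::real_normed_vector) \<Rightarrow> real" where
  "L2norm \<Omega> f = sqrt (integral\<^sup>L (lebesgue_on \<Omega>) (\<lambda>x. (norm (f x))\<^sup>2))"

definition L2inner :: "pt set \<Rightarrow> (pt \<Rightarrow> 'b::real_inner) \<Rightarrow> (pt \<Rightarrow> 'b) \<Rightarrow> real" where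
  "L2inner \<Omega> f g = integral\<^sup>L (lebesgue_on \<Omega>) (\<lambda>x. inner (f x) (g x))"

definition tracefree :: "mat3 \<Rightarrow> bool" where
  "tracefree M \<longleftrightarrow> trace M = 0"

definition symm :: "mat3 \<Rightarrow> bool" where
  "symm M \<longleftrightarrow> transpose M = M"

definition eps :: "3 \<Rightarrow> 3 \<Rightarrow> 3 \<Rightarrow> real" where
  "eps i k l = (cross3 (axis k 1) (axis l 1)) $ i"

definition pd :: "3 \<Rightarrow> (pt \<Rightarrow> real) \<Rightarrow> pt \<Rightarrow> real" where
  "pd k \<phi> x = frechet_derivative \<phi> (at x) (axis k 1)"

fun pds :: "3 list \<Rightarrow> (pt \<Rightarrow> real) \<Rightarrow> pt \<Rightarrow> real" where
  "pds [] \<phi> = \<phi>"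
| "pds (k # ks) \<phi> = pd k (pds ks \<phi>)"

definition smooth :: "(pt \<Rightarrow> real) \<Rightarrow> bool" where
  "smooth \<phi> \<longleftrightarrow> (\<forall>ks x. pds ks \<phi> differentiable (at x))"

definition test :: "pt set \<Rightarrow> (pt \<Rightarrow> real) \<Rightarrow> bool" where
  "test \<Omega> \<phi> \<longleftrightarrow> smooth \<phi> \<and> compact (closure {x. \<phi> x \<noteq> 0}) \<and> closure {x. \<phi> x \<noteq> 0} \<subseteq> \<Omega>"

text \<open>Graph of d0 = dev grad (distributional), domain {v in L2(R^3) : dev grad v in L2(T)}.
  Distribution (dev grad v)_ij (phi) = - int v_j d_i phi + delta_ij/3 int sum_k v_k d_k phi.\<close>
definition is_d0 :: "pt set \<Rightarrow> (pt \<Rightarrow> real^3) \<Rightarrow> (pt \<Rightarrow> mat3) \<Rightarrow> bool" where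
  "is_d0 \<Omega> v G \<longleftrightarrow> L2 \<Omega> v \<and> L2 \<Omega> G \<and> (AE x in lebesgue_on \<Omega>. tracefree (G x)) \<and>
     (\<forall>\<phi>. test \<Omega> \<phi> \<longrightarrow> (\<forall>i j.
        integral\<^sup>L (lebesgue_on \<Omega>) (\<lambda>x. G x $ i $ j * \<phi> x) =
          - integral\<^sup>L (lebesgue_on \<Omega>) (\<lambda>x. v x $ j * pd i \<phi> x)
          + (if i = j then 1/3 else 0) *
              integral\<^sup>L (lebesgue_on \<Omega>) (\<lambda>x. \<Sum>k\<in>UNIV. v x $ k * pd k \<phi> x)))"

text \<open>Graph of d1 = sym curl (distributional), (curl A)_ij = eps_ikl d_k A_lj,
  domain {A in L2(T) : sym curl A in L2(S)}.\<close>
definition curl_distr :: "pt set \<Rightarrow> (pt \<Rightarrow> mat3) \<Rightarrow> 3 \<Rightarrow> 3 \<Rightarrow> (pt \<Rightarrow> real) \<Rightarrow> real" where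
  "curl_distr \<Omega> A i j \<phi> = (\<Sum>k\<in>UNIV. \<Sum>l\<in>UNIV.
      eps i k l * - integral\<^sup>L (lebesgue_on \<Omega>) (\<lambda>x. A x $ l $ j * pd k \<phi> x))"

definition is_d1 :: "pt set \<Rightarrow> (pt \<Rightarrow> mat3) \<Rightarrow> (pt \<Rightarrow> mat3) \<Rightarrow> bool" where
  "is_d1 \<Omega> A S \<longleftrightarrow> L2 \<Omega> A \<and> (AE x in lebesgue_on \<Omega>. tracefree (A x)) \<and>
     L2 \<Omega> S \<and> (AE x in lebesgue_on \<Omega>. symm (S x)) \<and>
     (\<forall>\<phi>. test \<Omega> \<phi> \<longrightarrow> (\<forall>i j.
        integral\<^sup>L (lebesgue_on \<Omega>) (\<lambda>x. S x $ i $ j * \<phi> x) =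
          (curl_distr \<Omega> A i j \<phi> + curl_distr \<Omega> A j i \<phi>) / 2))"

text \<open>Graph of d2 = div div (distributional), div div s = d_i d_j s_ji,
  domain {s in L2(S) : div div s in L2}.\<close>
definition is_d2 :: "pt set \<Rightarrow> (pt \<Rightarrow> mat3) \<Rightarrow> (pt \<Rightarrow> real) \<Rightarrow> bool" where
  "is_d2 \<Omega> \<sigma> r \<longleftrightarrow> L2 \<Omega> \<sigma> \<and> (AE x in lebesgue_on \<Omega>. symm (\<sigma> x)) \<and> L2 \<Omega> r \<and>
     (\<forall>\<phi>. test \<Omega> \<phi> \<longrightarrow>
        integral\<^sup>L (lebesgue_on \<Omega>) (\<lambda>x. r x * \<phi> x) =
          (\<Sum>i\<in>UNIV. \<Sum>j\<in>UNIV. integral\<^sup>L (lebesgue_on \<Omega>) (\<lambda>x. \<sigma> x $ j $ i * pd i (pd j \<phi>) x)))"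

definition is_d0adj :: "pt set \<Rightarrow> (pt \<Rightarrow> mat3) \<Rightarrow> (pt \<Rightarrow> real^3) \<Rightarrow> bool" where
  "is_d0adj \<Omega> w z \<longleftrightarrow> L2 \<Omega> w \<and> (AE x in lebesgue_on \<Omega>. tracefree (w x)) \<and> L2 \<Omega> z \<and>
     (\<forall>u du. is_d0 \<Omega> u du \<longrightarrow> L2inner \<Omega> du w = L2inner \<Omega> u z)"

definition is_d1adj :: "pt set \<Rightarrow> (pt \<Rightarrow> mat3) \<Rightarrow> (pt \<Rightarrow> mat3) \<Rightarrow> bool" where
  "is_d1adj \<Omega> w z \<longleftrightarrow> L2 \<Omega> w \<and> (AE x in lebesgue_on \<Omega>. symm (w x)) \<and>
     L2 \<Omega> z \<and> (AE x in lebesgue_on \<Omega>. tracefree (z x)) \<and>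
     (\<forall>u du. is_d1 \<Omega> u du \<longrightarrow> L2inner \<Omega> du w = L2inner \<Omega> u z)"

definition is_d2adj :: "pt set \<Rightarrow> (pt \<Rightarrow> real) \<Rightarrow> (pt \<Rightarrow> mat3) \<Rightarrow> bool" where
  "is_d2adj \<Omega> w z \<longleftrightarrow> L2 \<Omega> w \<and> L2 \<Omega> z \<and> (AE x in lebesgue_on \<Omega>. symm (z x)) \<and>
     (\<forall>u du. is_d2 \<Omega> u du \<longrightarrow> L2inner \<Omega> du w = L2inner \<Omega> u z)"

definition lam0 :: "(pt \<Rightarrow> xval) \<Rightarrow> pt \<Rightarrow> real^3" where "lam0 U = (\<lambda>x. fst (U x))"
definition compA :: "(pt \<Rightarrow> xval) \<Rightarrow> pt \<Rightarrow> mat3" where "compA U = (\<lambda>x. fst (snd (U x)))"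
definition compg :: "(pt \<Rightarrow> xval) \<Rightarrow> pt \<Rightarrow> mat3" where "compg U = (\<lambda>x. fst (snd (snd (U x))))"
definition lam3 :: "(pt \<Rightarrow> xval) \<Rightarrow> pt \<Rightarrow> real" where "lam3 U = (\<lambda>x. snd (snd (snd (U x))))"

definition inX :: "pt set \<Rightarrow> (pt \<Rightarrow> xval) \<Rightarrow> bool" where
  "inX \<Omega> U \<longleftrightarrow> L2 \<Omega> U \<and> (AE x in lebesgue_on \<Omega>. tracefree (compA U x) \<and> symm (compg U x))"

text \<open>Graph of L = J(d + d*) on D(L) = D(d) \<inter> D(d*):
  L U = (d0* A, - d0 lambda0 - d1* g, d1 A + d2* lambda3, - d2 g).\<close>
definition isL :: "pt set \<Rightarrow> (pt \<Rightarrow> xval) \<Rightarrow> (pt \<Rightarrow> xval) \<Rightarrow> bool" where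
  "isL \<Omega> U V \<longleftrightarrow> inX \<Omega> U \<and>
     (\<exists>G S r z0 z1 z2. is_d0 \<Omega> (lam0 U) G \<and> is_d1 \<Omega> (compA U) S \<and> is_d2 \<Omega> (compg U) r \<and>
        is_d0adj \<Omega> (compA U) z0 \<and> is_d1adj \<Omega> (compg U) z1 \<and> is_d2adj \<Omega> (lam3 U) z2 \<and>
        (AE x in lebesgue_on \<Omega>. V x = (z0 x, - G x - z1 x, S x + z2 x, - r x)))"

definition inDL :: "pt set \<Rightarrow> (pt \<Rightarrow> xval) \<Rightarrow> bool" where
  "inDL \<Omega> U \<longleftrightarrow> (\<exists>V. isL \<Omega> U V)"

definition DL_dense :: "pt set \<Rightarrow> bool" where
  "DL_dense \<Omega> \<longleftrightarrow> (\<forall>U. inX \<Omega> U \<longrightarrow> (\<forall>e>0. \<exists>W. inDL \<Omega> W \<and> L2norm \<Omega> (\<lambda>x. U x - W x) < e))"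

definition L2cont :: "pt set \<Rightarrow> real \<Rightarrow> (real \<Rightarrow> pt \<Rightarrow> 'b::real_normed_vector) \<Rightarrow> bool" where
  "L2cont \<Omega> T F \<longleftrightarrow> (\<forall>t\<in>{0..T}.
     ((\<lambda>s. L2norm \<Omega> (\<lambda>x. F s x - F t x)) \<longlongrightarrow> 0) (at t within {0..T}))"

definition L2deriv :: "pt set \<Rightarrow> real \<Rightarrow> (real \<Rightarrow> pt \<Rightarrow> 'b::real_normed_vector) \<Rightarrow> (real \<Rightarrow> pt \<Rightarrow> 'b) \<Rightarrow> bool" where
  "L2deriv \<Omega> T F F' \<longleftrightarrow> (\<forall>t\<in>{0..T}.
     ((\<lambda>s. L2norm \<Omega> (\<lambda>x. (1 / (s - t)) *\<^sub>R (F s x - F t x) - F' t x)) \<longlongrightarrow> 0) (at t within {0..T}))"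

text \<open>U in C^0([0,T]; D(L)) (graph norm).\<close>
definition C0_DL :: "pt set \<Rightarrow> real \<Rightarrow> (real \<Rightarrow> pt \<Rightarrow> xval) \<Rightarrow> bool" where
  "C0_DL \<Omega> T U \<longleftrightarrow> (\<exists>LU. (\<forall>t\<in>{0..T}. isL \<Omega> (U t) (LU t)) \<and> L2cont \<Omega> T U \<and> L2cont \<Omega> T LU)"

definition C1_X :: "pt set \<Rightarrow> real \<Rightarrow> (real \<Rightarrow> pt \<Rightarrow> xval) \<Rightarrow> bool" where
  "C1_X \<Omega> T U \<longleftrightarrow> (\<forall>t\<in>{0..T}. inX \<Omega> (U t)) \<and>
     (\<exists>U'. (\<forall>t\<in>{0..T}. inX \<Omega> (U' t)) \<and> L2deriv \<Omega> T U U' \<and> L2cont \<Omega> T U \<and> L2cont \<Omega> T U')"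

definition is_solution :: "pt set \<Rightarrow> real \<Rightarrow> (pt \<Rightarrow> xval) \<Rightarrow> (real \<Rightarrow> pt \<Rightarrow> xval) \<Rightarrow> bool" where
  "is_solution \<Omega> T U0 U \<longleftrightarrow> C0_DL \<Omega> T U \<and> C1_X \<Omega> T U \<and>
     (AE x in lebesgue_on \<Omega>. U 0 x = U0 x) \<and>
     (\<exists>U'. L2deriv \<Omega> T U U' \<and> (\<forall>t\<in>{0..T}. isL \<Omega> (U t) (U' t)))"

definition embed0 :: "(real \<Rightarrow> pt \<Rightarrow> mat3 \<times> mat3) \<Rightarrow> real \<Rightarrow> pt \<Rightarrow> xval" where
  "embed0 AG t x = (0, fst (AG t x), snd (AG t x), 0)"

definition is_reduced_solution :: "pt set \<Rightarrow> real \<Rightarrow> (pt \<Rightarrow> mat3) \<Rightarrow> (pt \<Rightarrow> mat3) \<Rightarrow>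
    (real \<Rightarrow> pt \<Rightarrow> mat3 \<times> mat3) \<Rightarrow> bool" where
  "is_reduced_solution \<Omega> T A0 g0 AG \<longleftrightarrow> C0_DL \<Omega> T (embed0 AG) \<and> C1_X \<Omega> T (embed0 AG) \<and>
     (AE x in lebesgue_on \<Omega>. AG 0 x = (A0 x, g0 x)) \<and>
     (\<exists>AG'. L2deriv \<Omega> T AG AG' \<and> (\<forall>t\<in>{0..T}.
        is_d0adj \<Omega> (\<lambda>x. fst (AG t x)) (\<lambda>x. 0) \<and>
        (\<exists>z1. is_d1adj \<Omega> (\<lambda>x. snd (AG t x)) z1 \<and>
              (AE x in lebesgue_on \<Omega>. fst (AG' t x) + z1 x = 0)) \<and>
        (\<exists>S. is_d1 \<Omega> (\<lambda>x. fst (AG t x)) S \<and>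
              (AE x in lebesgue_on \<Omega>. snd (AG' t x) - S x = 0)) \<and>
        is_d2 \<Omega> (\<lambda>x. snd (AG t x)) (\<lambda>x. 0)))"

end

theory Submission
  imports Defs
begin

text \<open>
  The relation \<open>L = J (d + d\<^sup>\<star>)\<close> is skew because \<open>J\<close> anticommutes with \<open>d\<close>, and \<open>1 - h L\<close> maps onto
  \<open>X\<close> for every \<open>h > 0\<close>: a vector \<open>w\<close> orthogonal to the range is tested with fields in the complements of
  the kernels of \<open>d\<close> and of \<open>d\<^sup>\<star>\<close>, where by \<open>d d = 0\<close> the other operator vanishes; this puts \<open>J w\<close>, hence
  \<open>w\<close>, into the domain of \<open>L\<close>, and skewness gives \<open>w = 0\<close>. Density of the domain makes \<open>L\<close> single valued,
  and the solution is the limit of the backward Euler scheme \<open>(1 - h L)\<^sup>-\<^sup>n U\<^sub>0\<close> with dyadic steps \<open>h\<close>.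
  Uniqueness is conservation of the norm. The constrained states (vanishing multipliers, \<open>d\<^sub>0\<^sup>\<star> A = 0\<close>,
  \<open>d\<^sub>2 g = 0\<close>) form a closed subspace that every resolvent preserves, so the flow preserves it.
\<close>

section \<open>Skew-adjoint evolution in a Hilbert space\<close>

text \<open>The operators are weak and defined up to null sets, so everything is done with graphs,
  that is, sets of pairs in a Hilbert space; an adjoint may a priori be multivalued.
  \<open>d\<close> is closed because it is cut out by testing against a family \<open>T\<close>, and
  the same description makes \<open>d\<close> the adjoint of \<open>ds\<close>
  (\<open>biadjoint\<close>), although test fields need not respect the trace-free or symmetric
  constraint. The range of \<open>1 - h L\<close> is closed because the values of \<open>d\<close>
  and of its adjoint at the same \<open>u\<close> are orthogonal, so the norm of
  \<open>u - h L u\<close> controls both parts separately. Dyadic steps are used because two steps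
  of size \<open>h/2\<close> differ from one step of size \<open>h\<close> only by order
  \<open>h\<^sup>2\<close> on the domain of \<open>L\<^sup>2\<close>, so the approximations have
  geometric increments there; contractivity, density and approximation in the graph norm carry the
  limit and its derivative over to the domain of \<open>L\<close>. All state spaces are closed
  subspaces of ambient quotient spaces of functions on the whole space, because a type cannot depend
  on \<Omega>.\<close>

lemma orthogonal_projection_exists:
  fixes S :: "'a::{real_inner,banach} set"
  assumes "closed S" "subspace S"
  obtains p where "p \<in> S" "\<And>k. k \<in> S \<Longrightarrow> inner (x - p) k = 0"
proof -
  define I where "I = (INF p\<in>S. (norm (x - p))\<^sup>2)"
  have ne: "S \<noteq> {}" using assms(2) subspace_0 by blast
  have bdd: "bdd_below ((\<lambda>p. (norm (x - p))\<^sup>2) ` S)" by (rule bdd_belowI[of _ 0]) auto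
  have I_le: "I \<le> (norm (x - p))\<^sup>2" if "p \<in> S" for p
    unfolding I_def by (rule cINF_lower[OF bdd that])
  have "\<exists>p\<in>S. (norm (x - p))\<^sup>2 < I + 1 / real (Suc n)" for n
    using cINF_less_iff[OF ne bdd, of "I + 1 / real (Suc n)"] unfolding I_def by simp
  then obtain p where p: "\<And>n. p n \<in> S" "\<And>n. (norm (x - p n))\<^sup>2 < I + 1 / real (Suc n)"
    by metis
  \<comment> \<open>The parallelogram identity for \<open>x - p n\<close> and
    \<open>x - p m\<close>: the midpoint again lies in \<open>S\<close>, so its squared distance to
    \<open>x\<close> is at least \<open>I\<close> and only the two errors remain.\<close>
  have par: "(norm (p n - p m))\<^sup>2 \<le> 2 / real (Suc n) + 2 / real (Suc m)" for n m
  proof -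
    have mid: "(1/2) *\<^sub>R (p n + p m) \<in> S"
      using p(1) assms(2) by (simp add: subspace_add subspace_scale)
    have "(norm (p n - p m))\<^sup>2 = 2 * (norm (x - p n))\<^sup>2 + 2 * (norm (x - p m))\<^sup>2
       - 4 * (norm (x - (1/2) *\<^sub>R (p n + p m)))\<^sup>2"
      by (simp add: power2_norm_eq_inner inner_diff inner_add inner_commute algebra_simps)
    then show ?thesis using p(2)[of n] p(2)[of m] I_le[OF mid] by simp
  qed
  have "Cauchy p"
  proof (rule metric_CauchyI)
    fix e :: real assume e: "e > 0"
    obtain N where N: "4 / e\<^sup>2 < real N" using reals_Archimedean2 by blast
    have "dist (p m) (p n) < e" if "m \<ge> N" "n \<ge> N" for m n
    proof -
      have N0: "0 < real N" using N e by (smt (verit) zero_less_divide_iff zero_less_power)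
      have "1 / real (Suc n) \<le> 1 / real N" "1 / real (Suc m) \<le> 1 / real N"
        using that N0 by (auto intro!: divide_left_mono)
      then have "(norm (p m - p n))\<^sup>2 \<le> 4 / real N" using par[of m n] by simp
      also have "\<dots> < e\<^sup>2" using N N0 e by (simp add: field_simps)
      finally show ?thesis using e by (simp add: dist_norm power2_less_imp_less)
    qed
    then show "\<exists>M. \<forall>m\<ge>M. \<forall>n\<ge>M. dist (p m) (p n) < e" by blast
  qed
  then obtain q where q: "p \<longlonglongrightarrow> q" using Cauchy_convergent convergent_def by blast
  have qS: "q \<in> S" using closed_sequentially[OF assms(1)] p(1) q by blast
  have "(\<lambda>n. (norm (x - p n))\<^sup>2) \<longlonglongrightarrow> (norm (x - q))\<^sup>2" by (intro tendsto_intros q)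
  moreover have "(\<lambda>n. I + 1 / real (Suc n)) \<longlonglongrightarrow> I + 0"
    by (intro tendsto_add tendsto_const) (rule LIMSEQ_Suc, rule lim_1_over_n)
  ultimately have qI: "(norm (x - q))\<^sup>2 \<le> I"
    using p(2) by (intro LIMSEQ_le[of "\<lambda>n. (norm (x - p n))\<^sup>2" _ "\<lambda>n. I + 1 / real (Suc n)"]) (auto intro: less_imp_le)
  have "inner (x - q) k = 0" if k: "k \<in> S" for k
  proof (cases "k = 0")
    case False
    \<comment> \<open>This \<open>t\<close> minimises the quadratic
      \<open>|x - q - t k|\<^sup>2\<close>; its minimum lies below the value at \<open>0\<close> by
      \<open>(inner (x - q) k)\<^sup>2 / |k|\<^sup>2\<close>.\<close>
    define t where "t = inner (x - q) k / (norm k)\<^sup>2"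
    have "q + t *\<^sub>R k \<in> S" using qS k assms(2) by (simp add: subspace_add subspace_scale)
    from I_le[OF this] qI have "(norm (x - q))\<^sup>2 \<le> (norm (x - (q + t *\<^sub>R k)))\<^sup>2" by linarith
    also have "x - (q + t *\<^sub>R k) = (x - q) - t *\<^sub>R k" by simp
    finally have "(norm (x - q))\<^sup>2 \<le> (norm ((x - q) - t *\<^sub>R k))\<^sup>2" .
    also have "\<dots> = (norm (x - q))\<^sup>2 - 2 * t * inner (x - q) k + t\<^sup>2 * (norm k)\<^sup>2"
      by (simp only: power2_norm_eq_inner) (simp add: inner_diff inner_commute power2_eq_square algebra_simps)
    also have "\<dots> = (norm (x - q))\<^sup>2 - (inner (x - q) k)\<^sup>2 / (norm k)\<^sup>2"
      using False unfolding t_def by (simp add: field_simps power2_eq_square)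
    finally have "(inner (x - q) k)\<^sup>2 / (norm k)\<^sup>2 \<le> 0" by simp
    then show ?thesis using False by (simp add: divide_le_0_iff)
  qed simp
  with qS show ?thesis using that by blast
qed

text \<open>Telescoping turns the increments into a summable series. It serves twice: for the Euler
  approximations at a fixed time, and for pointwise convergence of a fast subsequence in the
  completeness proof.\<close>

lemma geometric_increments_convergent:
  fixes x :: "nat \<Rightarrow> 'a::banach"
  assumes "\<And>m. norm (x (Suc m) - x m) \<le> C * (1/2) ^ m"
  shows "convergent x"
proof -
  have "summable (\<lambda>m. x (Suc m) - x m)"
    by (rule summable_comparison_test'[where g="\<lambda>m. C * (1/2)^m" and N=0])
       (use assms in \<open>auto intro!: summable_mult summable_geometric\<close>)
  then have "convergent (\<lambda>n. \<Sum>m<n. x (Suc m) - x m)" by (simp add: summable_iff_convergent)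
  then have "convergent (\<lambda>n. x n - x 0)" by (simp add: sum_lessThan_telescope)
  then have "convergent (\<lambda>n. (x n - x 0) + x 0)" by (intro convergent_add convergent_const)
  then show ?thesis by simp
qed

text \<open>The setting of a Lumer-Phillips or Stone type theorem, for the graph \<open>A\<close> of
  a generator: \<open>skew\<close> and \<open>range_A\<close> express dissipativity and maximality.
  \<open>K\<close> is a closed subspace of a larger type because the state space is cut out of an
  ambient space by pointwise constraints.\<close>

locale skew_generator =
  fixes K :: "'a::{real_inner,banach} set" and A :: "('a \<times> 'a) set"
  assumes closed_K: "closed K" and subspace_K: "subspace K"
    and subspace_A: "subspace A" and A_sub: "A \<subseteq> K \<times> K"
    and skew: "\<And>u v. (u, v) \<in> A \<Longrightarrow> inner u v = 0"
    and range_A: "\<And>h f. h > 0 \<Longrightarrow> f \<in> K \<Longrightarrow> \<exists>u v. (u, v) \<in> A \<and> u - h *\<^sub>R v = f"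
    and dense_A: "K \<subseteq> closure (fst ` A)"
begin

section \<open>Resolvents of a maximal skew graph\<close>

lemma A_add: "(u, v) \<in> A \<Longrightarrow> (u', v') \<in> A \<Longrightarrow> (u + u', v + v') \<in> A"
  using subspace_add[OF subspace_A] by fastforce

lemma A_scale: "(u, v) \<in> A \<Longrightarrow> (c *\<^sub>R u, c *\<^sub>R v) \<in> A"
  using subspace_scale[OF subspace_A] by fastforce

lemma A_diff: "(u, v) \<in> A \<Longrightarrow> (u', v') \<in> A \<Longrightarrow> (u - u', v - v') \<in> A"
  using subspace_diff[OF subspace_A] by fastforce

lemma A_K: "(u, v) \<in> A \<Longrightarrow> u \<in> K" "(u, v) \<in> A \<Longrightarrow> v \<in> K"
  using A_sub by auto

lemmas K_simps = subspace_add[OF subspace_K] subspace_diff[OF subspace_K] subspace_scale[OF subspace_K]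
  subspace_0[OF subspace_K]

lemma norm_resolvent_eq:
  assumes "(u, v) \<in> A"
  shows "(norm (u - h *\<^sub>R v))\<^sup>2 = (norm u)\<^sup>2 + h\<^sup>2 * (norm v)\<^sup>2"
  using skew[OF assms] unfolding power2_norm_eq_inner
  by (simp add: inner_diff inner_commute power2_eq_square)

lemma resolvent_contraction:
  assumes "(u, v) \<in> A"
  shows "norm u \<le> norm (u - h *\<^sub>R v)"
proof (rule power2_le_imp_le)
  show "(norm u)\<^sup>2 \<le> (norm (u - h *\<^sub>R v))\<^sup>2" by (simp add: norm_resolvent_eq[OF assms])
qed simp

text \<open>Skewness applied to \<open>(u, v) + (0, w)\<close> leaves \<open>inner u w = 0\<close>,
  so a value \<open>w\<close> over \<open>0\<close> is orthogonal to the dense domain and, lying in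
  \<open>K\<close>, to itself.\<close>

lemma A_single_valued:
  assumes "(u, y) \<in> A" "(u, z) \<in> A"
  shows "y = z"
proof -
  define w where "w = y - z"
  have w: "(0, w) \<in> A" using A_diff[OF assms] by (simp add: w_def)
  have orth: "inner u w = 0" if "u \<in> fst ` A" for u
  proof -
    from that obtain v where v: "(u, v) \<in> A" by force
    show ?thesis using skew[OF A_add[OF v w]] skew[OF v] by (simp add: inner_add)
  qed
  have "closed {u. inner u w = 0}" by (intro closed_Collect_eq continuous_intros)
  then have "closure (fst ` A) \<subseteq> {u. inner u w = 0}" using orth by (intro closure_minimal) auto
  moreover have "w \<in> K" using A_K[OF w] by simp
  ultimately have "inner w w = 0" using dense_A by auto
  then show ?thesis by (simp add: w_def)
qed

text \<open>The resolvent \<open>(1 - h A)\<^sup>-\<^sup>1\<close>, one backward Euler step. For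
  \<open>h > 0\<close> and \<open>f\<close> in \<open>K\<close>, \<open>range_A\<close> gives
  existence and \<open>resolvent_contraction\<close> uniqueness, so \<open>THE\<close> is
  meaningful.\<close>

definition R :: "real \<Rightarrow> 'a \<Rightarrow> 'a" where
  "R h f = (THE u. \<exists>v. (u, v) \<in> A \<and> u - h *\<^sub>R v = f)"

lemma R_eq:
  assumes "(u, v) \<in> A" "h > 0"
  shows "R h (u - h *\<^sub>R v) = u"
  unfolding R_def
proof (rule the_equality)
  show "\<exists>v'. (u, v') \<in> A \<and> u - h *\<^sub>R v' = u - h *\<^sub>R v" using assms by blast
next
  fix u' assume "\<exists>v'. (u', v') \<in> A \<and> u' - h *\<^sub>R v' = u - h *\<^sub>R v"
  then obtain v' where v': "(u', v') \<in> A" "u' - h *\<^sub>R v' = u - h *\<^sub>R v" by blast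
  have "norm (u' - u) \<le> norm ((u' - u) - h *\<^sub>R (v' - v))"
    by (rule resolvent_contraction[OF A_diff[OF v'(1) assms(1)]])
  also have "(u' - u) - h *\<^sub>R (v' - v) = 0" using v'(2) by (simp add: algebra_simps)
  finally show "u' = u" by simp
qed

lemma R_graph:
  assumes "h > 0" "f \<in> K"
  shows "(R h f, (1/h) *\<^sub>R (R h f - f)) \<in> A"
proof -
  obtain u v where uv: "(u, v) \<in> A" "u - h *\<^sub>R v = f" using range_A[OF assms] by blast
  have "R h f = u" using R_eq[OF uv(1) assms(1)] uv(2) by simp
  moreover have "(1/h) *\<^sub>R (u - f) = v" using uv(2) assms(1) by (auto simp: algebra_simps)
  ultimately show ?thesis using uv(1) by simp
qed

lemma R_K: "h > 0 \<Longrightarrow> f \<in> K \<Longrightarrow> R h f \<in> K"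
  using R_graph A_K by blast

lemma R_lin:
  assumes "h > 0" "f \<in> K" "g \<in> K"
  shows "R h (f + c *\<^sub>R g) = R h f + c *\<^sub>R R h g"
proof -
  have "R h ((R h f + c *\<^sub>R R h g) - h *\<^sub>R ((1/h) *\<^sub>R (R h f - f) + c *\<^sub>R (1/h) *\<^sub>R (R h g - g)))
      = R h f + c *\<^sub>R R h g"
    by (intro R_eq A_add A_scale R_graph assms)
  then show ?thesis using assms(1) by (simp add: algebra_simps)
qed

lemma R_diff:
  assumes "h > 0" "f \<in> K" "g \<in> K"
  shows "R h (f - g) = R h f - R h g"
  using R_lin[OF assms, of "-1"] by simp

lemma R_norm:
  assumes "h > 0" "f \<in> K"
  shows "norm (R h f) \<le> norm f"
  using resolvent_contraction[OF R_graph[OF assms], of h] assms(1) by (simp add: algebra_simps)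

lemma R_step:
  assumes "h > 0" "(u, v) \<in> A"
  shows "R h u - u = h *\<^sub>R R h v"
proof -
  have "u = R h (u + (- h) *\<^sub>R v)" using R_eq[OF assms(2,1)] by simp
  also have "\<dots> = R h u + (- h) *\<^sub>R R h v" by (rule R_lin) (use assms A_K in auto)
  finally have e: "u = R h u - h *\<^sub>R R h v" by simp
  show ?thesis by (subst (2) e) simp
qed

text \<open>The resolvent commutes with \<open>A\<close>: its value over \<open>R h u\<close> is
  \<open>(R h u - u) / h\<close>, which is \<open>R h v\<close> by \<open>R_step\<close>.\<close>

lemma R_A:
  assumes "h > 0" "(u, v) \<in> A"
  shows "(R h u, R h v) \<in> A"
  using R_graph[OF assms(1) A_K(1)[OF assms(2)]] R_step[OF assms] assms(1) by simp

text \<open>Since \<open>u n = R 1 (u n - v n)\<close> and \<open>R 1\<close> is a contraction, the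
  limit satisfies \<open>x = R 1 (x - y)\<close>, and \<open>R_graph\<close> returns the pair
  \<open>(x, y)\<close>. Maximality forces closedness.\<close>

lemma A_closed:
  assumes "\<And>n. (u n, v n) \<in> A" "u \<longlonglongrightarrow> x" "v \<longlonglongrightarrow> y"
  shows "(x, y) \<in> A"
proof -
  have K: "x \<in> K" "y \<in> K"
    using closed_sequentially[OF closed_K _ assms(2)] closed_sequentially[OF closed_K _ assms(3)]
      A_K assms(1) by blast+
  have "norm (u n - R 1 (x - y)) \<le> norm ((u n - v n) - (x - y))" for n
    using R_norm[of 1 "(u n - v n) - (x - y)"] R_diff[of 1 "u n - v n" "x - y"]
      R_eq[OF assms(1), of 1 n] K A_K[OF assms(1)[of n]] by (simp add: K_simps)
  moreover have "(\<lambda>n. norm ((u n - v n) - (x - y))) \<longlonglongrightarrow> norm ((x - y) - (x - y))"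
    by (intro tendsto_intros assms)
  ultimately have "(\<lambda>n. u n - R 1 (x - y)) \<longlonglongrightarrow> 0"
    by (intro Lim_null_comparison[of "\<lambda>n. u n - R 1 (x - y)" "\<lambda>n. norm ((u n - v n) - (x - y))"]) auto
  then have "u \<longlonglongrightarrow> R 1 (x - y)" by (rule LIM_zero_cancel)
  then have "R 1 (x - y) = x" using assms(2) LIMSEQ_unique by blast
  then show ?thesis using R_graph[of 1 "x - y"] K by (simp add: K_simps)
qed

text \<open>On the domain \<open>R h u - u = h R h v\<close> is of order \<open>h\<close>;
  contractivity and density extend the convergence to \<open>K\<close>.\<close>

lemma R_approx:
  assumes "f \<in> K" "e > 0"
  shows "\<exists>h0>0. \<forall>h. 0 < h \<and> h \<le> h0 \<longrightarrow> norm (R h f - f) < e"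
proof -
  have "f \<in> closure (fst ` A)" "e / 3 > 0" using dense_A assms by auto
  then obtain x where "x \<in> A" "dist (fst x) f < e / 3" unfolding closure_approachable by blast
  then obtain u v where uv: "(u, v) \<in> A" "dist u f < e / 3" by (cases x) auto
  \<comment> \<open>Chosen so that \<open>h0 * (norm v + 1) = e / 3\<close>; the added
    \<open>1\<close> keeps the denominator positive when \<open>v = 0\<close>.\<close>
  define h0 where "h0 = e / (3 * (norm v + 1))"
  have h0: "h0 > 0" using assms(2) by (simp add: h0_def add_nonneg_pos)
  moreover have "norm (R h f - f) < e" if h: "0 < h" "h \<le> h0" for h
  proof -
    have K: "u \<in> K" "v \<in> K" using A_K uv(1) by auto
    have "norm (h *\<^sub>R R h v) \<le> h0 * norm v"
      using h R_norm[OF h(1) K(2)] by (auto intro!: mult_mono)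
    also have "\<dots> \<le> h0 * (norm v + 1)" using h0 by simp
    also have "\<dots> = e / 3" unfolding h0_def using norm_ge_zero[of v]
      by (subst times_divide_eq_left, subst mult_divide_mult_cancel_right) linarith+
    finally have 1: "norm (R h u - u) \<le> e / 3" using R_step[OF h(1) uv(1)] by simp
    have 2: "norm (R h (f - u)) \<le> norm (f - u)" by (intro R_norm h K_simps K assms)
    have 3: "R h f - f = R h (f - u) + (R h u - u) - (f - u)"
      using R_diff[OF h(1) assms(1) K(1)] by simp
    have "norm (R h f - f) \<le> norm (R h (f - u)) + norm (R h u - u) + norm (f - u)"
      unfolding 3 by (intro norm_triangle_le_diff add_right_mono norm_triangle_ineq)
    then show ?thesis using 1 2 uv(2) by (simp add: dist_norm norm_minus_commute)
  qed
  ultimately show ?thesis by blast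
qed

text \<open>\<open>R h\<close> commutes with \<open>A\<close> and maps into its domain, so
  \<open>(R h v, R h w)\<close> is a smoothed pair whose second entry is again in the domain: the
  domain of the square of \<open>A\<close> is a core.\<close>

lemma graph_approx:
  assumes "(v, w) \<in> A" "e > 0"
  obtains v' w' z' where "(v', w') \<in> A" "(w', z') \<in> A" "norm (v' - v) < e" "norm (w' - w) < e"
proof -
  obtain h1 where h1: "h1 > 0" "\<And>h. 0 < h \<Longrightarrow> h \<le> h1 \<Longrightarrow> norm (R h v - v) < e"
    using R_approx[OF A_K(1)[OF assms(1)] assms(2)] by blast
  obtain h2 where h2: "h2 > 0" "\<And>h. 0 < h \<Longrightarrow> h \<le> h2 \<Longrightarrow> norm (R h w - w) < e"
    using R_approx[OF A_K(2)[OF assms(1)] assms(2)] by blast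
  define h where "h = min h1 h2"
  have h: "h > 0" using h1 h2 by (simp add: h_def)
  show ?thesis
    using that[OF R_A[OF h assms(1)] R_graph[OF h A_K(2)[OF assms(1)]]] h1(2)[of h] h2(2)[of h] h
    by (simp add: h_def)
qed

lemma dense_A2:
  assumes "f \<in> K" "e > 0"
  obtains v w z where "(v, w) \<in> A" "(w, z) \<in> A" "norm (v - f) < e"
proof -
  have "f \<in> closure (fst ` A)" "e / 2 > 0" using dense_A assms by auto
  then obtain x where "x \<in> A" "dist (fst x) f < e / 2" unfolding closure_approachable by blast
  then obtain u y where uy: "(u, y) \<in> A" "dist u f < e / 2" by (cases x) auto
  obtain v w z where "(v, w) \<in> A" "(w, z) \<in> A" "norm (v - u) < e / 2"
    using graph_approx[OF uy(1), of "e/2"] assms(2) half_gt_zero by metis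
  moreover from this uy(2) have "norm (v - f) < e"
    using norm_triangle_ineq[of "v - u" "u - f"] by (simp add: dist_norm)
  ultimately show ?thesis using that by blast
qed

section \<open>Backward Euler iterates: stability and consistency\<close>

abbreviation E :: "real \<Rightarrow> nat \<Rightarrow> 'a \<Rightarrow> 'a" where "E h n \<equiv> R h ^^ n"

lemma E_K: "h > 0 \<Longrightarrow> f \<in> K \<Longrightarrow> E h n f \<in> K"
  by (induction n) (auto simp: R_K)

lemma E_norm: "h > 0 \<Longrightarrow> f \<in> K \<Longrightarrow> norm (E h n f) \<le> norm f"
  by (induction n) (auto intro: order_trans[OF R_norm] simp: E_K)

lemma E_diff: "h > 0 \<Longrightarrow> f \<in> K \<Longrightarrow> g \<in> K \<Longrightarrow> E h n (f - g) = E h n f - E h n g"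
  by (induction n) (auto simp: R_diff E_K)

lemma E_A: "h > 0 \<Longrightarrow> (u, v) \<in> A \<Longrightarrow> (E h n u, E h n v) \<in> A"
  by (induction n) (auto simp: R_A)

text \<open>For \<open>r = R h v\<close> one has \<open>(1 - h/2 A)\<^sup>2 r = v + h\<^sup>2/4 A\<^sup>2 r\<close>.\<close>

lemma halving_one_step:
  assumes h: "h > 0" and A: "(v, w) \<in> A" "(w, z) \<in> A"
  shows "norm (R h v - R (h/2) (R (h/2) v)) \<le> h\<^sup>2 / 4 * norm z"
proof -
  have k: "h / 2 > 0" using h by simp
  define r rw rz where "r = R h v" and "rw = R h w" and "rz = R h z"
  have K: "v \<in> K" "w \<in> K" "z \<in> K" "rz \<in> K" using A A_K h by (auto simp: rz_def R_K)
  have rA: "(r, rw) \<in> A" "(rw, rz) \<in> A" using A h by (auto simp: r_def rw_def rz_def R_A)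
  define x where "x = r - (h/2) *\<^sub>R rw"
  have x: "R (h/2) x = r" unfolding x_def by (rule R_eq[OF rA(1) k])
  have xA: "(x, rw - (h/2) *\<^sub>R rz) \<in> A" unfolding x_def by (intro A_diff A_scale rA)
  have "x - (h/2) *\<^sub>R (rw - (h/2) *\<^sub>R rz) = v + (h\<^sup>2/4) *\<^sub>R rz"
  proof -
    have "x - (h/2) *\<^sub>R (rw - (h/2) *\<^sub>R rz) = (r - h *\<^sub>R rw) + (h\<^sup>2/4) *\<^sub>R rz"
      using scaleR_add_left[of "h/2" "h/2" rw] unfolding x_def
      by (simp add: scaleR_diff_right power2_eq_square)
    moreover have "r - h *\<^sub>R rw = v" using R_step[OF h A(1)] by (simp add: r_def rw_def algebra_simps)
    ultimately show ?thesis by simp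
  qed
  then have "R (h/2) (v + (h\<^sup>2/4) *\<^sub>R rz) = x" using R_eq[OF xA k] by simp
  then have "x = R (h/2) v + (h\<^sup>2/4) *\<^sub>R R (h/2) rz" using R_lin[OF k K(1,4)] by simp
  then have "r = R (h/2) (R (h/2) v) + (h\<^sup>2/4) *\<^sub>R R (h/2) (R (h/2) rz)"
    using x R_lin[OF k R_K[OF k K(1)] R_K[OF k K(4)]] by simp
  then have "norm (R h v - R (h/2) (R (h/2) v)) = h\<^sup>2/4 * norm (R (h/2) (R (h/2) rz))"
    by (simp add: r_def)
  also have "norm (R (h/2) (R (h/2) rz)) \<le> norm z"
    unfolding rz_def by (meson K R_K R_norm k h order_trans)
  finally show ?thesis by (simp add: mult_left_mono)
qed

text \<open>The local errors of \<open>halving_one_step\<close> add up because the resolvent does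
  not amplify earlier errors. Each local bound keeps the constant \<open>norm z\<close>, since
  \<open>E h n\<close> commutes with \<open>A\<close> and is a contraction. With \<open>n h\<close>
  bounded the total is of order \<open>h\<close>.\<close>

lemma halving_steps:
  assumes h: "h > 0" and A: "(v, w) \<in> A" "(w, z) \<in> A"
  shows "norm (E h n v - E (h/2) (2 * n) v) \<le> real n * (h\<^sup>2 / 4 * norm z)"
proof (induction n)
  case (Suc n)
  have k: "h / 2 > 0" using h by simp
  have K: "v \<in> K" "w \<in> K" "z \<in> K" using A A_K by auto
  define x y where "x = E h n v" and "y = E (h/2) (2 * n) v"
  have xy: "x \<in> K" "y \<in> K" using K h by (auto simp: x_def y_def E_K)
  have 1: "norm (R h x - R (h/2) (R (h/2) x)) \<le> h\<^sup>2 / 4 * norm z"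
    using order_trans[OF halving_one_step[OF h E_A[OF h A(1)] E_A[OF h A(2)], of n]
      mult_left_mono[OF E_norm[OF h K(3), of n]]] by (simp add: x_def)
  have 2: "norm (R (h/2) (R (h/2) x) - R (h/2) (R (h/2) y)) \<le> norm (x - y)"
    using E_norm[OF k K_simps(2)[OF xy], of 2] E_diff[OF k xy, of 2] by (simp add: numeral_2_eq_2)
  have "E h (Suc n) v - E (h/2) (2 * Suc n) v
      = (R h x - R (h/2) (R (h/2) x)) + (R (h/2) (R (h/2) x) - R (h/2) (R (h/2) y))"
    by (simp add: x_def y_def)
  then have "norm (E h (Suc n) v - E (h/2) (2 * Suc n) v) \<le> h\<^sup>2 / 4 * norm z + norm (x - y)"
    using 1 2 by (metis add_mono norm_triangle_le)
  then show ?case using Suc by (simp add: x_def y_def algebra_simps)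
qed simp

text \<open>Each step moves by \<open>h\<close> times a resolvent of \<open>E h (n + j) w\<close>,
  and contractivity bounds this by \<open>h * norm w\<close>.\<close>

lemma E_lipschitz:
  assumes h: "h > 0" and A: "(v, w) \<in> A"
  shows "norm (E h (n + j) v - E h n v) \<le> real j * h * norm w"
proof (induction j)
  case (Suc j)
  have "E h (n + Suc j) v - E h (n + j) v = h *\<^sub>R R h (E h (n + j) w)"
    using R_step[OF h E_A[OF h A]] by simp
  moreover have "norm (R h (E h (n + j) w)) \<le> norm w"
    using E_norm[OF h A_K(2)[OF A], of "Suc (n + j)"] by simp
  ultimately have "norm (E h (n + Suc j) v - E h (n + j) v) \<le> h * norm w" using h by simp
  moreover have "norm (E h (n + Suc j) v - E h n v)
      \<le> norm (E h (n + Suc j) v - E h (n + j) v) + norm (E h (n + j) v - E h n v)"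
    using norm_triangle_ineq[of "E h (n + Suc j) v - E h (n + j) v" "E h (n + j) v - E h n v"] by simp
  ultimately show ?case using Suc by (simp add: algebra_simps)
qed simp

text \<open>A discrete Taylor formula whose remainder depends only on the elapsed time
  \<open>j h\<close>, so it survives the refinement of the grid. Step \<open>j + 1\<close>
  contributes \<open>h\<close> times the drift of \<open>E h (n + j + 1) w\<close> from
  \<open>E h n w\<close>, which \<open>E_lipschitz\<close> bounds.\<close>

lemma E_taylor:
  assumes h: "h > 0" and A: "(v, w) \<in> A" "(w, z) \<in> A"
  shows "norm (E h (n + j) v - E h n v - (real j * h) *\<^sub>R E h n w) \<le> (real j * h)\<^sup>2 * norm z"
proof (induction j)
  case (Suc j)
  have "E h (n + Suc j) v - E h (n + j) v = h *\<^sub>R E h (n + Suc j) w"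
    using R_step[OF h E_A[OF h A(1)]] by simp
  then have eq: "E h (n + Suc j) v - E h n v - (real (Suc j) * h) *\<^sub>R E h n w
     = (E h (n + j) v - E h n v - (real j * h) *\<^sub>R E h n w) + h *\<^sub>R (E h (n + Suc j) w - E h n w)"
    by (simp add: algebra_simps)
  have "norm (h *\<^sub>R (E h (n + Suc j) w - E h n w)) \<le> h * (real (Suc j) * h * norm z)"
    using E_lipschitz[OF h A(2), of n "Suc j"] h by simp
  then have "norm (E h (n + Suc j) v - E h n v - (real (Suc j) * h) *\<^sub>R E h n w)
     \<le> (real j * h)\<^sup>2 * norm z + h * (real (Suc j) * h * norm z)"
    unfolding eq using Suc by (meson add_mono norm_triangle_le)
  also have "\<dots> = ((real j)\<^sup>2 + real (Suc j)) * (h\<^sup>2 * norm z)"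
    by (simp add: power2_eq_square algebra_simps)
  \<comment> \<open>The recursion closes because
    \<open>j\<^sup>2 + (j + 1) \<le> (j + 1)\<^sup>2\<close>.\<close>
  also have "\<dots> \<le> (real (Suc j))\<^sup>2 * (h\<^sup>2 * norm z)"
    by (intro mult_right_mono mult_nonneg_nonneg) (auto simp: power2_eq_square algebra_simps)
  finally show ?case by (simp add: power_mult_distrib mult.assoc)
qed simp

section \<open>The limit of the dyadic Euler approximations\<close>

definition euler :: "nat \<Rightarrow> real \<Rightarrow> 'a \<Rightarrow> 'a" where
  "euler m t = E (1 / 2 ^ m) (nat \<lfloor>t * 2 ^ m\<rfloor>)"

definition S :: "real \<Rightarrow> 'a \<Rightarrow> 'a" where
  "S t f = lim (\<lambda>m. euler m t f)"

lemma euler_norm: "f \<in> K \<Longrightarrow> norm (euler m t f) \<le> norm f"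
  by (simp add: euler_def E_norm)

lemma euler_diff: "f \<in> K \<Longrightarrow> g \<in> K \<Longrightarrow> euler m t (f - g) = euler m t f - euler m t g"
  by (simp add: euler_def E_diff)

lemma euler_A: "(u, v) \<in> A \<Longrightarrow> (euler m t u, euler m t v) \<in> A"
  by (simp add: euler_def E_A)

lemma nat_floor_double:
  fixes x :: real
  assumes "x \<ge> 0"
  shows "nat \<lfloor>2 * x\<rfloor> = 2 * nat \<lfloor>x\<rfloor> \<or> nat \<lfloor>2 * x\<rfloor> = 2 * nat \<lfloor>x\<rfloor> + 1"
proof -
  have "\<lfloor>2 * x\<rfloor> = 2 * \<lfloor>x\<rfloor> \<or> \<lfloor>2 * x\<rfloor> = 2 * \<lfloor>x\<rfloor> + 1" by linarith
  then show ?thesis using assms by (auto simp: nat_mult_distrib nat_add_distrib)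
qed

text \<open>Dyadic grids are nested: at level \<open>m + 1\<close> the grid index is
  \<open>2 n\<close> or \<open>2 n + 1\<close>. \<open>halving_steps\<close> compares
  \<open>n\<close> coarse steps with \<open>2 n\<close> fine ones, and a possible extra fine step
  costs at most \<open>h / 2 * norm w\<close>; these are the two terms of the bound.\<close>

lemma euler_increment:
  assumes A: "(v, w) \<in> A" "(w, z) \<in> A" and t: "t \<ge> 0"
  shows "norm (euler (Suc m) t v - euler m t v) \<le> (t * norm z + norm w) * (1/2) ^ m"
proof -
  define h :: real where "h = 1 / 2 ^ m"
  have h: "h > 0" "h / 2 > 0" by (auto simp: h_def)
  define n where "n = nat \<lfloor>t * 2 ^ m\<rfloor>"
  define n' where "n' = nat \<lfloor>t * 2 ^ Suc m\<rfloor>"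
  have e: "euler m t v = E h n v" "euler (Suc m) t v = E (h/2) n' v"
    by (auto simp: euler_def h_def n_def n'_def mult.commute)
  have n': "n' = 2 * n + 0 \<or> n' = 2 * n + 1"
    using nat_floor_double[of "t * 2 ^ m"] t by (simp add: n_def n'_def mult.left_commute)
  have "real n * h \<le> t" using t by (simp add: n_def h_def field_simps of_nat_floor)
  then have "(real n * h) * (h / 4 * norm z) \<le> t * (h * norm z)"
    using h t by (intro mult_mono mult_right_mono) auto
  then have "real n * (h\<^sup>2 / 4 * norm z) \<le> t * h * norm z"
    by (simp add: power2_eq_square mult.assoc)
  then have 1: "norm (E h n v - E (h/2) (2 * n) v) \<le> t * h * norm z"
    using halving_steps[OF h(1) A, of n] by linarith
  have 2: "norm (E (h/2) n' v - E (h/2) (2 * n) v) \<le> h * norm w"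
    using n'
  proof
    assume "n' = 2 * n + 1"
    with E_lipschitz[OF h(2) A(1), of "2 * n" 1]
    have "norm (E (h/2) n' v - E (h/2) (2 * n) v) \<le> h / 2 * norm w" by simp
    also have "\<dots> \<le> h * norm w" using h by (intro mult_right_mono) auto
    finally show ?thesis .
  qed (use h in simp)
  have "norm (euler (Suc m) t v - euler m t v)
     \<le> norm (E (h/2) n' v - E (h/2) (2 * n) v) + norm (E h n v - E (h/2) (2 * n) v)"
    unfolding e using norm_triangle_ineq4[of "E (h/2) n' v - E (h/2) (2 * n) v" "E h n v - E (h/2) (2 * n) v"] by simp
  also have "\<dots> \<le> h * norm w + t * h * norm z" using 1 2 by linarith
  also have "\<dots> = (t * norm z + norm w) * (1/2) ^ m"
    by (simp add: h_def power_one_over algebra_simps add_divide_distrib)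
  finally show ?thesis .
qed

text \<open>Vectors in the domain of the square of \<open>A\<close> have geometric increments;
  contractivity, uniform in \<open>m\<close>, transfers the Cauchy property to all of
  \<open>K\<close>.\<close>

lemma euler_convergent:
  assumes f: "f \<in> K" and t: "t \<ge> 0"
  shows "convergent (\<lambda>m. euler m t f)"
proof (rule Cauchy_convergent, rule metric_CauchyI)
  fix e :: real assume e: "e > 0"
  obtain v w z where v: "(v, w) \<in> A" "(w, z) \<in> A" "norm (v - f) < e / 3"
    using dense_A2[OF f, of "e/3"] e by auto
  have "convergent (\<lambda>m. euler m t v)"
    by (rule geometric_increments_convergent[OF euler_increment[OF v(1,2) t]])
  then obtain M where M: "\<And>m n. m \<ge> M \<Longrightarrow> n \<ge> M \<Longrightarrow> dist (euler m t v) (euler n t v) < e / 3"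
    using convergent_Cauchy metric_CauchyD[of "\<lambda>m. euler m t v" "e/3"] e by (metis divide_pos_pos zero_less_numeral)
  have c: "dist (euler m t v) (euler m t f) < e / 3" for m
    using euler_diff[OF A_K(1)[OF v(1)] f] euler_norm[of "v - f" m t] v A_K f
    by (smt (verit) K_simps(2) dist_norm)
  have "dist (euler m t f) (euler n t f) < e" if "m \<ge> M" "n \<ge> M" for m n
    using M[OF that] c[of m] c[of n]
    using dist_triangle[of "euler m t f" "euler n t f" "euler m t v"] dist_triangle[of "euler m t v" "euler n t f" "euler n t v"]
    by (simp add: dist_commute)
  then show "\<exists>M. \<forall>m\<ge>M. \<forall>n\<ge>M. dist (euler m t f) (euler n t f) < e" by blast
qed

lemma S_lim: "f \<in> K \<Longrightarrow> t \<ge> 0 \<Longrightarrow> (\<lambda>m. euler m t f) \<longlonglongrightarrow> S t f"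
  unfolding S_def using euler_convergent convergent_LIMSEQ_iff by blast

lemma S_closed_invariant:
  assumes "closed N" "N \<subseteq> K" "\<And>h x. h > 0 \<Longrightarrow> x \<in> N \<Longrightarrow> R h x \<in> N" "f \<in> N" "t \<ge> 0"
  shows "S t f \<in> N"
proof -
  have "E h n f \<in> N" if "h > 0" for h n
    by (induction n) (auto simp: assms that)
  then have "euler m t f \<in> N" for m by (simp add: euler_def)
  moreover have "(\<lambda>m. euler m t f) \<longlonglongrightarrow> S t f" using assms by (intro S_lim) auto
  ultimately show ?thesis by (rule closed_sequentially[OF assms(1)])
qed

lemma S_norm:
  assumes "f \<in> K" "t \<ge> 0" shows "norm (S t f) \<le> norm f"
  by (rule LIMSEQ_le_const2[OF tendsto_norm[OF S_lim[OF assms]]]) (auto simp: euler_norm assms)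

lemma S_diff:
  assumes "f \<in> K" "g \<in> K" "t \<ge> 0" shows "S t (f - g) = S t f - S t g"
proof (rule LIMSEQ_unique[OF S_lim])
  show "(\<lambda>m. euler m t (f - g)) \<longlonglongrightarrow> S t f - S t g"
    unfolding euler_diff[OF assms(1,2)] by (intro tendsto_diff S_lim assms)
qed (use assms K_simps in auto)

text \<open>\<open>A\<close> commutes with each approximation and is closed, so the limit pair stays
  in the graph.\<close>

lemma S_A: "(u, v) \<in> A \<Longrightarrow> t \<ge> 0 \<Longrightarrow> (S t u, S t v) \<in> A"
  by (rule A_closed[OF euler_A S_lim S_lim]) (auto dest: A_K)

lemma S_0: "S 0 f = f"
  by (simp add: S_def euler_def)

lemma floor_dyadic_tendsto: 
  assumes "t \<ge> 0" shows "(\<lambda>m. real (nat \<lfloor>t * 2 ^ m\<rfloor>) * (1 / 2 ^ m)) \<longlonglongrightarrow> t"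
proof (rule tendsto_sandwich[of "\<lambda>m. t - (1/2)^m" _ _ "\<lambda>m. t"])
  show "(\<lambda>m. t - (1/2::real)^m) \<longlonglongrightarrow> t"
    using tendsto_diff[OF tendsto_const LIMSEQ_realpow_zero[of "1/2::real"], of t] by simp
  have "t * 2 ^ m - 1 \<le> real (nat \<lfloor>t * 2 ^ m\<rfloor>)" for m using assms by linarith
  then have "(t * 2 ^ m - 1) * (1 / 2 ^ m) \<le> real (nat \<lfloor>t * 2 ^ m\<rfloor>) * (1 / 2 ^ m)" for m
    by (intro mult_right_mono) auto
  then show "\<forall>\<^sub>F m in sequentially. t - (1/2)^m \<le> real (nat \<lfloor>t * 2 ^ m\<rfloor>) * (1 / 2 ^ m)"
    by (simp add: diff_divide_distrib power_one_over)
  have "real (nat \<lfloor>t * 2 ^ m\<rfloor>) \<le> t * 2 ^ m" for m using assms by (simp add: of_nat_floor)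
  then show "\<forall>\<^sub>F m in sequentially. real (nat \<lfloor>t * 2 ^ m\<rfloor>) * (1 / 2 ^ m) \<le> t"
    by (simp add: divide_le_eq)
qed simp

text \<open>Puts the approximations at two times on one grid, \<open>j m\<close> steps apart, so
  that \<open>E_lipschitz\<close> and \<open>E_taylor\<close> pass to the limit with elapsed time
  \<open>t - s\<close>.\<close>

lemma euler_at_later_time:
  assumes "0 \<le> s" "s \<le> t"
  obtains j :: "nat \<Rightarrow> nat" where "\<And>m. euler m t = E (1 / 2 ^ m) (nat \<lfloor>s * 2 ^ m\<rfloor> + j m)"
    "(\<lambda>m. real (j m) * (1 / 2 ^ m)) \<longlonglongrightarrow> t - s"
proof
  define j where "j m = nat \<lfloor>t * 2 ^ m\<rfloor> - nat \<lfloor>s * 2 ^ m\<rfloor>" for m :: nat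
  have le: "nat \<lfloor>s * 2 ^ m\<rfloor> \<le> nat \<lfloor>t * 2 ^ m\<rfloor>" for m
    using assms by (intro nat_mono floor_mono) simp
  show "euler m t = E (1 / 2 ^ m) (nat \<lfloor>s * 2 ^ m\<rfloor> + j m)" for m
    using le[of m] by (simp add: euler_def j_def)
  have "(\<lambda>m. real (nat \<lfloor>t * 2 ^ m\<rfloor>) * (1 / 2 ^ m) - real (nat \<lfloor>s * 2 ^ m\<rfloor>) * (1 / 2 ^ m)) \<longlonglongrightarrow> t - s"
    using assms by (intro tendsto_diff floor_dyadic_tendsto) auto
  then show "(\<lambda>m. real (j m) * (1 / 2 ^ m)) \<longlonglongrightarrow> t - s"
    using le by (simp add: j_def of_nat_diff left_diff_distrib diff_divide_distrib)
qed

lemma S_lipschitz_ordered: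
  assumes A: "(v, w) \<in> A" and s: "0 \<le> s" "s \<le> t"
  shows "norm (S t v - S s v) \<le> (t - s) * norm w"
proof -
  obtain j where j: "\<And>m. euler m t = E (1 / 2 ^ m) (nat \<lfloor>s * 2 ^ m\<rfloor> + j m)"
    "(\<lambda>m. real (j m) * (1 / 2 ^ m)) \<longlonglongrightarrow> t - s" using euler_at_later_time[OF s] by blast
  show ?thesis
  proof (rule LIMSEQ_le)
    show "(\<lambda>m. norm (euler m t v - euler m s v)) \<longlonglongrightarrow> norm (S t v - S s v)"
      using A_K(1)[OF A] s by (intro tendsto_intros S_lim) auto
    show "(\<lambda>m. real (j m) * (1 / 2 ^ m) * norm w) \<longlonglongrightarrow> (t - s) * norm w"
      by (intro tendsto_intros j(2))
    have "norm (euler m t v - euler m s v) \<le> real (j m) * (1 / 2 ^ m) * norm w" for m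
      unfolding j(1) unfolding euler_def by (rule E_lipschitz[OF _ A]) simp
    then show "\<exists>N. \<forall>n\<ge>N. norm (euler n t v - euler n s v) \<le> real (j n) * (1 / 2 ^ n) * norm w" by blast
  qed
qed

lemma S_lipschitz:
  assumes A: "(v, w) \<in> A" and "0 \<le> s" "0 \<le> t"
  shows "norm (S t v - S s v) \<le> \<bar>t - s\<bar> * norm w"
  using S_lipschitz_ordered[OF A, of s t] S_lipschitz_ordered[OF A, of t s] assms
  by (cases "s \<le> t") (auto simp: norm_minus_commute)

lemma S_taylor_forward:
  assumes A: "(v, w) \<in> A" "(w, z) \<in> A" and s: "0 \<le> s" "s \<le> t"
  shows "norm (S t v - S s v - (t - s) *\<^sub>R S s w) \<le> (t - s)\<^sup>2 * norm z"
proof -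
  obtain j where j: "\<And>m. euler m t = E (1 / 2 ^ m) (nat \<lfloor>s * 2 ^ m\<rfloor> + j m)"
    "(\<lambda>m. real (j m) * (1 / 2 ^ m)) \<longlonglongrightarrow> t - s" using euler_at_later_time[OF s] by blast
  show ?thesis
  proof (rule LIMSEQ_le)
    show "(\<lambda>m. norm (euler m t v - euler m s v - (real (j m) * (1 / 2 ^ m)) *\<^sub>R euler m s w))
        \<longlonglongrightarrow> norm (S t v - S s v - (t - s) *\<^sub>R S s w)"
      using A_K[OF A(1)] s by (intro tendsto_intros S_lim j(2)) auto
    show "(\<lambda>m. (real (j m) * (1 / 2 ^ m))\<^sup>2 * norm z) \<longlonglongrightarrow> (t - s)\<^sup>2 * norm z"
      by (intro tendsto_intros j(2))
    have "norm (euler m t v - euler m s v - (real (j m) * (1 / 2 ^ m)) *\<^sub>R euler m s w)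
        \<le> (real (j m) * (1 / 2 ^ m))\<^sup>2 * norm z" for m
      unfolding j(1) unfolding euler_def by (rule E_taylor[OF _ A]) simp
    then show "\<exists>N. \<forall>n\<ge>N. norm (euler n t v - euler n s v - (real (j n) * (1 / 2 ^ n)) *\<^sub>R euler n s w)
        \<le> (real (j n) * (1 / 2 ^ n))\<^sup>2 * norm z" by blast
  qed
qed

text \<open>For \<open>t < s\<close> the forward expansion is taken at the earlier time
  \<open>t\<close>, and replacing \<open>S t w\<close> by \<open>S s w\<close> costs another
  \<open>(t - s)\<^sup>2 * norm z\<close> by the Lipschitz bound for \<open>w\<close>; hence the
  factor \<open>2\<close>.\<close>

lemma S_taylor:
  assumes A: "(v, w) \<in> A" "(w, z) \<in> A" and s: "0 \<le> s" "0 \<le> t"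
  shows "norm (S t v - S s v - (t - s) *\<^sub>R S s w) \<le> 2 * (t - s)\<^sup>2 * norm z"
proof (cases "s \<le> t")
  case True
  have "(t - s)\<^sup>2 * norm z \<le> 2 * ((t - s)\<^sup>2 * norm z)" by simp
  then show ?thesis using S_taylor_forward[OF A s(1) True] by linarith
next
  case False
  have "S t v - S s v - (t - s) *\<^sub>R S s w
      = (s - t) *\<^sub>R (S s w - S t w) - (S s v - S t v - (s - t) *\<^sub>R S t w)"
    by (simp add: algebra_simps)
  also have "norm \<dots> \<le> norm ((s - t) *\<^sub>R (S s w - S t w)) + norm (S s v - S t v - (s - t) *\<^sub>R S t w)"
    by (rule norm_triangle_ineq4)
  also have "\<dots> \<le> \<bar>s - t\<bar> * (\<bar>s - t\<bar> * norm z) + (s - t)\<^sup>2 * norm z"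
    using S_lipschitz[OF A(2) s(2,1)] S_taylor_forward[OF A s(2), of s] False
    by (intro add_mono) (auto intro!: mult_left_mono)
  also have "\<dots> = 2 * (t - s)\<^sup>2 * norm z"
    using False by (simp add: power2_eq_square algebra_simps)
  finally show ?thesis .
qed

lemma S_continuous:
  assumes f: "f \<in> K"
  shows "continuous_on {0..} (\<lambda>t. S t f)"
  unfolding continuous_on_iff
proof (intro ballI allI impI)
  fix s e :: real assume s: "s \<in> {0..}" and e: "e > 0"
  obtain v w z where v: "(v, w) \<in> A" "norm (v - f) < e / 3"
    using dense_A2[OF f, of "e/3"] e by (metis divide_pos_pos zero_less_numeral)
  define d where "d = e / (3 * (norm w + 1))"
  have pos: "norm w + 1 > 0" by (simp add: add_nonneg_pos)
  have d: "d > 0" using e pos by (simp add: d_def)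
  have d': "d * (norm w + 1) = e / 3"
    unfolding d_def using pos by (subst times_divide_eq_left, subst mult_divide_mult_cancel_right) linarith+
  have "dist (S t f) (S s f) < e" if t: "t \<in> {0..}" "dist t s < d" for t
  proof -
    have near: "norm (S r v - S r f) < e / 3" if "r \<ge> 0" for r
      using S_diff[OF A_K(1)[OF v(1)] f that] S_norm[OF K_simps(2)[OF A_K(1)[OF v(1)] f] that] v(2) by simp
    have "\<bar>t - s\<bar> * norm w \<le> d * (norm w + 1)"
      using t d by (intro mult_mono) (auto simp: dist_real_def)
    then have "norm (S t v - S s v) \<le> e / 3" using S_lipschitz[OF v(1), of s t] s t d' by auto
    then show ?thesis using near[of t] near[of s] s t
      dist_triangle[of "S t f" "S s f" "S t v"] dist_triangle[of "S t v" "S s f" "S s v"]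
      by (simp add: dist_norm norm_minus_commute)
  qed
  then show "\<exists>d>0. \<forall>x'\<in>{0..}. dist x' s < d \<longrightarrow> dist (S x' f) (S s f) < e" using d by blast
qed

text \<open>The quadratic remainder requires \<open>w\<close> in the domain, so
  \<open>(v, w)\<close> is replaced by a pair close to it in the graph norm. The Lipschitz bound
  controls the increment of \<open>v - v'\<close> by \<open>\<bar>t - s\<bar>\<close> times
  \<open>norm (w - w')\<close>, which is what a difference quotient tolerates.\<close>

lemma S_has_vector_derivative:
  assumes A: "(v, w) \<in> A" and s: "s \<ge> 0"
  shows "((\<lambda>t. S t v) has_vector_derivative S s w) (at s within {0..})"
  unfolding has_vector_derivative_def has_derivative_within_alt
proof (intro conjI allI impI)
  show "bounded_linear (\<lambda>x. x *\<^sub>R S s w)" by (rule bounded_linear_scaleR_left)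
  fix e :: real assume e: "e > 0"
  obtain v' w' z' where a: "(v', w') \<in> A" "(w', z') \<in> A" "norm (w' - w) < e / 4"
    using graph_approx[OF A, of "e/4"] e by (metis divide_pos_pos zero_less_numeral)
  have pos: "norm z' + 1 > 0" by (simp add: add_nonneg_pos)
  \<comment> \<open>The budget \<open>e\<close> is spent as \<open>e/4\<close> on the increment of
    \<open>v - v'\<close>, \<open>e/4\<close> on the term with \<open>S s (w - w')\<close>, and
    \<open>2 * (e/4)\<close> on the Taylor remainder with its factor \<open>2\<close>.\<close>
  define d where "d = e / (4 * (norm z' + 1))"
  have d: "d > 0" using e pos by (simp add: d_def)
  have d': "d * (norm z' + 1) = e / 4"
    unfolding d_def using pos by (subst times_divide_eq_left, subst mult_divide_mult_cancel_right) linarith+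
  have K: "v \<in> K" "w \<in> K" "v' \<in> K" "w' \<in> K" using A_K A a by blast+
  have dA: "(v - v', w - w') \<in> A" by (rule A_diff[OF A a(1)])
  have "norm (S t v - S s v - (t - s) *\<^sub>R S s w) \<le> e * norm (t - s)"
    if t: "t \<ge> 0" "norm (t - s) < d" for t
  proof -
    have 1: "norm (S t (v - v') - S s (v - v')) \<le> \<bar>t - s\<bar> * (e/4)"
      using S_lipschitz[OF dA s t(1)] a(3)
      by (smt (verit) mult_left_mono norm_minus_commute abs_ge_zero)
    have "norm (S s (w - w')) \<le> e / 4"
      using S_norm[OF K_simps(2)[OF K(2,4)] s] a(3) by (simp add: norm_minus_commute)
    then have 2: "norm ((t - s) *\<^sub>R S s (w - w')) \<le> \<bar>t - s\<bar> * (e/4)"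
      unfolding norm_scaleR by (intro mult_left_mono) auto
    have "\<bar>t - s\<bar> * norm z' \<le> d * (norm z' + 1)" using t d by (intro mult_mono) auto
    then have "2 * \<bar>t - s\<bar> * (\<bar>t - s\<bar> * norm z') \<le> 2 * \<bar>t - s\<bar> * (e/4)"
      using d' by (intro mult_left_mono) auto
    then have 3: "norm (S t v' - S s v' - (t - s) *\<^sub>R S s w') \<le> 2 * \<bar>t - s\<bar> * (e/4)"
      using S_taylor[OF a(1,2) s t(1)] by (simp add: power2_eq_square abs_mult_self_eq mult.assoc)
    have "S t v - S s v - (t - s) *\<^sub>R S s w =
      (S t (v - v') - S s (v - v')) - (t - s) *\<^sub>R S s (w - w') + (S t v' - S s v' - (t - s) *\<^sub>R S s w')"
      using K s t by (simp add: S_diff algebra_simps)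
    also have "norm \<dots> \<le> norm (S t (v - v') - S s (v - v')) + norm ((t - s) *\<^sub>R S s (w - w'))
        + norm (S t v' - S s v' - (t - s) *\<^sub>R S s w')"
      by (intro norm_triangle_le add_right_mono norm_triangle_ineq4)
    also have "\<dots> \<le> \<bar>t - s\<bar> * (e/4) + \<bar>t - s\<bar> * (e/4) + 2 * \<bar>t - s\<bar> * (e/4)"
      by (intro add_mono 1 2 3)
    finally show ?thesis by (simp add: algebra_simps)
  qed
  then show "\<exists>d>0. \<forall>y\<in>{0..}. norm (y - s) < d \<longrightarrow>
      norm (S y v - S s v - (y - s) *\<^sub>R S s w) \<le> e * norm (y - s)" using d by auto
qed

text \<open>Invariance is phrased for an arbitrary closed \<open>N\<close> that is stable under
  solving \<open>x - h A x = f\<close>, in terms of \<open>A\<close> alone, so that a later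
  application has to check resolvent equations only.\<close>

theorem evolution_exists:
  assumes "(u0, v0) \<in> A"
  shows "\<exists>u u'. u 0 = u0 \<and> (\<forall>t\<ge>0. (u t, u' t) \<in> A \<and> norm (u t) \<le> norm u0 \<and>
      (u has_vector_derivative u' t) (at t within {0..})) \<and>
    continuous_on {0..} u \<and> continuous_on {0..} u' \<and>
    (\<forall>N. closed N \<longrightarrow> N \<subseteq> K \<longrightarrow> u0 \<in> N \<longrightarrow>
      (\<forall>h>0. \<forall>f\<in>N. \<forall>x y. (x, y) \<in> A \<longrightarrow> x - h *\<^sub>R y = f \<longrightarrow> x \<in> N) \<longrightarrow> (\<forall>t\<ge>0. u t \<in> N))"
proof (rule exI[of _ "\<lambda>t. S t u0"], rule exI[of _ "\<lambda>t. S t v0"], intro conjI allI impI)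
  show "S 0 u0 = u0" by (rule S_0)
  fix N and t :: real assume N: "closed N" "N \<subseteq> K" "u0 \<in> N" "t \<ge> 0"
    "\<forall>h>0. \<forall>f\<in>N. \<forall>x y. (x, y) \<in> A \<longrightarrow> x - h *\<^sub>R y = f \<longrightarrow> x \<in> N"
  have "R h f \<in> N" if "h > 0" "f \<in> N" for h f
  proof -
    have "R h f - h *\<^sub>R (1/h) *\<^sub>R (R h f - f) = f" using that by simp
    then show ?thesis using R_graph[of h f] N(2,5) that by blast
  qed
  then show "S t u0 \<in> N" using S_closed_invariant[OF N(1,2) _ N(3,4)] by blast
qed (use assms A_K[OF assms] in \<open>auto simp: S_A S_norm S_has_vector_derivative S_continuous\<close>)

end

section \<open>Uniqueness for skew relations\<close>

lemma skew_evolution_unique: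
  fixes u u' v v' :: "real \<Rightarrow> 'a::real_inner"
  assumes B: "subspace B" "\<And>x y. (x, y) \<in> B \<Longrightarrow> inner x y = 0"
    and u: "\<And>t. t \<in> {0..T} \<Longrightarrow> (u t, u' t) \<in> B"
      "\<And>t. t \<in> {0..T} \<Longrightarrow> (u has_vector_derivative u' t) (at t within {0..T})"
    and v: "\<And>t. t \<in> {0..T} \<Longrightarrow> (v t, v' t) \<in> B"
      "\<And>t. t \<in> {0..T} \<Longrightarrow> (v has_vector_derivative v' t) (at t within {0..T})"
    and init: "u 0 = v 0" and t: "t \<in> {0..T}"
  shows "u t = v t"
proof -
  define w where "w t = u t - v t" for t
  have "((\<lambda>t. inner (w t) (w t)) has_vector_derivative 0) (at s within {0..T})"
    if s: "s \<in> {0..T}" for s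
  proof -
    have "(w has_vector_derivative u' s - v' s) (at s within {0..T})"
      unfolding w_def by (intro has_vector_derivative_diff u v s)
    then have "((\<lambda>t. inner (w t) (w t)) has_vector_derivative
        inner (w s) (u' s - v' s) + inner (u' s - v' s) (w s)) (at s within {0..T})"
      by (intro bounded_bilinear.has_vector_derivative[OF bounded_bilinear_inner])
    moreover have "inner (w s) (u' s - v' s) = 0"
      unfolding w_def using subspace_diff[OF B(1) u(1)[OF s] v(1)[OF s]] B(2) by simp
    ultimately show ?thesis by (simp add: inner_commute)
  qed
  then obtain c where "\<And>s. s \<in> {0..T} \<Longrightarrow> inner (w s) (w s) = c"
    using has_vector_derivative_zero_constant[of "{0..T}" "\<lambda>t. inner (w t) (w t)"] by auto
  from this[of t] this[of 0] have "inner (w t) (w t) = inner (w 0) (w 0)" using t by simp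
  then show ?thesis using init by (simp add: w_def)
qed

text \<open>A pair of \<open>T\<close> is to be read as a test field \<open>a\<close> with the
  formal adjoint operator applied to it, \<open>b\<close>; then \<open>y\<close> is the weak image
  of \<open>x\<close>. The points \<open>x\<close>, \<open>y\<close> are confined to
  \<open>K\<close>, \<open>K'\<close>, while \<open>a\<close>, \<open>b\<close> are not.\<close>

definition weak_graph :: "'a::real_inner set \<Rightarrow> 'b::real_inner set \<Rightarrow> ('b \<times> 'a) set \<Rightarrow> ('a \<times> 'b) set" where
  "weak_graph K K' T = {(x, y). x \<in> K \<and> y \<in> K' \<and> (\<forall>(a, b)\<in>T. inner y a = inner x b)}"

definition adjoint_graph :: "'a::real_inner set \<Rightarrow> 'b::real_inner set \<Rightarrow> ('a \<times> 'b) set \<Rightarrow> ('b \<times> 'a) set" where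
  "adjoint_graph K K' D = {(w, z). w \<in> K' \<and> z \<in> K \<and> (\<forall>(u, p)\<in>D. inner p w = inner u z)}"

lemma closed_weak_graph:
  fixes K :: "'a::real_inner set" and K' :: "'b::real_inner set"
  assumes "closed K" "closed K'"
  shows "closed (weak_graph K K' T)"
proof -
  have "weak_graph K K' T
    = (K \<times> K') \<inter> (\<Inter>z\<in>T. {xy. inner (snd xy) (fst z) = inner (fst xy) (snd z)})"
    unfolding weak_graph_def by (auto simp del: split_paired_All) force
  also have "closed \<dots>"
    by (intro closed_Int closed_Times assms closed_INT ballI closed_Collect_eq continuous_intros)
  finally show ?thesis .
qed

text \<open>An adjoint is itself a weak graph, with the graph of the operator in the role of the
  test family; so closedness of adjoints follows from \<open>closed_weak_graph\<close>.\<close>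

lemma adjoint_graph_eq: "adjoint_graph K K' D = weak_graph K' K D"
  unfolding adjoint_graph_def weak_graph_def by (force simp: inner_commute)

lemma adjoint_graphD: "(w, z) \<in> adjoint_graph K K' D \<Longrightarrow> (u, p) \<in> D \<Longrightarrow> inner p w = inner u z"
  by (auto simp: adjoint_graph_def)

text \<open>The total operator on the product space. Of the grading only \<open>J\<close> is
  retained: \<open>d\<close> raises the degree by one and \<open>J\<close> is the sign alternating
  with the degree, so they anticommute, which is \<open>d_J\<close>.\<close>

locale graded_complex =
  fixes K :: "'a::{real_inner,banach} set" and T :: "('a \<times> 'a) set" and J :: "'a \<Rightarrow> 'a"
    and d :: "('a \<times> 'a) set" and ds :: "('a \<times> 'a) set" and L :: "('a \<times> 'a) set"
  assumes closed_K: "closed K" and subspace_K: "subspace K"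
    and J_lin: "linear J" and J_invol: "\<And>x. J (J x) = x" and J_inner: "\<And>x y. inner (J x) (J y) = inner x y"
    and J_K: "\<And>x. x \<in> K \<Longrightarrow> J x \<in> K"
    and d_is: "d = weak_graph K K T"
    and dd: "\<And>x y. (x, y) \<in> d \<Longrightarrow> (y, 0) \<in> d"
    and d_J: "\<And>x y. (x, y) \<in> d \<Longrightarrow> (J x, - J y) \<in> d"
    and ds_is: "ds = adjoint_graph K K d"
    and L_is: "L = {(u, v). \<exists>p q. (u, p) \<in> d \<and> (u, q) \<in> ds \<and> v = J (p + q)}"
begin

lemmas K_simps = subspace_add[OF subspace_K] subspace_diff[OF subspace_K] subspace_scale[OF subspace_K]
  subspace_0[OF subspace_K]

lemma d_K: "(x, y) \<in> d \<Longrightarrow> x \<in> K" "(x, y) \<in> d \<Longrightarrow> y \<in> K"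
  by (auto simp: d_is weak_graph_def)

lemma ds_K: "(x, y) \<in> ds \<Longrightarrow> x \<in> K" "(x, y) \<in> ds \<Longrightarrow> y \<in> K"
  by (auto simp: ds_is adjoint_graph_def)

lemma adjoint: "(u, p) \<in> d \<Longrightarrow> (w, z) \<in> ds \<Longrightarrow> inner p w = inner u z"
  by (auto simp: ds_is adjoint_graph_def)

lemma J_adj: "inner (J x) y = inner x (J y)"
  using J_inner[of x "J y"] J_invol by simp

lemma subspace_d: "subspace d"
  by (simp add: subspace_def d_is weak_graph_def K_simps inner_add zero_prod_def split_beta)

lemma subspace_ds: "subspace ds"
  by (simp add: subspace_def ds_is adjoint_graph_def K_simps inner_add zero_prod_def split_beta)

lemma closed_d: "closed d"
  unfolding d_is by (rule closed_weak_graph[OF closed_K closed_K])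

lemma closed_ds: "closed ds"
  unfolding ds_is adjoint_graph_eq by (rule closed_weak_graph[OF closed_K closed_K])

lemma ds_J: assumes "(w, z) \<in> ds" shows "(J w, - J z) \<in> ds"
proof -
  have "inner p (J w) = inner u (- J z)" if "(u, p) \<in> d" for u p
    using adjoint[OF d_J[OF that] assms] by (simp add: J_adj)
  then show ?thesis
    using ds_K[OF assms] J_K K_simps(3)[of _ "-1"] by (auto simp: ds_is adjoint_graph_def)
qed

lemma ds_ds: assumes "(w, z) \<in> ds" shows "(z, 0) \<in> ds"
  using ds_K[OF assms] adjoint[OF dd assms] by (auto simp: ds_is adjoint_graph_def K_simps)

text \<open>For a test pair \<open>(a, b)\<close> the weak definition of \<open>d\<close> says
  precisely that \<open>(a, b)\<close>, once projected to \<open>K\<close>, lies in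
  \<open>ds\<close>. The projection is there because test fields may leave \<open>K\<close>; inner
  products with elements of \<open>K\<close> do not notice it.\<close>

lemma biadjoint:
  assumes "x \<in> K" "y \<in> K" "\<And>w z. (w, z) \<in> ds \<Longrightarrow> inner y w = inner x z"
  shows "(x, y) \<in> d"
proof -
  have "inner y a = inner x b" if ab: "(a, b) \<in> T" for a b
  proof -
    obtain a' where a': "a' \<in> K" "\<And>k. k \<in> K \<Longrightarrow> inner (a - a') k = 0"
      using orthogonal_projection_exists[OF closed_K subspace_K] by blast
    obtain b' where b': "b' \<in> K" "\<And>k. k \<in> K \<Longrightarrow> inner (b - b') k = 0"
      using orthogonal_projection_exists[OF closed_K subspace_K] by blast
    have a: "inner k a' = inner k a" if "k \<in> K" for k
      using a'(2)[OF that] by (simp add: inner_diff inner_commute)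
    have b: "inner k b' = inner k b" if "k \<in> K" for k
      using b'(2)[OF that] by (simp add: inner_diff inner_commute)
    have "(a', b') \<in> ds" using ab a'(1) b'(1) by (auto simp: ds_is adjoint_graph_def d_is weak_graph_def a b)
    from assms(3)[OF this] show ?thesis using assms a b by simp
  qed
  then show ?thesis using assms by (auto simp: d_is weak_graph_def)
qed

lemma L_skew: assumes "(u, v) \<in> L" shows "inner u v = 0"
proof -
  obtain p q where pq: "(u, p) \<in> d" "(u, q) \<in> ds" "v = J (p + q)" using assms by (auto simp: L_is)
  \<comment> \<open>Adjointness at \<open>J u\<close>, whose value under \<open>d\<close> is
    \<open>- J p\<close>: it makes the contributions of \<open>p\<close> and \<open>q\<close> to
    \<open>inner u v\<close> cancel.\<close>
  have "inner (- J p) u = inner (J u) q" by (rule adjoint[OF d_J[OF pq(1)] pq(2)])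
  then show ?thesis using pq(3) J_adj
    by (simp add: linear_add[OF J_lin] inner_add inner_commute)
qed

lemma subspace_L: "subspace L"
  unfolding subspace_def
proof (intro conjI ballI allI)
  have "J (0 + 0) = 0" by (simp add: linear_0[OF J_lin])
  then show "0 \<in> L" using subspace_0[OF subspace_d] subspace_0[OF subspace_ds]
    unfolding L_is zero_prod_def by force
next
  fix x y assume "x \<in> L" "y \<in> L"
  then obtain u p q u' p' q' where *: "x = (u, J (p + q))" "(u, p) \<in> d" "(u, q) \<in> ds"
    "y = (u', J (p' + q'))" "(u', p') \<in> d" "(u', q') \<in> ds"
    unfolding L_is by auto
  have "(u + u', p + p') \<in> d" "(u + u', q + q') \<in> ds"
    using subspace_add[OF subspace_d *(2,5)] subspace_add[OF subspace_ds *(3,6)] by auto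
  moreover have "J (p + q) + J (p' + q') = J ((p + p') + (q + q'))"
    by (simp add: linear_add[OF J_lin])
  ultimately show "x + y \<in> L" unfolding L_is * by auto
next
  fix c x assume "x \<in> L"
  then obtain u p q where *: "x = (u, J (p + q))" "(u, p) \<in> d" "(u, q) \<in> ds"
    unfolding L_is by auto
  have "(c *\<^sub>R u, c *\<^sub>R p) \<in> d" "(c *\<^sub>R u, c *\<^sub>R q) \<in> ds"
    using subspace_scale[OF subspace_d *(2)] subspace_scale[OF subspace_ds *(3)] by auto
  moreover have "c *\<^sub>R J (p + q) = J (c *\<^sub>R p + c *\<^sub>R q)"
    by (simp add: linear_add[OF J_lin] linear_scale[OF J_lin] scaleR_add_right)
  ultimately show "c *\<^sub>R x \<in> L" unfolding L_is * by auto
qed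

lemma L_K: "L \<subseteq> K \<times> K"
  by (auto simp: L_is d_K ds_K J_K K_simps)

lemma norm_J: "norm (J x) = norm x"
  by (simp add: norm_eq_sqrt_inner J_inner)

section \<open>Surjectivity of \<open>1 - h L\<close>\<close>

lemma kernel_closed_subspace:
  assumes "closed B" "subspace (B :: ('a \<times> 'a) set)"
  shows "closed {x. (x, 0) \<in> B}" "subspace {x. (x, 0) \<in> B}"
proof -
  have "{x. (x, 0) \<in> B} = (\<lambda>x. (x, 0)) -` B" by auto
  then show "closed {x. (x, 0) \<in> B}"
    using continuous_closed_vimage[OF assms(1), of "\<lambda>x. (x, 0)"] by (simp add: continuous_intros)
  show "subspace {x. (x, 0) \<in> B}"
    using subspace_0[OF assms(2)] subspace_add[OF assms(2), of "(_,0)" "(_,0)"]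
      subspace_scale[OF assms(2), of "(_,0)"]
    by (fastforce simp: subspace_def zero_prod_def)
qed

text \<open>On the orthogonal complement of the kernel of \<open>d\<close> the adjoint vanishes, so testing with
  the component of \<open>u\<close> there isolates the \<open>d\<close>-part of \<open>L\<close>; likewise with the roles exchanged.\<close>

lemma perp_range_ds:
  assumes w: "w \<in> K" and h: "h > 0"
    and perp: "\<And>u p q. (u, p) \<in> d \<Longrightarrow> (u, q) \<in> ds \<Longrightarrow> inner w (u - h *\<^sub>R J (p + q)) = 0"
  shows "\<exists>z. (J w, z) \<in> ds"
proof -
  define N where "N = {x. (x, 0) \<in> d}"
  have N: "closed N" "subspace N" unfolding N_def by (rule kernel_closed_subspace[OF closed_d subspace_d])+
  obtain w' where w': "w' \<in> N" "\<And>k. k \<in> N \<Longrightarrow> inner (w - w') k = 0"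
    using orthogonal_projection_exists[OF N] by blast
  \<comment> \<open>The candidate for the adjoint value at \<open>J w\<close> is \<open>1/h\<close>
    times the component of \<open>w\<close> orthogonal to the kernel \<open>N\<close>: this is what
    orthogonality to the range says when tested with \<open>u - u'\<close>.\<close>
  have "inner p (J w) = inner u ((1/h) *\<^sub>R (w - w'))" if up: "(u, p) \<in> d" for u p
  proof -
    obtain u' where u': "u' \<in> N" "\<And>k. k \<in> N \<Longrightarrow> inner (u - u') k = 0"
      using orthogonal_projection_exists[OF N] by blast
    have u'd: "(u', 0) \<in> d" using u' N_def by blast
    have 1: "(u - u', p) \<in> d" using subspace_diff[OF subspace_d up u'd] by simp
    \<comment> \<open>The values of \<open>d\<close> lie in \<open>N\<close> by \<open>dd\<close>,
      so \<open>u - u'\<close>, being orthogonal to \<open>N\<close>, has adjoint value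
      \<open>0\<close>.\<close>
    have "(u - u', 0) \<in> ds"
      using d_K[OF 1] u'(2) dd by (fastforce simp: ds_is adjoint_graph_def K_simps N_def inner_commute)
    from perp[OF 1 this] have "inner w (u - u') = h * inner p (J w)"
      by (simp add: inner_diff J_adj inner_commute[of p])
    moreover have "inner w (u - u') = inner (w - w') (u - u')"
      using u'(2)[OF w'(1)] by (simp add: inner_diff inner_commute)
    moreover have "inner (w - w') (u - u') = inner u (w - w')"
      using w'(2)[OF u'(1)] by (simp add: inner_diff inner_commute)
    ultimately show ?thesis using h by simp
  qed
  moreover have "w' \<in> K" using w'(1) d_K unfolding N_def by blast
  ultimately have "(J w, (1/h) *\<^sub>R (w - w')) \<in> ds"
    using w by (auto simp: ds_is adjoint_graph_def K_simps J_K)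
  then show ?thesis by blast
qed

lemma perp_range_d:
  assumes w: "w \<in> K" and h: "h > 0"
    and perp: "\<And>u p q. (u, p) \<in> d \<Longrightarrow> (u, q) \<in> ds \<Longrightarrow> inner w (u - h *\<^sub>R J (p + q)) = 0"
  shows "\<exists>z. (J w, z) \<in> d"
proof -
  define N where "N = {x. (x, 0) \<in> ds}"
  have N: "closed N" "subspace N" unfolding N_def by (rule kernel_closed_subspace[OF closed_ds subspace_ds])+
  obtain w' where w': "w' \<in> N" "\<And>k. k \<in> N \<Longrightarrow> inner (w - w') k = 0"
    using orthogonal_projection_exists[OF N] by blast
  have "inner ((1/h) *\<^sub>R (w - w')) u = inner (J w) q" if uq: "(u, q) \<in> ds" for u q
  proof -
    obtain u' where u': "u' \<in> N" "\<And>k. k \<in> N \<Longrightarrow> inner (u - u') k = 0"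
      using orthogonal_projection_exists[OF N] by blast
    have u'd: "(u', 0) \<in> ds" using u' N_def by blast
    have 1: "(u - u', q) \<in> ds" using subspace_diff[OF subspace_ds uq u'd] by simp
    \<comment> \<open>Here \<open>biadjoint\<close> enters: the values of \<open>ds\<close> lie in
      \<open>N\<close> by \<open>ds_ds\<close>, hence they all pair to zero with
      \<open>u - u'\<close>.\<close>
    have "(u - u', 0) \<in> d"
    proof (rule biadjoint)
      fix a b assume "(a, b) \<in> ds"
      then have "b \<in> N" using ds_ds N_def by blast
      then show "inner 0 a = inner (u - u') b" using u'(2) by simp
    qed (use ds_K[OF 1] K_simps in auto)
    from perp[OF this 1] have "inner w (u - u') = h * inner (J w) q"
      by (simp add: inner_diff J_adj)
    moreover have "inner w (u - u') = inner (w - w') (u - u')"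
      using u'(2)[OF w'(1)] by (simp add: inner_diff inner_commute)
    moreover have "inner (w - w') (u - u') = inner (w - w') u"
      using w'(2)[OF u'(1)] by (simp add: inner_diff inner_commute)
    ultimately show ?thesis using h by simp
  qed
  moreover have "w' \<in> K" using w'(1) ds_K unfolding N_def by blast
  ultimately have "(J w, (1/h) *\<^sub>R (w - w')) \<in> d"
    using w by (intro biadjoint) (auto simp: K_simps J_K)
  then show ?thesis by blast
qed

lemma perp_range_zero:
  assumes w: "w \<in> K" and h: "h > 0"
    and perp: "\<And>u p q. (u, p) \<in> d \<Longrightarrow> (u, q) \<in> ds \<Longrightarrow> inner w (u - h *\<^sub>R J (p + q)) = 0"
  shows "w = 0"
proof -
  obtain p q where "(J w, p) \<in> d" "(J w, q) \<in> ds"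
    using perp_range_d[OF assms] perp_range_ds[OF assms] by blast
  from d_J[OF this(1)] ds_J[OF this(2)] obtain p q where pq: "(w, p) \<in> d" "(w, q) \<in> ds"
    unfolding J_invol by blast
  have "inner w (J (p + q)) = 0" using pq by (intro L_skew) (auto simp: L_is)
  then show ?thesis using perp[OF pq] by (simp add: inner_diff)
qed

text \<open>The unknown is the triple of \<open>u\<close> with its values \<open>p\<close> under
  \<open>d\<close> and \<open>q\<close> under \<open>ds\<close> as separate entries, which ranges
  over a closed subspace. On it \<open>|u - h J (p + q)|\<^sup>2 = |u|\<^sup>2 + h\<^sup>2
  (|p|\<^sup>2 + |q|\<^sup>2)\<close>, so the map is bounded below and has closed range; the
  orthogonal residual of \<open>f\<close> then vanishes by \<open>perp_range_zero\<close>.\<close>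

lemma L_range:
  assumes h: "h > 0" and f: "f \<in> K"
  shows "\<exists>u v. (u, v) \<in> L \<and> u - h *\<^sub>R v = f"
proof -
  define C where "C = {(u, p, q). (u, p) \<in> d \<and> (u, q) \<in> ds}"
  define \<Phi> where "\<Phi> = (\<lambda>(u, p, q). u - h *\<^sub>R J (p + q))"
  have \<Phi>: "bounded_linear \<Phi>"
  proof -
    have "bounded_linear J"
      by (rule bounded_linear_intro[of _ 1])
         (auto simp: linear_add[OF J_lin] linear_scale[OF J_lin] norm_J)
    then have "bounded_linear (\<lambda>x. J (fst (snd x) + snd (snd x :: 'a \<times> 'a)))"
      by (rule bounded_linear_compose) (intro bounded_linear_intros)
    then have "bounded_linear (\<lambda>x. fst x - h *\<^sub>R J (fst (snd x) + snd (snd x :: 'a \<times> 'a)))"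
      by (intro bounded_linear_sub bounded_linear_fst bounded_linear_const_scaleR)
    moreover have "\<Phi> = (\<lambda>x. fst x - h *\<^sub>R J (fst (snd x) + snd (snd x)))" by (auto simp: \<Phi>_def)
    ultimately show ?thesis by simp
  qed
  have "C = (\<lambda>x. (fst x, fst (snd x))) -` d \<inter> (\<lambda>x. (fst x, snd (snd x))) -` ds"
    by (auto simp: C_def)
  then have "closed C"
    by (auto intro!: closed_Int continuous_closed_vimage closed_d closed_ds continuous_intros)
  have sC: "subspace C"
    unfolding subspace_def
    using subspace_0[OF subspace_d] subspace_0[OF subspace_ds] subspace_add[OF subspace_d, of "(_,_)" "(_,_)"]
      subspace_add[OF subspace_ds, of "(_,_)" "(_,_)"] subspace_scale[OF subspace_d, of "(_,_)"]
      subspace_scale[OF subspace_ds, of "(_,_)"]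
    by (simp add: C_def zero_prod_def)
  have lower: "min 1 h * norm x \<le> norm (\<Phi> x)" if "x \<in> C" for x
  proof -
    obtain u p q where x: "x = (u, p, q)" "(u, p) \<in> d" "(u, q) \<in> ds" using \<open>x \<in> C\<close> by (auto simp: C_def)
    \<comment> \<open>Adjointness of \<open>(p, 0)\<close> in \<open>d\<close> with
      \<open>(u, q)\<close> in \<open>ds\<close> gives \<open>inner 0 u = inner p q\<close>.\<close>
    have pq: "inner p q = 0" using adjoint[OF dd[OF x(2)] x(3)] by simp
    have skew: "inner u (J (p + q)) = 0" using x by (intro L_skew) (auto simp: L_is)
    have "(min 1 h)\<^sup>2 \<le> 1" "(min 1 h)\<^sup>2 \<le> h\<^sup>2" using h by (auto intro: power_le_one power_mono)
    then have "(min 1 h)\<^sup>2 * (norm u)\<^sup>2 \<le> (norm u)\<^sup>2"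
      "(min 1 h)\<^sup>2 * ((norm p)\<^sup>2 + (norm q)\<^sup>2) \<le> h\<^sup>2 * ((norm p)\<^sup>2 + (norm q)\<^sup>2)"
      by (auto intro!: mult_right_mono mult_left_le_one_le)
    moreover have "(norm (\<Phi> x))\<^sup>2 = (norm u)\<^sup>2 + h\<^sup>2 * ((norm p)\<^sup>2 + (norm q)\<^sup>2)"
      unfolding power2_norm_eq_inner x \<Phi>_def using skew pq
      by (simp add: inner_diff inner_commute power2_eq_square J_inner inner_add algebra_simps)
    moreover have "(norm x)\<^sup>2 = (norm u)\<^sup>2 + ((norm p)\<^sup>2 + (norm q)\<^sup>2)"
      by (simp add: x norm_Pair)
    ultimately have "(min 1 h * norm x)\<^sup>2 \<le> (norm (\<Phi> x))\<^sup>2"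
      unfolding power_mult_distrib by (simp only: distrib_left)
    then show ?thesis by (rule power2_le_imp_le) simp
  qed
  have "complete (\<Phi> ` C)"
    by (rule complete_isometric_image[of "min 1 h", OF _ sC \<Phi>])
       (use h lower \<open>closed C\<close> in \<open>simp_all add: complete_eq_closed\<close>)
  then have cl: "closed (\<Phi> ` C)" by (simp add: complete_eq_closed)
  have sub: "subspace (\<Phi> ` C)"
    by (rule linear_subspace_image[OF bounded_linear.linear[OF \<Phi>] sC])
  obtain m where m: "m \<in> \<Phi> ` C" "\<And>k. k \<in> \<Phi> ` C \<Longrightarrow> inner (f - m) k = 0"
    using orthogonal_projection_exists[OF cl sub] by blast
  obtain u p q where u: "m = u - h *\<^sub>R J (p + q)" "(u, p) \<in> d" "(u, q) \<in> ds"
    using m(1) by (auto simp: C_def \<Phi>_def)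
  have "m \<in> K" unfolding u(1) using d_K[OF u(2)] ds_K[OF u(3)] by (intro K_simps(1-3) J_K)
  have "f - m = 0"
  proof (rule perp_range_zero[OF _ h])
    show "f - m \<in> K" using f \<open>m \<in> K\<close> K_simps by blast
    fix u p q assume "(u, p) \<in> d" "(u, q) \<in> ds"
    then have "\<Phi> (u, p, q) \<in> \<Phi> ` C" by (intro imageI) (simp add: C_def)
    from m(2)[OF this] show "inner (f - m) (u - h *\<^sub>R J (p + q)) = 0" by (simp add: \<Phi>_def)
  qed
  then show ?thesis using u by (auto simp: L_is)
qed

lemma skew_generator_L:
  assumes "K \<subseteq> closure (fst ` L)"
  shows "skew_generator K L"
  by unfold_locales
     (use closed_K subspace_K subspace_L L_K L_skew L_range assms in auto)

end

section \<open>The Hilbert space of square-integrable functions\<close>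

text \<open>Functions live on the whole space, so the quotient type is free of a domain parameter; a
  field on an open set enters by extension with zero.\<close>

definition sq_int :: "('a::euclidean_space \<Rightarrow> 'b::euclidean_space) \<Rightarrow> bool" where
  "sq_int f \<longleftrightarrow> f \<in> borel_measurable lebesgue \<and> integrable lebesgue (\<lambda>x. (norm (f x))\<^sup>2)"

lemma sq_int_measurable: "sq_int f \<Longrightarrow> f \<in> borel_measurable lebesgue"
  by (simp add: sq_int_def)

lemma sq_int_norm2: "sq_int f \<Longrightarrow> integrable lebesgue (\<lambda>x. (norm (f x))\<^sup>2)"
  by (simp add: sq_int_def)

lemma sq_int_zero: "sq_int (\<lambda>x. 0)"
  by (simp add: sq_int_def)

lemma sq_int_scaleR: "sq_int f \<Longrightarrow> sq_int (\<lambda>x. c *\<^sub>R f x)"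
  by (auto simp: sq_int_def power_mult_distrib)

lemma sq_int_add:
  assumes "sq_int f" "sq_int g" shows "sq_int (\<lambda>x. f x + g x)"
proof -
  have [measurable]: "f \<in> borel_measurable lebesgue" "g \<in> borel_measurable lebesgue"
    using assms by (auto simp: sq_int_def)
  have "integrable lebesgue (\<lambda>x. (norm (f x + g x))\<^sup>2)"
  proof (rule Bochner_Integration.integrable_bound)
    show "integrable lebesgue (\<lambda>x. 2 * (norm (f x))\<^sup>2 + 2 * (norm (g x))\<^sup>2)"
      using assms by (auto simp: sq_int_def)
    have "(norm (f x + g x))\<^sup>2 \<le> 2 * (norm (f x))\<^sup>2 + 2 * (norm (g x))\<^sup>2" for x
    proof -
      have "(norm (f x + g x))\<^sup>2 \<le> (norm (f x) + norm (g x))\<^sup>2"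
        by (intro power_mono norm_triangle_ineq) simp
      also have "\<dots> \<le> 2 * (norm (f x))\<^sup>2 + 2 * (norm (g x))\<^sup>2"
        using sum_squares_bound[of "norm (f x)" "norm (g x)"] by (simp add: power2_sum)
      finally show ?thesis .
    qed
    then show "AE x in lebesgue. norm ((norm (f x + g x))\<^sup>2) \<le> norm (2 * (norm (f x))\<^sup>2 + 2 * (norm (g x))\<^sup>2)"
      by simp
  qed measurable
  then show ?thesis by (simp add: sq_int_def)
qed

lemma sq_int_uminus: "sq_int f \<Longrightarrow> sq_int (\<lambda>x. - f x)"
  using sq_int_scaleR[of f "-1"] by simp

lemma sq_int_diff: "sq_int f \<Longrightarrow> sq_int g \<Longrightarrow> sq_int (\<lambda>x. f x - g x)"
  using sq_int_add[OF _ sq_int_uminus, of f g] by simp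

lemma sq_int_inner:
  assumes "sq_int f" "sq_int g" shows "integrable lebesgue (\<lambda>x. inner (f x) (g x))"
proof (rule Bochner_Integration.integrable_bound)
  have [measurable]: "f \<in> borel_measurable lebesgue" "g \<in> borel_measurable lebesgue"
    using assms by (auto simp: sq_int_def)
  show "(\<lambda>x. inner (f x) (g x)) \<in> borel_measurable lebesgue" by measurable
  show "integrable lebesgue (\<lambda>x. (norm (f x))\<^sup>2 + (norm (g x))\<^sup>2)"
    using assms by (auto simp: sq_int_def)
  have "\<bar>inner (f x) (g x)\<bar> \<le> (norm (f x))\<^sup>2 + (norm (g x))\<^sup>2" for x
  proof -
    have "\<bar>inner (f x) (g x)\<bar> \<le> norm (f x) * norm (g x)" by (rule Cauchy_Schwarz_ineq2)
    also have "\<dots> \<le> (norm (f x))\<^sup>2 + (norm (g x))\<^sup>2"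
      using sum_squares_bound[of "norm (f x)" "norm (g x)"]
        mult_nonneg_nonneg[OF norm_ge_zero[of "f x"] norm_ge_zero[of "g x"]] by linarith
    finally show ?thesis .
  qed
  then show "AE x in lebesgue. norm (inner (f x) (g x)) \<le> norm ((norm (f x))\<^sup>2 + (norm (g x))\<^sup>2)"
    by simp
qed

lemma sq_int_cong_AE:
  assumes "sq_int f" "AE x in lebesgue. f x = g x"
  shows "sq_int g"
proof -
  have g: "g \<in> borel_measurable lebesgue"
    by (rule borel_measurable_AE[OF sq_int_measurable[OF assms(1)] assms(2)])
  have "integrable lebesgue (\<lambda>x. (norm (g x))\<^sup>2)"
    by (rule integrable_cong_AE_imp[OF sq_int_norm2[OF assms(1)]])
       (use assms g in \<open>auto intro!: borel_measurable_power borel_measurable_norm elim: AE_mp\<close>)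
  then show ?thesis using g by (simp add: sq_int_def)
qed

definition sq_rel :: "('a::euclidean_space \<Rightarrow> 'b::euclidean_space) \<Rightarrow> ('a \<Rightarrow> 'b) \<Rightarrow> bool" where
  "sq_rel f g \<longleftrightarrow> sq_int f \<and> sq_int g \<and> (AE x in lebesgue. f x = g x)"

\<comment> \<open>The quotient is partial because \<open>sq_rel\<close> is reflexive only on
  square-integrable functions, which thereby become the carrier.\<close>
quotient_type (overloaded) ('a, 'b) lsq = "'a::euclidean_space \<Rightarrow> 'b::euclidean_space" / partial: sq_rel
proof (rule part_equivpI)
  show "\<exists>x::'a \<Rightarrow> 'b. sq_rel x x" using sq_int_zero by (auto simp: sq_rel_def)
  show "symp (sq_rel :: ('a \<Rightarrow> 'b) \<Rightarrow> _)" by (auto simp: symp_def sq_rel_def elim: AE_mp)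
  show "transp (sq_rel :: ('a \<Rightarrow> 'b) \<Rightarrow> _)"
    unfolding transp_def sq_rel_def by (metis (mono_tags, lifting) AE_mp AE_I2)
qed

section \<open>The inner product space of classes\<close>

instantiation lsq :: (euclidean_space, euclidean_space) real_vector
begin

lift_definition zero_lsq :: "('a, 'b) lsq" is "\<lambda>x. 0" by (simp add: sq_rel_def sq_int_zero)

lift_definition plus_lsq :: "('a, 'b) lsq \<Rightarrow> ('a, 'b) lsq \<Rightarrow> ('a, 'b) lsq" is "\<lambda>f g x. f x + g x"
  by (auto simp: sq_rel_def sq_int_add)

lift_definition uminus_lsq :: "('a, 'b) lsq \<Rightarrow> ('a, 'b) lsq" is "\<lambda>f x. - f x"
  by (auto simp: sq_rel_def sq_int_uminus)

lift_definition minus_lsq :: "('a, 'b) lsq \<Rightarrow> ('a, 'b) lsq \<Rightarrow> ('a, 'b) lsq" is "\<lambda>f g x. f x - g x"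
  by (auto simp: sq_rel_def sq_int_diff)

lift_definition scaleR_lsq :: "real \<Rightarrow> ('a, 'b) lsq \<Rightarrow> ('a, 'b) lsq" is "\<lambda>c f x. c *\<^sub>R f x"
  by (auto simp: sq_rel_def sq_int_scaleR)

instance
  by standard
     (transfer; auto simp: sq_rel_def sq_int_add sq_int_scaleR sq_int_uminus sq_int_diff sq_int_zero
        algebra_simps; fail)+

end

instantiation lsq :: (euclidean_space, euclidean_space) real_inner
begin

lift_definition inner_lsq :: "('a, 'b) lsq \<Rightarrow> ('a, 'b) lsq \<Rightarrow> real"
  is "\<lambda>f g. integral\<^sup>L lebesgue (\<lambda>x. inner (f x) (g x))"
proof -
  fix f f' g g' :: "'a \<Rightarrow> 'b" assume *: "sq_rel f f'" "sq_rel g g'"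
  then have [measurable]: "f \<in> borel_measurable lebesgue" "g \<in> borel_measurable lebesgue"
     "f' \<in> borel_measurable lebesgue" "g' \<in> borel_measurable lebesgue"
    by (auto simp: sq_int_def sq_rel_def)
  show "integral\<^sup>L lebesgue (\<lambda>x. inner (f x) (g x)) = integral\<^sup>L lebesgue (\<lambda>x. inner (f' x) (g' x))"
    by (rule integral_cong_AE) (use * in \<open>auto simp: sq_rel_def elim: AE_mp\<close>)
qed

definition norm_lsq :: "('a, 'b) lsq \<Rightarrow> real" where "norm_lsq x = sqrt (inner x x)"
definition dist_lsq :: "('a, 'b) lsq \<Rightarrow> ('a, 'b) lsq \<Rightarrow> real" where "dist_lsq x y = norm (x - y)"
definition sgn_lsq :: "('a, 'b) lsq \<Rightarrow> ('a, 'b) lsq" where "sgn_lsq x = x /\<^sub>R norm x"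
definition uniformity_lsq :: "(('a, 'b) lsq \<times> ('a, 'b) lsq) filter" where
  "uniformity_lsq = (INF e\<in>{0 <..}. principal {(x, y). dist x y < e})"
definition open_lsq :: "('a, 'b) lsq set \<Rightarrow> bool" where
  "open_lsq S \<longleftrightarrow> (\<forall>x\<in>S. \<forall>\<^sub>F (x', y) in uniformity. x' = x \<longrightarrow> y \<in> S)"

instance
proof
  fix x y z :: "('a, 'b) lsq" and r :: real and U :: "('a, 'b) lsq set"
  show "dist x y = norm (x - y)" "sgn x = x /\<^sub>R norm x" "norm x = sqrt (inner x x)"
    by (auto simp: dist_lsq_def sgn_lsq_def norm_lsq_def)
  show "uniformity = (INF e\<in>{0 <..}. principal {(x::('a, 'b) lsq, y). dist x y < e})"
    by (rule uniformity_lsq_def)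
  show "open U = (\<forall>x\<in>U. \<forall>\<^sub>F (x', y) in uniformity. x' = x \<longrightarrow> y \<in> U)"
    by (rule open_lsq_def)
  show "inner x y = inner y x" by transfer (simp add: inner_commute)
  show "inner (x + y) z = inner x z + inner y z"
    by transfer (simp add: inner_add_left sq_int_inner sq_rel_def Bochner_Integration.integral_add)
  show "inner (r *\<^sub>R x) y = r * inner x y" by transfer simp
  show "0 \<le> inner x x" by transfer simp
  show "inner x x = 0 \<longleftrightarrow> x = 0"
  proof (transfer)
    fix f :: "'a \<Rightarrow> 'b" assume f: "sq_rel f f"
    have "integral\<^sup>L lebesgue (\<lambda>x. inner (f x) (f x)) = 0 \<longleftrightarrow> (AE x in lebesgue. inner (f x) (f x) = 0)"
      using f by (intro integral_nonneg_eq_0_iff_AE) (auto simp: sq_rel_def sq_int_inner)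
    then show "(integral\<^sup>L lebesgue (\<lambda>x. inner (f x) (f x)) = 0) = sq_rel f (\<lambda>x. 0)"
      using f by (auto simp: sq_rel_def sq_int_zero)
  qed
qed

end

lemma inner_abs_lsq:
  assumes "sq_int f" "sq_int g"
  shows "inner (abs_lsq f) (abs_lsq g) = integral\<^sup>L lebesgue (\<lambda>x. inner (f x) (g x))"
  by (rule inner_lsq.abs_eq) (use assms in \<open>auto simp: sq_rel_def\<close>)

lemma norm2_abs_lsq:
  assumes "sq_int f"
  shows "(norm (abs_lsq f))\<^sup>2 = integral\<^sup>L lebesgue (\<lambda>x. (norm (f x))\<^sup>2)"
  unfolding power2_norm_eq_inner by (rule inner_abs_lsq[OF assms assms])

lemma abs_lsq_add: "sq_int f \<Longrightarrow> sq_int g \<Longrightarrow> abs_lsq f + abs_lsq g = abs_lsq (\<lambda>x. f x + g x)"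
  by (simp add: plus_lsq.abs_eq sq_rel_def)

lemma abs_lsq_diff: "sq_int f \<Longrightarrow> sq_int g \<Longrightarrow> abs_lsq f - abs_lsq g = abs_lsq (\<lambda>x. f x - g x)"
  by (simp add: minus_lsq.abs_eq sq_rel_def)

lemma abs_lsq_scaleR: "sq_int f \<Longrightarrow> c *\<^sub>R abs_lsq f = abs_lsq (\<lambda>x. c *\<^sub>R f x)"
  by (simp add: scaleR_lsq.abs_eq sq_rel_def)

lemma abs_lsq_eq_iff:
  "sq_int f \<Longrightarrow> sq_int g \<Longrightarrow> abs_lsq f = abs_lsq g \<longleftrightarrow> (AE x in lebesgue. f x = g x)"
  using Quotient_rel_abs[OF Quotient_lsq] Quotient_rel[OF Quotient_lsq, of f g]
  by (auto simp: sq_rel_def)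

lemma lsq_cases: obtains f where "sq_int f" "x = abs_lsq f"
proof
  show "sq_int (rep_lsq x)" using Quotient_rep_reflp[OF Quotient_lsq, of x] by (simp add: sq_rel_def)
  show "x = abs_lsq (rep_lsq x)" using Quotient_abs_rep[OF Quotient_lsq, of x] by simp
qed

section \<open>Completeness\<close>

lemma nn_integral_norm2_sq_int:
  assumes "sq_int f"
  shows "(\<integral>\<^sup>+x. ennreal ((norm (f x))\<^sup>2) \<partial>lebesgue) = ennreal ((norm (abs_lsq f))\<^sup>2)"
  unfolding norm2_abs_lsq[OF assms]
  by (rule nn_integral_eq_integral[OF sq_int_norm2[OF assms]]) simp

text \<open>The bound is on a nonnegative integral, which makes sense before integrability is known;
  this is the form in which Fatou's lemma delivers a limit.\<close>

lemma sq_int_of_nn_integral_bound: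
  assumes f: "f \<in> borel_measurable lebesgue"
    and b: "(\<integral>\<^sup>+x. ennreal ((norm (f x))\<^sup>2) \<partial>lebesgue) \<le> ennreal (e\<^sup>2)" and e: "e \<ge> 0"
  shows "sq_int f" "norm (abs_lsq f) \<le> e"
proof -
  have "integrable lebesgue (\<lambda>x. (norm (f x))\<^sup>2)"
  proof (rule integrableI_bounded)
    show "(\<lambda>x. (norm (f x))\<^sup>2) \<in> borel_measurable lebesgue" using f by measurable
    show "(\<integral>\<^sup>+x. ennreal (norm ((norm (f x))\<^sup>2)) \<partial>lebesgue) < \<infinity>"
      using b by (simp add: le_less_trans)
  qed
  then show s: "sq_int f" using f by (simp add: sq_int_def)
  have "(norm (abs_lsq f))\<^sup>2 \<le> e\<^sup>2"
    using b unfolding nn_integral_norm2_sq_int[OF s] by simp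
  then show "norm (abs_lsq f) \<le> e" using e by (rule power2_le_imp_le)
qed

text \<open>The series of the \<open>4 ^ n * g n\<close> has integral at most the sum of the
  \<open>(1/4) ^ n\<close>, so it is finite almost everywhere and bounds each of its terms. The
  resulting decay \<open>(1/4) ^ n\<close> becomes \<open>(1/2) ^ n\<close> after a square root, as
  \<open>geometric_increments_convergent\<close> asks.\<close>

lemma AE_bounded_of_geometric_integrals:
  fixes g :: "nat \<Rightarrow> 'a \<Rightarrow> real"
  assumes meas: "\<And>n. g n \<in> borel_measurable M" and nonneg: "\<And>n x. g n x \<ge> 0"
    and int: "\<And>n. (\<integral>\<^sup>+x. ennreal (g n x) \<partial>M) \<le> ennreal ((1/16) ^ n)"
  shows "AE x in M. \<exists>C\<ge>0. \<forall>n. 4 ^ n * g n x \<le> C"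
proof -
  have [measurable]: "\<And>n. g n \<in> borel_measurable M" by (rule meas)
  have "(\<integral>\<^sup>+x. (\<Sum>n. ennreal (4 ^ n * g n x)) \<partial>M) = (\<Sum>n. \<integral>\<^sup>+x. ennreal (4 ^ n * g n x) \<partial>M)"
    by (rule nn_integral_suminf) measurable
  also have "\<dots> \<le> (\<Sum>n. ennreal ((1/4) ^ n))"
  proof (intro suminf_le summableI)
    fix n
    have "(\<integral>\<^sup>+x. ennreal (4 ^ n * g n x) \<partial>M) = ennreal (4 ^ n) * (\<integral>\<^sup>+x. ennreal (g n x) \<partial>M)"
      using nonneg by (simp add: ennreal_mult nn_integral_cmult)
    also have "\<dots> \<le> ennreal (4 ^ n) * ennreal ((1/16) ^ n)" by (intro mult_left_mono int) simp
    also have "\<dots> = ennreal ((1/4) ^ n)"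
      by (simp add: ennreal_mult[symmetric] power_mult_distrib[symmetric])
    finally show "(\<integral>\<^sup>+x. ennreal (4 ^ n * g n x) \<partial>M) \<le> ennreal ((1/4) ^ n)" .
  qed
  also have "\<dots> = ennreal (\<Sum>n. (1/4) ^ n)"
    by (intro suminf_ennreal2 summable_geometric) auto
  finally have "(\<integral>\<^sup>+x. (\<Sum>n. ennreal (4 ^ n * g n x)) \<partial>M) \<noteq> \<infinity>"
    by (auto simp: top_unique)
  then have "AE x in M. (\<Sum>n. ennreal (4 ^ n * g n x)) \<noteq> \<infinity>"
    by (intro nn_integral_PInf_AE) measurable
  then show ?thesis
  proof (rule AE_mp, intro AE_I2 impI)
    fix x assume fin: "(\<Sum>n. ennreal (4 ^ n * g n x)) \<noteq> \<infinity>"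
    define C where "C = enn2real (\<Sum>n. ennreal (4 ^ n * g n x))"
    have "4 ^ n * g n x \<le> C" for n
    proof -
      have "ennreal (4 ^ n * g n x) \<le> (\<Sum>n. ennreal (4 ^ n * g n x))"
        using sum_le_suminf[of "\<lambda>n. ennreal (4 ^ n * g n x)" "{n}"] by simp
      then show ?thesis using fin nonneg[of n x] unfolding C_def
        by (metis enn2real_ennreal enn2real_mono infinity_ennreal_def less_top mult_nonneg_nonneg zero_le_numeral zero_le_power)
    qed
    then show "\<exists>C\<ge>0. \<forall>n. 4 ^ n * g n x \<le> C" by (intro exI[of _ C]) (auto simp: C_def)
  qed
qed

text \<open>The Riesz-Fischer argument: a rapidly converging subsequence of representatives
  converges almost everywhere, and Fatou's lemma along it identifies the limit of the whole
  sequence.\<close>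

instance lsq :: (euclidean_space, euclidean_space) banach
proof
  fix X :: "nat \<Rightarrow> ('a, 'b) lsq" assume X: "Cauchy X"
  define f where "f n = rep_lsq (X n)" for n
  have f: "sq_int (f n)" "X n = abs_lsq (f n)" for n
    using Quotient_rep_reflp[OF Quotient_lsq, of "X n"] Quotient_abs_rep[OF Quotient_lsq, of "X n"]
    by (auto simp: sq_rel_def f_def)
  have [measurable]: "f n \<in> borel_measurable lebesgue" for n using f by (simp add: sq_int_def)
  \<comment> \<open>The threshold \<open>(1/4) ^ k\<close> squares to the \<open>(1/16) ^ k\<close>
    of \<open>AE_bounded_of_geometric_integrals\<close>.\<close>
  have "\<exists>N. \<forall>m\<ge>N. \<forall>n\<ge>N. dist (X m) (X n) < (1/4) ^ k" for k :: nat
    by (rule metric_CauchyD[OF X]) simp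
  then obtain N where N: "\<And>k m n. m \<ge> N k \<Longrightarrow> n \<ge> N k \<Longrightarrow> dist (X m) (X n) < (1/4) ^ k"
    by metis
  \<comment> \<open>The sum makes \<open>r\<close> monotone and at least \<open>N n\<close>; the
    summand \<open>n\<close> makes it tend to infinity.\<close>
  define r where "r n = (\<Sum>i\<le>n. N i) + n" for n
  have r: "r n \<ge> n" "r n \<ge> N n" "r (Suc n) \<ge> r n" for n
    using member_le_sum[of n "{..n}" N] by (auto simp: r_def)
  have nn: "(\<integral>\<^sup>+x. ennreal ((norm (f m x - f n x))\<^sup>2) \<partial>lebesgue) = ennreal ((dist (X m) (X n))\<^sup>2)" for m n
    unfolding nn_integral_norm2_sq_int[OF sq_int_diff[OF f(1) f(1)]]
    by (simp add: dist_norm f(2) abs_lsq_diff f(1))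
  have "AE x in lebesgue. \<exists>C\<ge>0. \<forall>n. 4 ^ n * (norm (f (r (Suc n)) x - f (r n) x))\<^sup>2 \<le> C"
  proof (rule AE_bounded_of_geometric_integrals)
    fix n
    have "dist (X (r (Suc n))) (X (r n)) \<le> (1/4) ^ n"
      using N[of n "r (Suc n)" "r n"] r[of n] by simp
    then have "(dist (X (r (Suc n))) (X (r n)))\<^sup>2 \<le> ((1/4) ^ n)\<^sup>2" by (intro power_mono) auto
    also have "\<dots> = (1/16) ^ n"
      by (simp add: power_even_eq power_one_over power2_eq_square flip: power_mult_distrib)
    finally show "(\<integral>\<^sup>+x. ennreal ((norm (f (r (Suc n)) x - f (r n) x))\<^sup>2) \<partial>lebesgue) \<le> ennreal ((1/16) ^ n)"
      unfolding nn by (rule ennreal_leI)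
  qed auto
  then have conv: "AE x in lebesgue. convergent (\<lambda>n. f (r n) x)"
  proof (rule AE_mp, intro AE_I2 impI)
    fix x assume "\<exists>C\<ge>0. \<forall>n. 4 ^ n * (norm (f (r (Suc n)) x - f (r n) x))\<^sup>2 \<le> C"
    then obtain C where C: "C \<ge> 0" "\<And>n. 4 ^ n * (norm (f (r (Suc n)) x - f (r n) x))\<^sup>2 \<le> C" by blast
    show "convergent (\<lambda>n. f (r n) x)"
    proof (rule geometric_increments_convergent)
      fix n
      have "(norm (f (r (Suc n)) x - f (r n) x))\<^sup>2 \<le> C * (1/4) ^ n"
        using C(2)[of n] by (simp add: field_simps)
      also have "\<dots> = (sqrt C * (1/2) ^ n)\<^sup>2"
        using C(1) by (simp add: power_mult_distrib power2_eq_square[of "(1/2) ^ n"] flip: power_mult_distrib[of "1/2" "1/2"])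
      finally show "norm (f (r (Suc n)) x - f (r n) x) \<le> sqrt C * (1/2) ^ n"
        by (rule power2_le_imp_le) (use C in simp)
    qed
  qed
  \<comment> \<open>On the null set where the subsequence diverges \<open>F\<close> is the default
    value of \<open>lim\<close>; it is measurable all the same.\<close>
  define F where "F x = lim (\<lambda>n. f (r n) x)" for x
  have F[measurable]: "F \<in> borel_measurable lebesgue"
    unfolding F_def by (rule borel_measurable_lim_metric) simp
  \<comment> \<open>The index \<open>n\<close> is arbitrary beyond \<open>M\<close> and only the
    other index runs along the subsequence, so the estimate concerns the full sequence.\<close>
  have fatou: "sq_int (\<lambda>x. F x - f n x)" "norm (abs_lsq (\<lambda>x. F x - f n x)) \<le> e"
    if e: "e > 0" and M: "\<And>m n. m \<ge> M \<Longrightarrow> n \<ge> M \<Longrightarrow> dist (X m) (X n) < e" and n: "n \<ge> M" for e M n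
  proof -
    have "(\<integral>\<^sup>+x. ennreal ((norm (F x - f n x))\<^sup>2) \<partial>lebesgue)
       = (\<integral>\<^sup>+x. liminf (\<lambda>m. ennreal ((norm (f (r m) x - f n x))\<^sup>2)) \<partial>lebesgue)"
    proof (rule nn_integral_cong_AE, rule AE_mp[OF conv], intro AE_I2 impI)
      fix x assume "convergent (\<lambda>n. f (r n) x)"
      then have "(\<lambda>m. f (r m) x) \<longlonglongrightarrow> F x" unfolding F_def by (simp add: convergent_LIMSEQ_iff)
      then have "(\<lambda>m. ennreal ((norm (f (r m) x - f n x))\<^sup>2)) \<longlonglongrightarrow> ennreal ((norm (F x - f n x))\<^sup>2)"
        by (intro tendsto_intros)
      then show "ennreal ((norm (F x - f n x))\<^sup>2) = liminf (\<lambda>m. ennreal ((norm (f (r m) x - f n x))\<^sup>2))"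
        by (intro lim_imp_Liminf[symmetric]) auto
    qed
    also have "\<dots> \<le> liminf (\<lambda>m. \<integral>\<^sup>+x. ennreal ((norm (f (r m) x - f n x))\<^sup>2) \<partial>lebesgue)"
      by (rule nn_integral_liminf) measurable
    also have "\<dots> \<le> liminf (\<lambda>m. ennreal (e\<^sup>2))"
    proof (rule Liminf_mono)
      have "dist (X (r m)) (X n) \<le> e" if "m \<ge> M" for m
        using M[of "r m" n] r(1)[of m] n that by simp
      then have "(\<integral>\<^sup>+x. ennreal ((norm (f (r m) x - f n x))\<^sup>2) \<partial>lebesgue) \<le> ennreal (e\<^sup>2)" if "m \<ge> M" for m
        unfolding nn using that by (intro ennreal_leI power_mono) auto
      then show "\<forall>\<^sub>F m in sequentially. (\<integral>\<^sup>+x. ennreal ((norm (f (r m) x - f n x))\<^sup>2) \<partial>lebesgue) \<le> ennreal (e\<^sup>2)"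
        by (auto simp: eventually_sequentially)
    qed
    also have "\<dots> = ennreal (e\<^sup>2)" by (rule Liminf_const) simp
    finally have b: "(\<integral>\<^sup>+x. ennreal ((norm (F x - f n x))\<^sup>2) \<partial>lebesgue) \<le> ennreal (e\<^sup>2)" .
    have m: "(\<lambda>x. F x - f n x) \<in> borel_measurable lebesgue" by measurable
    show "sq_int (\<lambda>x. F x - f n x)" "norm (abs_lsq (\<lambda>x. F x - f n x)) \<le> e"
      using sq_int_of_nn_integral_bound[OF m b] e by auto
  qed
  have sF: "sq_int F"
  proof -
    obtain M where M: "\<And>m n. m \<ge> M \<Longrightarrow> n \<ge> M \<Longrightarrow> dist (X m) (X n) < 1"
      using metric_CauchyD[OF X, of 1] by auto
    have "sq_int (\<lambda>x. F x - f M x)" using fatou(1)[of 1 M M] M by simp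
    from sq_int_add[OF this f(1)[of M]] show ?thesis by simp
  qed
  have "X \<longlonglongrightarrow> abs_lsq F"
  proof (rule metric_LIMSEQ_I)
    fix e :: real assume e: "e > 0"
    obtain M where M: "\<And>m n. m \<ge> M \<Longrightarrow> n \<ge> M \<Longrightarrow> dist (X m) (X n) < e / 2"
      using metric_CauchyD[OF X, of "e/2"] e by auto
    have "dist (X n) (abs_lsq F) < e" if "n \<ge> M" for n
    proof -
      have "norm (abs_lsq (\<lambda>x. F x - f n x)) \<le> e / 2" using fatou(2)[of "e/2" M n] M that e by simp
      then show ?thesis using e by (simp add: dist_commute dist_norm f abs_lsq_diff sF norm_minus_commute)
    qed
    then show "\<exists>M. \<forall>n\<ge>M. dist (X n) (abs_lsq F) < e" by blast
  qed
  then show "convergent X" by (auto simp: convergent_def)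
qed

section \<open>A four-term Hilbert complex\<close>

text \<open>Each operator is given by its own test family, so that the total operator is again a
  weak graph. A condition such as \<open>(y, 0) \<in> D1\<close> states both that \<open>y\<close>
  is in the domain and that its image vanishes.\<close>

locale hilbert_complex =
  fixes K0 :: "'a::{real_inner,banach} set" and K1 :: "'b::{real_inner,banach} set"
    and K2 :: "'c::{real_inner,banach} set" and K3 :: "'e::{real_inner,banach} set"
    and T0 :: "('b \<times> 'a) set" and T1 :: "('c \<times> 'b) set" and T2 :: "('e \<times> 'c) set"
    and D0 D1 D2 D0s D1s D2s
  assumes closed_Ks: "closed K0" "closed K1" "closed K2" "closed K3"
    and subspace_Ks: "subspace K0" "subspace K1" "subspace K2" "subspace K3"
    and D_def: "D0 = weak_graph K0 K1 T0" "D1 = weak_graph K1 K2 T1" "D2 = weak_graph K2 K3 T2"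
    and Ds_def: "D0s = adjoint_graph K0 K1 D0" "D1s = adjoint_graph K1 K2 D1" "D2s = adjoint_graph K2 K3 D2"
    and D1_D0: "\<And>x y. (x, y) \<in> D0 \<Longrightarrow> (y, 0) \<in> D1"
    and D2_D1: "\<And>x y. (x, y) \<in> D1 \<Longrightarrow> (y, 0) \<in> D2"
begin

definition K :: "('a \<times> 'b \<times> 'c \<times> 'e) set" where "K = K0 \<times> K1 \<times> K2 \<times> K3"

definition J :: "'a \<times> 'b \<times> 'c \<times> 'e \<Rightarrow> 'a \<times> 'b \<times> 'c \<times> 'e" where
  "J = (\<lambda>(x0, x1, x2, x3). (x0, - x1, x2, - x3))"

definition d :: "(('a \<times> 'b \<times> 'c \<times> 'e) \<times> ('a \<times> 'b \<times> 'c \<times> 'e)) set" where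
  "d = {((x0, x1, x2, x3), (y0, y1, y2, y3)) | x0 x1 x2 x3 y0 y1 y2 y3.
     y0 = 0 \<and> (x0, y1) \<in> D0 \<and> (x1, y2) \<in> D1 \<and> (x2, y3) \<in> D2 \<and> x3 \<in> K3}"

definition ds :: "(('a \<times> 'b \<times> 'c \<times> 'e) \<times> ('a \<times> 'b \<times> 'c \<times> 'e)) set" where
  "ds = {((w0, w1, w2, w3), (z0, z1, z2, z3)) | w0 w1 w2 w3 z0 z1 z2 z3.
     w0 \<in> K0 \<and> (w1, z0) \<in> D0s \<and> (w2, z1) \<in> D1s \<and> (w3, z2) \<in> D2s \<and> z3 = 0}"

definition L :: "(('a \<times> 'b \<times> 'c \<times> 'e) \<times> ('a \<times> 'b \<times> 'c \<times> 'e)) set" where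
  "L = {((x0, x1, x2, x3), (z0, - G - z1, S + z2, - r)) | x0 x1 x2 x3 G S r z0 z1 z2.
     (x0, G) \<in> D0 \<and> (x1, S) \<in> D1 \<and> (x2, r) \<in> D2 \<and>
     (x1, z0) \<in> D0s \<and> (x2, z1) \<in> D1s \<and> (x3, z2) \<in> D2s}"

text \<open>The three families in their slots. The extra pairs \<open>((a, 0, 0, 0), 0)\<close> make
  the first component of a value orthogonal to everything, hence \<open>0\<close>, as no operator
  maps into degree zero.\<close>

definition T :: "(('a \<times> 'b \<times> 'c \<times> 'e) \<times> ('a \<times> 'b \<times> 'c \<times> 'e)) set" where
  "T = range (\<lambda>a. ((a, 0, 0, 0), 0)) \<union> (\<lambda>(a, b). ((0, a, 0, 0), (b, 0, 0, 0))) ` T0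
     \<union> (\<lambda>(a, b). ((0, 0, a, 0), (0, b, 0, 0))) ` T1 \<union> (\<lambda>(a, b). ((0, 0, 0, a), (0, 0, b, 0))) ` T2"

lemma D_iff:
  "(x0, y1) \<in> D0 \<longleftrightarrow> x0 \<in> K0 \<and> y1 \<in> K1 \<and> (\<forall>(a, b)\<in>T0. inner y1 a = inner x0 b)"
  "(x1, y2) \<in> D1 \<longleftrightarrow> x1 \<in> K1 \<and> y2 \<in> K2 \<and> (\<forall>(a, b)\<in>T1. inner y2 a = inner x1 b)"
  "(x2, y3) \<in> D2 \<longleftrightarrow> x2 \<in> K2 \<and> y3 \<in> K3 \<and> (\<forall>(a, b)\<in>T2. inner y3 a = inner x2 b)"
  by (auto simp: D_def weak_graph_def)

lemma Ds_iff:
  "(w1, z0) \<in> D0s \<longleftrightarrow> w1 \<in> K1 \<and> z0 \<in> K0 \<and> (\<forall>(u, p)\<in>D0. inner p w1 = inner u z0)"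
  "(w2, z1) \<in> D1s \<longleftrightarrow> w2 \<in> K2 \<and> z1 \<in> K1 \<and> (\<forall>(u, p)\<in>D1. inner p w2 = inner u z1)"
  "(w3, z2) \<in> D2s \<longleftrightarrow> w3 \<in> K3 \<and> z2 \<in> K2 \<and> (\<forall>(u, p)\<in>D2. inner p w3 = inner u z2)"
  by (auto simp: Ds_def adjoint_graph_def)

lemma zero_mem_K: "0 \<in> K0" "0 \<in> K1" "0 \<in> K2" "0 \<in> K3"
  using subspace_Ks by (auto dest: subspace_0)

lemma D_zero: "(0, 0) \<in> D0" "(0, 0) \<in> D1" "(0, 0) \<in> D2"
  by (auto simp: D_iff zero_mem_K)

lemma Ds_zero: "(0, 0) \<in> D0s" "(0, 0) \<in> D1s" "(0, 0) \<in> D2s"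
  by (auto simp: Ds_iff zero_mem_K)

lemma D_K: "(x0, y1) \<in> D0 \<Longrightarrow> x0 \<in> K0 \<and> y1 \<in> K1" "(x1, y2) \<in> D1 \<Longrightarrow> x1 \<in> K1 \<and> y2 \<in> K2"
   "(x2, y3) \<in> D2 \<Longrightarrow> x2 \<in> K2 \<and> y3 \<in> K3"
  by (auto simp: D_iff)

lemma Ds_K: "(y1, x0) \<in> D0s \<Longrightarrow> x0 \<in> K0 \<and> y1 \<in> K1" "(y2, x1) \<in> D1s \<Longrightarrow> x1 \<in> K1 \<and> y2 \<in> K2"
   "(y3, x2) \<in> D2s \<Longrightarrow> x2 \<in> K2 \<and> y3 \<in> K3"
  by (auto simp: Ds_iff)

lemma adj0: "(u, p) \<in> D0 \<Longrightarrow> (w, z) \<in> D0s \<Longrightarrow> inner p w = inner u z"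
  and adj1: "(u', p') \<in> D1 \<Longrightarrow> (w', z') \<in> D1s \<Longrightarrow> inner p' w' = inner u' z'"
  and adj2: "(u'', p'') \<in> D2 \<Longrightarrow> (w'', z'') \<in> D2s \<Longrightarrow> inner p'' w'' = inner u'' z''"
  by (auto simp: Ds_def dest: adjoint_graphD)

lemma ds_eq: "ds = adjoint_graph K K d"
  unfolding adjoint_graph_def
proof (intro set_eqI iffI)
  fix wz assume "wz \<in> ds"
  then show "wz \<in> {(w, z). w \<in> K \<and> z \<in> K \<and> (\<forall>(u, p)\<in>d. inner p w = inner u z)}"
    by (auto simp: ds_def d_def K_def zero_mem_K adj0 adj1 adj2 dest: Ds_K)
next
  fix wz assume *: "wz \<in> {(w, z). w \<in> K \<and> z \<in> K \<and> (\<forall>(u, p)\<in>d. inner p w = inner u z)}"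
  obtain w0 w1 w2 w3 z0 z1 z2 z3 where wz: "wz = ((w0, w1, w2, w3), (z0, z1, z2, z3))"
    by (metis surj_pair)
  have mem: "w0 \<in> K0" "w1 \<in> K1" "w2 \<in> K2" "w3 \<in> K3" "z0 \<in> K0" "z1 \<in> K1" "z2 \<in> K2" "z3 \<in> K3"
    using * by (auto simp: wz K_def)
  have t: "inner p (w0, w1, w2, w3) = inner u (z0, z1, z2, z3)" if "(u, p) \<in> d" for u p
    using * that by (auto simp: wz)
  have "inner p w1 = inner u z0" if "(u, p) \<in> D0" for u p
    using t[of "(u, 0, 0, 0)" "(0, p, 0, 0)"] that by (simp add: d_def D_zero zero_mem_K)
  moreover have "inner p w2 = inner u z1" if "(u, p) \<in> D1" for u p
    using t[of "(0, u, 0, 0)" "(0, 0, p, 0)"] that by (simp add: d_def D_zero zero_mem_K)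
  moreover have "inner p w3 = inner u z2" if "(u, p) \<in> D2" for u p
    using t[of "(0, 0, u, 0)" "(0, 0, 0, p)"] that by (simp add: d_def D_zero zero_mem_K)
  \<comment> \<open>The vector \<open>(0, 0, 0, z3)\<close> is annihilated by \<open>d\<close>, so
    testing with it gives \<open>inner z3 z3 = 0\<close>.\<close>
  moreover have "z3 = 0"
    using t[of "(0, 0, 0, z3)" "(0, 0, 0, 0)"] mem by (simp add: d_def D_zero)
  ultimately show "wz \<in> ds" using mem by (auto simp: wz ds_def Ds_iff)
qed

lemma d_eq: "d = weak_graph K K T"
  unfolding weak_graph_def
proof (intro set_eqI iffI)
  fix xy assume "xy \<in> d"
  then show "xy \<in> {(x, y). x \<in> K \<and> y \<in> K \<and> (\<forall>(a, b)\<in>T. inner y a = inner x b)}"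
    by (auto simp: d_def T_def K_def zero_mem_K D_iff zero_prod_def)
next
  fix xy assume *: "xy \<in> {(x, y). x \<in> K \<and> y \<in> K \<and> (\<forall>(a, b)\<in>T. inner y a = inner x b)}"
  obtain x0 x1 x2 x3 y0 y1 y2 y3 where xy: "xy = ((x0, x1, x2, x3), (y0, y1, y2, y3))"
    by (metis surj_pair)
  have t: "inner (y0, y1, y2, y3) a = inner (x0, x1, x2, x3) b" if "(a, b) \<in> T" for a b
    using * that by (auto simp: xy)
  have "inner y1 a = inner x0 b" if "(a, b) \<in> T0" for a b
    using t[of "(0, a, 0, 0)" "(b, 0, 0, 0)"] that by (force simp: T_def)
  moreover have "inner y2 a = inner x1 b" if "(a, b) \<in> T1" for a b
    using t[of "(0, 0, a, 0)" "(0, b, 0, 0)"] that by (force simp: T_def)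
  moreover have "inner y3 a = inner x2 b" if "(a, b) \<in> T2" for a b
    using t[of "(0, 0, 0, a)" "(0, 0, b, 0)"] that by (force simp: T_def)
  moreover have "y0 = 0"
    using t[of "(y0, 0, 0, 0)" 0] by (simp add: T_def)
  ultimately show "xy \<in> d" using * by (auto simp: xy d_def D_iff K_def)
qed

lemma D_uminus: "(x0, y1) \<in> D0 \<Longrightarrow> (- x0, - y1) \<in> D0" "(x1, y2) \<in> D1 \<Longrightarrow> (- x1, - y2) \<in> D1"
   "(x2, y3) \<in> D2 \<Longrightarrow> (- x2, - y3) \<in> D2"
  using subspace_neg[OF subspace_Ks(1)] subspace_neg[OF subspace_Ks(2)]
    subspace_neg[OF subspace_Ks(3)] subspace_neg[OF subspace_Ks(4)]
  by (auto simp: D_iff)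

lemma L_eq: "L = {(u, v). \<exists>p q. (u, p) \<in> d \<and> (u, q) \<in> ds \<and> v = J (p + q)}"
proof (intro set_eqI iffI)
  fix uv assume "uv \<in> L"
  then obtain x0 x1 x2 x3 G S r z0 z1 z2 where *:
    "uv = ((x0, x1, x2, x3), (z0, - G - z1, S + z2, - r))"
    "(x0, G) \<in> D0" "(x1, S) \<in> D1" "(x2, r) \<in> D2" "(x1, z0) \<in> D0s" "(x2, z1) \<in> D1s" "(x3, z2) \<in> D2s"
    unfolding L_def by auto
  have "((x0, x1, x2, x3), (0, G, S, r)) \<in> d" "((x0, x1, x2, x3), (z0, z1, z2, 0)) \<in> ds"
    using * D_K Ds_K by (auto simp: d_def ds_def)
  moreover have "(z0, - G - z1, S + z2, - r) = J ((0, G, S, r) + (z0, z1, z2, 0))"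
    by (simp add: J_def)
  ultimately show "uv \<in> {(u, v). \<exists>p q. (u, p) \<in> d \<and> (u, q) \<in> ds \<and> v = J (p + q)}"
    unfolding *(1) by blast
next
  fix uv assume "uv \<in> {(u, v). \<exists>p q. (u, p) \<in> d \<and> (u, q) \<in> ds \<and> v = J (p + q)}"
  then show "uv \<in> L" unfolding L_def d_def ds_def by (fastforce simp: J_def)
qed

sublocale graded_complex K T J d ds L
proof (rule graded_complex.intro)
  show "closed K" "subspace K"
    unfolding K_def by (intro closed_Times closed_Ks subspace_Times subspace_Ks)+
  show "linear J" by (rule linearI) (auto simp: J_def)
  show "J (J x) = x" "inner (J x) (J y) = inner x y" for x y
    by (auto simp: J_def split: prod.splits)
  show "x \<in> K \<Longrightarrow> J x \<in> K" for x
    using subspace_Ks by (auto simp: J_def K_def subspace_neg)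
  show "(y, 0) \<in> d" if "(x, y) \<in> d" for x y
    using that D1_D0 D2_D1 D_K by (fastforce simp: d_def zero_prod_def D_zero)
  show "(x, y) \<in> d \<Longrightarrow> (J x, - J y) \<in> d" for x y
    using subspace_Ks(4) D_uminus by (auto simp: d_def J_def subspace_neg)
qed (rule d_eq ds_eq L_eq)+

text \<open>Only the two constraints enter, not the domains of \<open>D1\<close> and
  \<open>D1s\<close>, so \<open>N\<close> is closed in the norm of the product space and not merely
  in a graph norm.\<close>

definition N :: "('a \<times> 'b \<times> 'c \<times> 'e) set" where
  "N = {(x0, x1, x2, x3). x0 = 0 \<and> x3 = 0 \<and> (x1, 0) \<in> D0s \<and> (x2, 0) \<in> D2}"

lemma closed_N: "closed N"
proof -
  have "closed D0s" "closed D2"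
    unfolding Ds_def D_def adjoint_graph_eq by (intro closed_weak_graph closed_Ks)+
  moreover have "N = {x. fst x = 0} \<inter> {x. snd (snd (snd x)) = 0} \<inter>
     ((\<lambda>x. (fst (snd x), 0)) -` D0s) \<inter> ((\<lambda>x. (fst (snd (snd x)), 0)) -` D2)"
    by (auto simp: N_def)
  ultimately show ?thesis
    by (auto intro!: closed_Int closed_Collect_eq continuous_closed_vimage continuous_intros)
qed

lemma N_sub_K: "N \<subseteq> K"
  using zero_mem_K D_K Ds_K by (auto simp: N_def K_def)

text \<open>Testing the first equation of the resolvent system with \<open>x0\<close> gives
  \<open>|x0|\<^sup>2 + h\<^sup>2 |G|\<^sup>2 = 0\<close> because \<open>d1 G = 0\<close>; the last component is treated in the same way.\<close>

lemma N_resolvent_invariant: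
  assumes h: "h > 0" and f: "f \<in> N" and L: "(x, y) \<in> L" and eq: "x - h *\<^sub>R y = f"
  shows "x \<in> N"
proof -
  obtain x0 x1 x2 x3 G S r z0 z1 z2 where *:
    "x = (x0, x1, x2, x3)" "y = (z0, - G - z1, S + z2, - r)"
    "(x0, G) \<in> D0" "(x1, S) \<in> D1" "(x2, r) \<in> D2" "(x1, z0) \<in> D0s" "(x2, z1) \<in> D1s" "(x3, z2) \<in> D2s"
    using L unfolding L_def by auto
  obtain f1 f2 where f12: "f = (0, f1, f2, 0)" "(f1, 0) \<in> D0s" "(f2, 0) \<in> D2"
    using f by (auto simp: N_def)
  \<comment> \<open>The outer components of \<open>f\<close> are zero, so \<open>x0\<close> is
    \<open>h z0\<close> and \<open>x3\<close> is \<open>- h r\<close>: each multiplier is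
    proportional to the residual of a constraint, and the two vanish together.\<close>
  have e: "x0 = h *\<^sub>R z0" "x1 = f1 - h *\<^sub>R (G + z1)" "x2 = f2 + h *\<^sub>R (S + z2)" "x3 = - (h *\<^sub>R r)"
    using eq by (auto simp: * f12 algebra_simps eq_neg_iff_add_eq_0)
  have "inner x0 z0 = inner G x1" using adj0[OF *(3,6)] by simp
  also have "\<dots> = inner G f1 - h * inner G G - h * inner G z1"
    unfolding e(2) by (simp add: inner_diff inner_add algebra_simps)
  also have "inner G f1 = 0" using adj0[OF *(3) f12(2)] by simp
  also have "inner G z1 = 0" using adj1[OF D1_D0[OF *(3)] *(7)] by simp
  finally have "h * inner z0 z0 + h * inner G G = 0" unfolding e(1) by simp
  then have "inner z0 z0 + inner G G = 0" using h by (simp flip: distrib_left)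
  then have z0: "z0 = 0" using inner_ge_zero[of z0] inner_ge_zero[of G]
    by (simp add: add_nonneg_eq_0_iff)
  have "inner r x3 = inner x2 z2" using adj2[OF *(5,8)] by simp
  also have "\<dots> = inner f2 z2 + h * inner S z2 + h * inner z2 z2"
    unfolding e(3) by (simp add: inner_add algebra_simps)
  also have "inner f2 z2 = 0" using adj2[OF f12(3) *(8)] by simp
  also have "inner S z2 = 0" using adj2[OF D2_D1[OF *(4)] *(8)] by simp
  finally have "h * inner r r + h * inner z2 z2 = 0" unfolding e(4) by simp
  then have "inner r r + inner z2 z2 = 0" using h by (simp flip: distrib_left)
  then have r: "r = 0" using inner_ge_zero[of r] inner_ge_zero[of z2]
    by (simp add: add_nonneg_eq_0_iff)
  show ?thesis using * e z0 r by (auto simp: N_def)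
qed

theorem complex_evolution_exists:
  assumes "K \<subseteq> closure (fst ` L)" "(u0, v0) \<in> L"
  shows "\<exists>u u'. u 0 = u0 \<and> (\<forall>t\<ge>0. (u t, u' t) \<in> L \<and> norm (u t) \<le> norm u0 \<and>
      (u has_vector_derivative u' t) (at t within {0..})) \<and>
    continuous_on {0..} u \<and> continuous_on {0..} u' \<and> (u0 \<in> N \<longrightarrow> (\<forall>t\<ge>0. u t \<in> N))"
proof -
  obtain u u' where u: "u 0 = u0" "\<forall>t\<ge>0. (u t, u' t) \<in> L \<and> norm (u t) \<le> norm u0 \<and>
      (u has_vector_derivative u' t) (at t within {0..})"
    "continuous_on {0..} u" "continuous_on {0..} u'"
    and inv: "\<forall>N. closed N \<longrightarrow> N \<subseteq> K \<longrightarrow> u0 \<in> N \<longrightarrow>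
      (\<forall>h>0. \<forall>f\<in>N. \<forall>x y. (x, y) \<in> L \<longrightarrow> x - h *\<^sub>R y = f \<longrightarrow> x \<in> N) \<longrightarrow> (\<forall>t\<ge>0. u t \<in> N)"
    using skew_generator.evolution_exists[OF skew_generator_L[OF assms(1)] assms(2)] by blast
  have "\<forall>t\<ge>0. u t \<in> N" if "u0 \<in> N"
    using inv[rule_format, OF closed_N N_sub_K that N_resolvent_invariant] by simp
  then show ?thesis using u by blast
qed

lemma L_single_valued:
  assumes "K \<subseteq> closure (fst ` L)" "(u, v) \<in> L" "(u, w) \<in> L"
  shows "v = w"
  by (rule skew_generator.A_single_valued[OF skew_generator_L[OF assms(1)] assms(2,3)])

lemma N_graph_L:
  assumes "(A, 0) \<in> D0s" "(g, z) \<in> D1s" "(A, S) \<in> D1" "(g, 0) \<in> D2"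
  shows "((0, A, g, 0), (0, - z, S, 0)) \<in> L"
  unfolding L_def mem_Collect_eq
  by (rule exI[of _ 0], rule exI[of _ A], rule exI[of _ g], rule exI[of _ 0], rule exI[of _ 0],
      rule exI[of _ S], rule exI[of _ 0], rule exI[of _ 0], rule exI[of _ z], rule exI[of _ 0])
     (use assms D_zero Ds_zero in simp)

text \<open>Membership in \<open>L\<close> only provides some value for each operator, and the
  values \<open>G\<close>, \<open>r\<close>, \<open>z0\<close>, \<open>z2\<close> need not be the
  zero ones. \<open>N_graph_L\<close> exhibits a pair with zeros, and single-valuedness of
  \<open>L\<close> identifies it with \<open>u'\<close>.\<close>

lemma L_graph_N:
  assumes "K \<subseteq> closure (fst ` L)" "(u, u') \<in> L" "u \<in> N"
  obtains A g z S where "u = (0, A, g, 0)" "u' = (0, - z, S, 0)"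
    "(A, 0) \<in> D0s" "(g, z) \<in> D1s" "(A, S) \<in> D1" "(g, 0) \<in> D2"
proof -
  obtain A g where N: "u = (0, A, g, 0)" "(A, 0) \<in> D0s" "(g, 0) \<in> D2"
    using assms(3) by (auto simp: N_def)
  obtain S z where "(A, S) \<in> D1" "(g, z) \<in> D1s"
    using assms(2) unfolding L_def N(1) by auto
  moreover from this have "u' = (0, - z, S, 0)"
    using L_single_valued[OF assms(1,2)] N_graph_L[OF N(2)] N(1,3) by blast
  ultimately show ?thesis using that N by blast
qed

end

section \<open>Fields on a domain as elements of the Hilbert space\<close>

text \<open>Applied pointwise to the values of a field. Linearity makes the projection continuous,
  so that its composition with a measurable field is measurable.\<close>

lemma linear_orthogonal_projection_exists:
  fixes P :: "'a::euclidean_space set"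
  assumes "subspace P"
  obtains \<pi> where "linear \<pi>" "\<And>v. \<pi> v \<in> P" "\<And>v p. p \<in> P \<Longrightarrow> inner (v - \<pi> v) p = 0"
proof -
  have "\<exists>q. q \<in> P \<and> (\<forall>p\<in>P. inner (v - q) p = 0)" for v
    by (rule orthogonal_projection_exists[OF closed_subspace[OF assms] assms, of v]) blast
  then obtain \<pi> where \<pi>: "\<And>v. \<pi> v \<in> P" "\<And>v p. p \<in> P \<Longrightarrow> inner (v - \<pi> v) p = 0"
    by metis
  have unique: "q = \<pi> v" if "q \<in> P" "\<And>p. p \<in> P \<Longrightarrow> inner (v - q) p = 0" for q v
  proof -
    have "\<pi> v - q \<in> P" using that(1) \<pi>(1) assms by (simp add: subspace_diff)
    then have "inner (v - q) (\<pi> v - q) - inner (v - \<pi> v) (\<pi> v - q) = 0" using that \<pi>(2) by simp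
    then have "inner (\<pi> v - q) (\<pi> v - q) = 0" by (simp add: inner_diff_left)
    then show ?thesis by simp
  qed
  have "linear \<pi>"
  proof (rule linearI)
    fix v w show "\<pi> (v + w) = \<pi> v + \<pi> w"
    proof (rule unique[symmetric])
      fix p assume p: "p \<in> P"
      show "inner (v + w - (\<pi> v + \<pi> w)) p = 0"
        using \<pi>(2)[OF p, of v] \<pi>(2)[OF p, of w] by (simp add: inner_diff_left inner_add_left)
    qed (simp add: \<pi> subspace_add assms)
  next
    fix c v show "\<pi> (c *\<^sub>R v) = c *\<^sub>R \<pi> v"
    proof (rule unique[symmetric])
      fix p assume p: "p \<in> P"
      show "inner (c *\<^sub>R v - c *\<^sub>R \<pi> v) p = 0"
        using \<pi>(2)[OF p, of v] by (simp flip: scaleR_diff_right)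
    qed (simp add: \<pi> subspace_scale assms)
  qed
  with \<pi> show ?thesis using that by blast
qed

definition zext :: "pt set \<Rightarrow> (pt \<Rightarrow> 'b::zero) \<Rightarrow> pt \<Rightarrow> 'b" where
  "zext \<Omega> f = (\<lambda>x. if x \<in> \<Omega> then f x else 0)"

definition emb :: "pt set \<Rightarrow> (pt \<Rightarrow> 'b::euclidean_space) \<Rightarrow> (pt, 'b) lsq" where
  "emb \<Omega> f = abs_lsq (zext \<Omega> f)"

text \<open>\<open>P\<close> is the constraint on the values of a field. With
  \<open>P = UNIV\<close> this is the space of all classes that vanish off \<Omega>.\<close>

definition Kspace :: "pt set \<Rightarrow> 'b::euclidean_space set \<Rightarrow> (pt, 'b) lsq set" where
  "Kspace \<Omega> P = {emb \<Omega> f | f. L2 \<Omega> f \<and> (AE x in lebesgue_on \<Omega>. f x \<in> P)}"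

locale open_domain =
  fixes \<Omega> :: "pt set"
  assumes open_\<Omega>: "open \<Omega>"
begin

lemma \<Omega>_meas: "\<Omega> \<in> sets lebesgue"
  using open_\<Omega> by (simp add: borel_open)

lemma AE_on_iff: "(AE x in lebesgue_on \<Omega>. Q x) \<longleftrightarrow> (AE x in lebesgue. x \<in> \<Omega> \<longrightarrow> Q x)"
  by (rule AE_restrict_space_iff) (simp add: \<Omega>_meas)

lemma L2_iff:
  fixes f :: "pt \<Rightarrow> 'b::euclidean_space"
  shows "L2 \<Omega> f \<longleftrightarrow> sq_int (zext \<Omega> f)"
proof -
  have "(\<lambda>x. (norm (zext \<Omega> f x))\<^sup>2) = (\<lambda>x. if x \<in> \<Omega> then (norm (f x))\<^sup>2 else 0)"
    by (auto simp: zext_def)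
  then show ?thesis
    unfolding L2_def sq_int_def
    using Lebesgue_Measure.integrable_restrict_UNIV[OF \<Omega>_meas, of "\<lambda>x. (norm (f x))\<^sup>2"] borel_measurable_if[OF \<Omega>_meas, of f]
    by (simp add: zext_def)
qed

lemma inner_emb:
  fixes f g :: "pt \<Rightarrow> 'b::euclidean_space"
  assumes "L2 \<Omega> f" "L2 \<Omega> g"
  shows "inner (emb \<Omega> f) (emb \<Omega> g) = L2inner \<Omega> f g"
proof -
  have "(\<lambda>x. inner (zext \<Omega> f x) (zext \<Omega> g x)) = (\<lambda>x. if x \<in> \<Omega> then inner (f x) (g x) else 0)"
    by (auto simp: zext_def)
  then show ?thesis
    using assms Lebesgue_Measure.integral_restrict_UNIV[OF \<Omega>_meas, of "\<lambda>x. inner (f x) (g x)"]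
    by (simp add: emb_def inner_abs_lsq L2_iff L2inner_def)
qed

lemma norm_emb:
  fixes f :: "pt \<Rightarrow> 'b::euclidean_space"
  assumes "L2 \<Omega> f"
  shows "norm (emb \<Omega> f) = L2norm \<Omega> f"
  using inner_emb[OF assms assms]
  by (simp add: norm_eq_sqrt_inner[of "emb \<Omega> f"] L2norm_def L2inner_def power2_norm_eq_inner)

lemma L2_add: "L2 \<Omega> f \<Longrightarrow> L2 \<Omega> g \<Longrightarrow> L2 \<Omega> (\<lambda>x. f x + g x)"
  and emb_add: "L2 \<Omega> f \<Longrightarrow> L2 \<Omega> g \<Longrightarrow> emb \<Omega> (\<lambda>x. f x + g x) = emb \<Omega> f + emb \<Omega> g"
  for f g :: "pt \<Rightarrow> 'b::euclidean_space"
proof -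
  have e: "zext \<Omega> (\<lambda>x. f x + g x) = (\<lambda>x. zext \<Omega> f x + zext \<Omega> g x)" by (auto simp: zext_def)
  show "L2 \<Omega> f \<Longrightarrow> L2 \<Omega> g \<Longrightarrow> L2 \<Omega> (\<lambda>x. f x + g x)" by (simp add: L2_iff e sq_int_add)
  show "L2 \<Omega> f \<Longrightarrow> L2 \<Omega> g \<Longrightarrow> emb \<Omega> (\<lambda>x. f x + g x) = emb \<Omega> f + emb \<Omega> g"
    by (simp add: L2_iff emb_def e abs_lsq_add)
qed

lemma L2_scaleR: "L2 \<Omega> f \<Longrightarrow> L2 \<Omega> (\<lambda>x. c *\<^sub>R f x)"
  and emb_scaleR: "L2 \<Omega> f \<Longrightarrow> emb \<Omega> (\<lambda>x. c *\<^sub>R f x) = c *\<^sub>R emb \<Omega> f"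
  for f :: "pt \<Rightarrow> 'b::euclidean_space"
proof -
  have e: "zext \<Omega> (\<lambda>x. c *\<^sub>R f x) = (\<lambda>x. c *\<^sub>R zext \<Omega> f x)" by (auto simp: zext_def)
  show "L2 \<Omega> f \<Longrightarrow> L2 \<Omega> (\<lambda>x. c *\<^sub>R f x)" by (simp add: L2_iff e sq_int_scaleR)
  show "L2 \<Omega> f \<Longrightarrow> emb \<Omega> (\<lambda>x. c *\<^sub>R f x) = c *\<^sub>R emb \<Omega> f"
    by (simp add: L2_iff emb_def e abs_lsq_scaleR)
qed

lemma L2_minus: "L2 \<Omega> f \<Longrightarrow> L2 \<Omega> (\<lambda>x. - f x)"
  and emb_minus: "L2 \<Omega> f \<Longrightarrow> emb \<Omega> (\<lambda>x. - f x) = - emb \<Omega> f"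
  for f :: "pt \<Rightarrow> 'b::euclidean_space"
  using L2_scaleR[of f "-1"] emb_scaleR[of f "-1"] by auto

lemma L2_diff: "L2 \<Omega> f \<Longrightarrow> L2 \<Omega> g \<Longrightarrow> L2 \<Omega> (\<lambda>x. f x - g x)"
  and emb_diff: "L2 \<Omega> f \<Longrightarrow> L2 \<Omega> g \<Longrightarrow> emb \<Omega> (\<lambda>x. f x - g x) = emb \<Omega> f - emb \<Omega> g"
  for f g :: "pt \<Rightarrow> 'b::euclidean_space"
  using L2_add[OF _ L2_minus, of f g] emb_add[OF _ L2_minus, of f g] emb_minus[of g] by auto

lemma L2_zero: "L2 \<Omega> (\<lambda>x. 0)"
  and emb_zero: "emb \<Omega> (\<lambda>x. 0 :: 'b::euclidean_space) = 0"
  by (auto simp: L2_def emb_def zext_def zero_lsq_def)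

lemma L2_sum: "finite I \<Longrightarrow> (\<And>i. i \<in> I \<Longrightarrow> L2 \<Omega> (f i)) \<Longrightarrow> L2 \<Omega> (\<lambda>x. \<Sum>i\<in>I. f i x)"
  for f :: "'i \<Rightarrow> pt \<Rightarrow> 'b::euclidean_space"
  by (induction I rule: finite_induct) (auto simp: L2_zero L2_add)

lemma emb_eq_iff:
  fixes f g :: "pt \<Rightarrow> 'b::euclidean_space"
  assumes "L2 \<Omega> f" "L2 \<Omega> g"
  shows "emb \<Omega> f = emb \<Omega> g \<longleftrightarrow> (AE x in lebesgue_on \<Omega>. f x = g x)"
proof -
  have "zext \<Omega> f x = zext \<Omega> g x \<longleftrightarrow> (x \<in> \<Omega> \<longrightarrow> f x = g x)" for x by (auto simp: zext_def)
  then show ?thesis using assms by (simp add: emb_def abs_lsq_eq_iff L2_iff AE_on_iff)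
qed

lemma L2_cong_AE:
  fixes f g :: "pt \<Rightarrow> 'b::euclidean_space"
  assumes f: "L2 \<Omega> f" and eq: "AE x in lebesgue_on \<Omega>. f x = g x"
  shows "L2 \<Omega> g"
proof -
  have "AE x in lebesgue. zext \<Omega> f x = zext \<Omega> g x"
    using eq unfolding AE_on_iff by (rule AE_mp) (auto simp: zext_def)
  then show ?thesis using f sq_int_cong_AE unfolding L2_iff by blast
qed

lemma Kspace_I: "L2 \<Omega> f \<Longrightarrow> AE x in lebesgue_on \<Omega>. f x \<in> P \<Longrightarrow> emb \<Omega> f \<in> Kspace \<Omega> P"
  by (auto simp: Kspace_def)

lemma emb_Kspace_iff:
  assumes "L2 \<Omega> f"
  shows "emb \<Omega> f \<in> Kspace \<Omega> P \<longleftrightarrow> (AE x in lebesgue_on \<Omega>. f x \<in> P)"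
proof
  assume "emb \<Omega> f \<in> Kspace \<Omega> P"
  then obtain g where g: "L2 \<Omega> g" "AE x in lebesgue_on \<Omega>. g x \<in> P" "emb \<Omega> f = emb \<Omega> g"
    by (auto simp: Kspace_def)
  have "AE x in lebesgue_on \<Omega>. f x = g x" using g(3) emb_eq_iff[OF assms g(1)] by simp
  with g(2) show "AE x in lebesgue_on \<Omega>. f x \<in> P" by eventually_elim simp
qed (use assms Kspace_I in blast)

lemma subspace_Kspace:
  assumes "subspace P"
  shows "subspace (Kspace \<Omega> P)"
  unfolding subspace_def
proof (intro conjI ballI allI)
  show "0 \<in> Kspace \<Omega> P"
    using Kspace_I[OF L2_zero, of P] subspace_0[OF assms] by (simp add: emb_zero)
next
  fix x y assume "x \<in> Kspace \<Omega> P" "y \<in> Kspace \<Omega> P"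
  then obtain f g where f: "x = emb \<Omega> f" "L2 \<Omega> f" "AE x in lebesgue_on \<Omega>. f x \<in> P"
    and g: "y = emb \<Omega> g" "L2 \<Omega> g" "AE x in lebesgue_on \<Omega>. g x \<in> P"
    by (auto simp: Kspace_def)
  from f(3) g(3) have "AE x in lebesgue_on \<Omega>. f x + g x \<in> P"
    by eventually_elim (simp add: subspace_add assms)
  then show "x + y \<in> Kspace \<Omega> P"
    using Kspace_I[OF L2_add[OF f(2) g(2)]] emb_add[OF f(2) g(2)] f(1) g(1) by simp
next
  fix c x assume "x \<in> Kspace \<Omega> P"
  then obtain f where f: "x = emb \<Omega> f" "L2 \<Omega> f" "AE x in lebesgue_on \<Omega>. f x \<in> P"
    by (auto simp: Kspace_def)
  from f(3) have "AE x in lebesgue_on \<Omega>. c *\<^sub>R f x \<in> P"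
    by eventually_elim (simp add: subspace_scale assms)
  then show "c *\<^sub>R x \<in> Kspace \<Omega> P"
    using Kspace_I[OF L2_scaleR[OF f(2)]] emb_scaleR[OF f(2)] f(1) by simp
qed

text \<open>The space is the annihilator of the functions that are pointwise orthogonal to \<open>P\<close> on the domain.\<close>

lemma closed_Kspace:
  assumes P: "subspace P"
  shows "closed (Kspace \<Omega> P)"
proof -
  define Q where "Q = {abs_lsq g | g. sq_int g \<and> (\<forall>x\<in>\<Omega>. \<forall>p\<in>P. inner p (g x) = 0)}"
  have "Kspace \<Omega> P = (\<Inter>y\<in>Q. {x. inner x y = 0})"
  proof (intro set_eqI iffI)
    fix x assume "x \<in> Kspace \<Omega> P"
    then obtain f where f: "x = emb \<Omega> f" "L2 \<Omega> f" "AE x in lebesgue_on \<Omega>. f x \<in> P"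
      by (auto simp: Kspace_def)
    have "inner x (abs_lsq g) = 0" if g: "sq_int g" "\<forall>x\<in>\<Omega>. \<forall>p\<in>P. inner p (g x) = 0" for g
    proof -
      have "AE x in lebesgue. inner (zext \<Omega> f x) (g x) = 0"
        using f(3) unfolding AE_on_iff by (rule AE_mp) (use g in \<open>auto simp: zext_def\<close>)
      moreover have "(\<lambda>x. inner (zext \<Omega> f x) (g x)) \<in> borel_measurable lebesgue"
        using sq_int_inner[OF f(2)[unfolded L2_iff] g(1)] by auto
      ultimately have "integral\<^sup>L lebesgue (\<lambda>x. inner (zext \<Omega> f x) (g x)) = integral\<^sup>L lebesgue (\<lambda>x::pt. 0::real)"
        by (intro integral_cong_AE) auto
      then show ?thesis using f(1,2) g(1) by (simp add: emb_def inner_abs_lsq L2_iff)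
    qed
    then show "x \<in> (\<Inter>y\<in>Q. {x. inner x y = 0})" by (auto simp: Q_def)
  next
    fix y assume y: "y \<in> (\<Inter>y\<in>Q. {x. inner x y = 0})"
    obtain f where f: "sq_int f" "y = abs_lsq f" by (rule lsq_cases)
    obtain \<pi> where \<pi>: "linear \<pi>" "\<And>v. \<pi> v \<in> P" "\<And>v p. p \<in> P \<Longrightarrow> inner (v - \<pi> v) p = 0"
      using linear_orthogonal_projection_exists[OF P] by metis
    \<comment> \<open>The part of \<open>f\<close> that violates membership: its component
      orthogonal to \<open>P\<close> on \<Omega>, and all of \<open>f\<close> outside. It is an
      admissible annihilating function, and its pointwise product with \<open>f\<close> is its own
      squared norm, so it vanishes almost everywhere.\<close>
    define g where "g = (\<lambda>x. if x \<in> \<Omega> then f x - \<pi> (f x) else f x)"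
    have fm[measurable]: "f \<in> borel_measurable lebesgue" using f by (simp add: sq_int_def)
    have [measurable]: "\<Omega> \<in> sets lebesgue" by (rule \<Omega>_meas)
    have "(\<lambda>x. \<pi> (f x)) \<in> borel_measurable lebesgue"
      using borel_measurable_continuous_onI[OF linear_continuous_on[OF linear_conv_bounded_linear[THEN iffD1, OF \<pi>(1)]]]
      by (rule measurable_compose[OF fm])
    then have gm: "g \<in> borel_measurable lebesgue" unfolding g_def by measurable
    have fg: "inner (f x) (g x) = (norm (g x))\<^sup>2" for x
    proof (cases "x \<in> \<Omega>")
      case True
      have "inner (f x) (g x) - inner (g x) (g x) = inner (\<pi> (f x)) (f x - \<pi> (f x))"
        using True by (simp add: g_def inner_diff_left)
      also have "\<dots> = 0" using \<pi>(3)[OF \<pi>(2)] by (simp add: inner_commute)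
      finally show ?thesis by (simp add: power2_norm_eq_inner)
    qed (simp add: g_def power2_norm_eq_inner)
    have "norm (g x) \<le> norm (f x)" for x
    proof -
      have "(norm (g x))\<^sup>2 \<le> norm (f x) * norm (g x)" using fg[of x] norm_cauchy_schwarz[of "f x" "g x"] by simp
      then show ?thesis
        by (cases "g x = 0") (auto simp: power2_eq_square)
    qed
    then have "integrable lebesgue (\<lambda>x. (norm (g x))\<^sup>2)"
      using gm by (intro Bochner_Integration.integrable_bound[OF sq_int_norm2[OF f(1)]])
        (auto intro!: power_mono)
    then have g: "sq_int g" using gm by (simp add: sq_int_def)
    have "abs_lsq g \<in> Q"
      unfolding Q_def using g \<pi>(3) by (auto simp: g_def inner_commute)
    then have "inner (abs_lsq f) (abs_lsq g) = 0" using y f(2) by auto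
    then have "integral\<^sup>L lebesgue (\<lambda>x. (norm (g x))\<^sup>2) = 0" using inner_abs_lsq[OF f(1) g] fg by simp
    then have "abs_lsq g = 0" using norm2_abs_lsq[OF g] by simp
    then have "abs_lsq g = abs_lsq (\<lambda>x. 0)" by (simp add: zero_lsq_def)
    then have g0: "AE x in lebesgue. g x = 0" using abs_lsq_eq_iff[OF g sq_int_zero] by simp
    have "AE x in lebesgue. f x = zext \<Omega> f x"
      using g0 by (rule AE_mp) (auto simp: g_def zext_def)
    moreover from this have "L2 \<Omega> f" unfolding L2_iff by (rule sq_int_cong_AE[OF f(1)])
    ultimately have "y = emb \<Omega> f" using f by (simp add: emb_def abs_lsq_eq_iff L2_iff)
    moreover have "AE x in lebesgue_on \<Omega>. f x \<in> P"
      unfolding AE_on_iff using g0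
    proof (rule AE_mp, intro AE_I2 impI)
      fix x assume "g x = 0" "x \<in> \<Omega>"
      then have "f x = \<pi> (f x)" by (simp add: g_def)
      then show "f x \<in> P" using \<pi>(2) by metis
    qed
    ultimately show "y \<in> Kspace \<Omega> P" using \<open>L2 \<Omega> f\<close> Kspace_I by simp
  qed
  also have "closed \<dots>" by (intro closed_INT ballI closed_Collect_eq continuous_intros)
  finally show ?thesis .
qed

end

section \<open>Test functions and the complex property\<close>

lemma pds_append: "pds (ks @ [k]) \<phi> = pds ks (pd k \<phi>)"
  by (induction ks) auto

lemma smooth_pd: "smooth \<phi> \<Longrightarrow> smooth (pd k \<phi>)"
  unfolding smooth_def by (metis pds_append)

lemma smooth_differentiable: "smooth \<phi> \<Longrightarrow> \<phi> differentiable (at x)"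
  unfolding smooth_def by (metis pds.simps(1))

lemma smooth_continuous: "smooth \<phi> \<Longrightarrow> continuous_on S \<phi>"
  by (meson continuous_at_imp_continuous_on differentiable_imp_continuous_within smooth_differentiable)

lemma has_real_derivative_line:
  assumes "smooth \<phi>"
  shows "((\<lambda>s. \<phi> (y + s *\<^sub>R axis i 1)) has_real_derivative pd i \<phi> (y + s *\<^sub>R axis i 1)) (at s)"
proof -
  have f: "(\<phi> has_derivative frechet_derivative \<phi> (at (y + s *\<^sub>R axis i 1))) (at (y + s *\<^sub>R axis i 1))"
    using smooth_differentiable[OF assms] frechet_derivative_works by blast
  have "((\<lambda>s. y + s *\<^sub>R axis i 1 :: pt) has_derivative (\<lambda>t. t *\<^sub>R axis i 1)) (at s)"
    by (auto intro!: derivative_eq_intros)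
  from has_derivative_compose[OF this f]
  have "((\<lambda>s. \<phi> (y + s *\<^sub>R axis i 1)) has_derivative
      (\<lambda>t. frechet_derivative \<phi> (at (y + s *\<^sub>R axis i 1)) (t *\<^sub>R axis i 1))) (at s)" .
  moreover have "frechet_derivative \<phi> (at (y + s *\<^sub>R axis i 1)) (t *\<^sub>R axis i 1) = pd i \<phi> (y + s *\<^sub>R axis i 1) * t" for t
    using linear_scale[OF has_derivative_linear[OF f]] by (simp add: pd_def)
  ultimately show ?thesis by (simp add: has_field_derivative_def)
qed

text \<open>The mean value theorem is applied in direction \<open>i\<close> to a difference in
  direction \<open>j\<close>, and then in direction \<open>j\<close> to the first derivative so
  obtained.\<close>

lemma second_difference_mean_value:
  assumes \<phi>: "smooth \<phi>" and h: "h > 0"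
  shows "\<exists>\<xi> \<eta>. 0 \<le> \<xi> \<and> \<xi> \<le> h \<and> 0 \<le> \<eta> \<and> \<eta> \<le> h \<and>
    \<phi> (x + h *\<^sub>R axis i 1 + h *\<^sub>R axis j 1) - \<phi> (x + h *\<^sub>R axis i 1) - \<phi> (x + h *\<^sub>R axis j 1) + \<phi> x
      = h * h * pd j (pd i \<phi>) (x + \<xi> *\<^sub>R axis i 1 + \<eta> *\<^sub>R axis j 1)"
proof -
  define F where "F s = \<phi> ((x + h *\<^sub>R axis j 1) + s *\<^sub>R axis i 1) - \<phi> (x + s *\<^sub>R axis i 1)" for s
  have "\<exists>\<xi>. 0 < \<xi> \<and> \<xi> < h \<and> F h - F 0 = (h - 0) *
      (pd i \<phi> ((x + h *\<^sub>R axis j 1) + \<xi> *\<^sub>R axis i 1) - pd i \<phi> (x + \<xi> *\<^sub>R axis i 1))"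
    unfolding F_def by (rule MVT2[OF h]) (intro DERIV_diff has_real_derivative_line \<phi>)
  then obtain \<xi> where \<xi>: "0 < \<xi>" "\<xi> < h"
    "F h - F 0 = h * (pd i \<phi> ((x + h *\<^sub>R axis j 1) + \<xi> *\<^sub>R axis i 1) - pd i \<phi> (x + \<xi> *\<^sub>R axis i 1))"
    by auto
  have "\<exists>\<eta>. 0 < \<eta> \<and> \<eta> < h \<and> pd i \<phi> ((x + \<xi> *\<^sub>R axis i 1) + h *\<^sub>R axis j 1) - pd i \<phi> ((x + \<xi> *\<^sub>R axis i 1) + 0 *\<^sub>R axis j 1)
      = (h - 0) * pd j (pd i \<phi>) ((x + \<xi> *\<^sub>R axis i 1) + \<eta> *\<^sub>R axis j 1)"
    by (rule MVT2[OF h]) (intro has_real_derivative_line smooth_pd \<phi>)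
  then obtain \<eta> where \<eta>: "0 < \<eta>" "\<eta> < h"
    "pd i \<phi> (x + \<xi> *\<^sub>R axis i 1 + h *\<^sub>R axis j 1) - pd i \<phi> (x + \<xi> *\<^sub>R axis i 1)
      = h * pd j (pd i \<phi>) (x + \<xi> *\<^sub>R axis i 1 + \<eta> *\<^sub>R axis j 1)"
    by auto
  have c: "x + h *\<^sub>R axis j 1 + s *\<^sub>R axis i 1 = x + s *\<^sub>R axis i 1 + h *\<^sub>R axis j 1" for s
    by (simp add: algebra_simps)
  show ?thesis
    by (intro exI[of _ \<xi>] exI[of _ \<eta>]) (use \<xi> \<eta> in \<open>simp add: F_def c algebra_simps\<close>)
qed

text \<open>The second difference is symmetric in \<open>i\<close> and \<open>j\<close>. It equals
  \<open>h\<^sup>2\<close> times either mixed derivative at points that tend to \<open>x\<close>,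
  and continuity of these derivatives identifies the limits.\<close>

lemma pd_commute:
  assumes \<phi>: "smooth \<phi>"
  shows "pd i (pd j \<phi>) = pd j (pd i \<phi>)"
proof
  fix x
  define h :: "nat \<Rightarrow> real" where "h n = 1 / real (Suc n)" for n
  have h: "h n > 0" for n by (simp add: h_def)
  have h0: "h \<longlonglongrightarrow> 0" unfolding h_def by (rule LIMSEQ_Suc, rule lim_1_over_n)
  obtain \<xi> \<eta> where 1: "\<And>n. 0 \<le> \<xi> n \<and> \<xi> n \<le> h n \<and> 0 \<le> \<eta> n \<and> \<eta> n \<le> h n \<and>
    \<phi> (x + h n *\<^sub>R axis i 1 + h n *\<^sub>R axis j 1) - \<phi> (x + h n *\<^sub>R axis i 1) - \<phi> (x + h n *\<^sub>R axis j 1) + \<phi> x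
      = h n * h n * pd j (pd i \<phi>) (x + \<xi> n *\<^sub>R axis i 1 + \<eta> n *\<^sub>R axis j 1)"
    using second_difference_mean_value[OF \<phi> h, where x = x and i = i and j = j] by metis
  obtain \<xi>' \<eta>' where 2: "\<And>n. 0 \<le> \<xi>' n \<and> \<xi>' n \<le> h n \<and> 0 \<le> \<eta>' n \<and> \<eta>' n \<le> h n \<and>
    \<phi> (x + h n *\<^sub>R axis j 1 + h n *\<^sub>R axis i 1) - \<phi> (x + h n *\<^sub>R axis j 1) - \<phi> (x + h n *\<^sub>R axis i 1) + \<phi> x
      = h n * h n * pd i (pd j \<phi>) (x + \<xi>' n *\<^sub>R axis j 1 + \<eta>' n *\<^sub>R axis i 1)"
    using second_difference_mean_value[OF \<phi> h, where x = x and i = j and j = i] by metis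
  have sq: "a \<longlonglongrightarrow> 0" if "\<And>n. 0 \<le> a n \<and> a n \<le> h n" for a
    by (rule tendsto_sandwich[OF _ _ tendsto_const h0]) (use that in auto)
  have lim: "(\<lambda>n. \<psi> (x + a n *\<^sub>R axis k 1 + b n *\<^sub>R axis l 1)) \<longlonglongrightarrow> \<psi> x"
    if "smooth \<psi>" "a \<longlonglongrightarrow> 0" "b \<longlonglongrightarrow> 0" for \<psi> a b k l
  proof -
    have "(\<lambda>n. x + a n *\<^sub>R axis k 1 + b n *\<^sub>R axis l 1) \<longlonglongrightarrow> x + 0 *\<^sub>R axis k 1 + 0 *\<^sub>R axis l 1"
      by (intro tendsto_intros that)
    then show ?thesis
      using isCont_tendsto_compose[of x \<psi>] smooth_differentiable[OF that(1)]
      by (simp add: differentiable_imp_continuous_within)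
  qed
  have l1: "(\<lambda>n. pd j (pd i \<phi>) (x + \<xi> n *\<^sub>R axis i 1 + \<eta> n *\<^sub>R axis j 1)) \<longlonglongrightarrow> pd j (pd i \<phi>) x"
    by (intro lim smooth_pd \<phi> sq) (use 1 in auto)
  have l2: "(\<lambda>n. pd i (pd j \<phi>) (x + \<xi>' n *\<^sub>R axis j 1 + \<eta>' n *\<^sub>R axis i 1)) \<longlonglongrightarrow> pd i (pd j \<phi>) x"
    by (intro lim smooth_pd \<phi> sq) (use 2 in auto)
  have "pd i (pd j \<phi>) (x + \<xi>' n *\<^sub>R axis j 1 + \<eta>' n *\<^sub>R axis i 1)
     = pd j (pd i \<phi>) (x + \<xi> n *\<^sub>R axis i 1 + \<eta> n *\<^sub>R axis j 1)" for n
  proof -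
    have c: "x + h n *\<^sub>R axis j 1 + h n *\<^sub>R axis i 1 = x + h n *\<^sub>R axis i 1 + h n *\<^sub>R axis j 1"
      by (simp add: algebra_simps)
    have "h n * h n * pd i (pd j \<phi>) (x + \<xi>' n *\<^sub>R axis j 1 + \<eta>' n *\<^sub>R axis i 1)
       = h n * h n * pd j (pd i \<phi>) (x + \<xi> n *\<^sub>R axis i 1 + \<eta> n *\<^sub>R axis j 1)"
      using 1[of n] 2[of n] unfolding c by (elim conjE) linarith
    then show ?thesis using h[of n] by simp
  qed
  then show "pd i (pd j \<phi>) x = pd j (pd i \<phi>) x" by (intro LIMSEQ_unique[OF l2]) (simp add: l1)
qed

lemma pd_eq_0_outside_support:
  assumes "x \<notin> closure {x. \<phi> x \<noteq> 0}"
  shows "pd k \<phi> x = 0"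
proof -
  have "(\<phi> has_derivative (\<lambda>_. 0)) (at x)"
  proof (rule has_derivative_transform_within_open[where f="\<lambda>_. 0" and s="- closure {x. \<phi> x \<noteq> 0}"])
    fix y assume "y \<in> - closure {x. \<phi> x \<noteq> 0}"
    then show "0 = \<phi> y" using closure_subset[of "{x. \<phi> x \<noteq> 0}"] by auto
  qed (use assms in auto)
  then have "frechet_derivative \<phi> (at x) = (\<lambda>_. 0)" by (rule frechet_derivative_at[symmetric])
  then show ?thesis by (simp add: pd_def)
qed

lemma test_smooth: "test \<Omega> \<phi> \<Longrightarrow> smooth \<phi>"
  by (simp add: test_def)

text \<open>Supports only shrink under differentiation, so derivatives of test functions may
  themselves be inserted into the weak identities.\<close>

lemma test_pd:
  assumes "test \<Omega> \<phi>" shows "test \<Omega> (pd k \<phi>)"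
proof -
  have sub: "closure {x. pd k \<phi> x \<noteq> 0} \<subseteq> closure {x. \<phi> x \<noteq> 0}"
    using pd_eq_0_outside_support by (intro closure_minimal) auto
  then have "compact (closure {x. pd k \<phi> x \<noteq> 0})"
    using assms compact_Int_closed[of "closure {x. \<phi> x \<noteq> 0}" "closure {x. pd k \<phi> x \<noteq> 0}"]
    by (simp add: test_def Int_absorb1)
  then show ?thesis using assms sub by (auto simp: test_def smooth_pd)
qed

section \<open>Vanishing of the compositions\<close>

lemma eps_skew: "eps i k l = - eps i l k" "eps i k l = - eps l k i" "eps i k l = - eps k i l"
proof -
  have "\<forall>i k l. eps i k l = - eps i l k \<and> eps i k l = - eps l k i \<and> eps i k l = - eps k i l"
    unfolding forall_3 eps_def cross3_def by (simp add: axis_def)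
  then show "eps i k l = - eps i l k" "eps i k l = - eps l k i" "eps i k l = - eps k i l" by blast+
qed

lemma sum_skew_sym_eq_0:
  fixes e b :: "'i::finite \<Rightarrow> 'i \<Rightarrow> real"
  assumes "\<And>j k. e j k = - e k j" "\<And>j k. b j k = b k j"
  shows "(\<Sum>j\<in>UNIV. \<Sum>k\<in>UNIV. e j k * b j k) = 0"
proof -
  have "(\<Sum>j\<in>UNIV. \<Sum>k\<in>UNIV. e j k * b j k) = (\<Sum>j\<in>UNIV. \<Sum>k\<in>UNIV. e k j * b k j)"
    by (rule sum.swap)
  also have "\<dots> = - (\<Sum>j\<in>UNIV. \<Sum>k\<in>UNIV. e j k * b j k)"
    unfolding sum_negf[symmetric] using assms by (intro sum.cong refl) (metis mult_minus_left)
  finally show ?thesis by simp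
qed

context open_domain
begin

lemma L2_test:
  assumes "test \<Omega> \<phi>"
  shows "L2 \<Omega> \<phi>"
proof -
  define C where "C = closure {x. \<phi> x \<noteq> 0}"
  have C: "compact C" "C \<subseteq> \<Omega>" using assms by (auto simp: C_def test_def)
  have z: "\<phi> x = 0" if "x \<notin> C" for x using that closure_subset[of "{x. \<phi> x \<noteq> 0}"] by (auto simp: C_def)
  have cont: "continuous_on S \<phi>" for S using assms by (simp add: smooth_continuous test_smooth)
  have "zext \<Omega> \<phi> = \<phi>" using z C by (auto simp: zext_def fun_eq_iff)
  have m: "\<phi> \<in> borel_measurable borel" by (rule borel_measurable_continuous_onI[OF cont])
  have "integrable lborel (\<lambda>x. indicator C x *\<^sub>R (norm (\<phi> x))\<^sup>2)"
    by (intro borel_integrable_compact C continuous_intros cont)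
  also have "(\<lambda>x. indicator C x *\<^sub>R (norm (\<phi> x))\<^sup>2) = (\<lambda>x. (norm (\<phi> x))\<^sup>2)"
    using z by (auto simp: indicator_def fun_eq_iff)
  finally have i: "integrable lborel (\<lambda>x. (norm (\<phi> x))\<^sup>2)" .
  then have "integrable lebesgue (\<lambda>x. (norm (\<phi> x))\<^sup>2)" by (rule integrable_completion[THEN iffD2, rotated]) (use i in auto)
  then show ?thesis
    using m unfolding L2_iff \<open>zext \<Omega> \<phi> = \<phi>\<close> sq_int_def by (auto intro: measurable_completion)
qed

lemma L2_test_scaleR:
  fixes e :: "'b::euclidean_space"
  assumes "test \<Omega> \<phi>"
  shows "L2 \<Omega> (\<lambda>x. \<phi> x *\<^sub>R e)"
proof -
  have "integrable (lebesgue_on \<Omega>) (\<lambda>x. (norm (\<phi> x))\<^sup>2 * (norm e)\<^sup>2)"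
    using L2_test[OF assms] unfolding L2_def by (intro integrable_mult_left) auto
  moreover have "\<phi> \<in> borel_measurable (lebesgue_on \<Omega>)" using L2_test[OF assms] by (simp add: L2_def)
  ultimately show ?thesis
    by (simp add: L2_def power_mult_distrib)
qed

text \<open>The gradient part contributes \<open>eps\<close> contracted with symmetric second
  derivatives and vanishes. The trace part, a multiple of the identity, has a curl that is skew in
  \<open>i\<close> and \<open>j\<close>, and taking the symmetric part removes it.\<close>

lemma d1_d0:
  assumes "is_d0 \<Omega> v G"
  shows "is_d1 \<Omega> G (\<lambda>x. 0)"
proof -
  have G: "L2 \<Omega> G" "AE x in lebesgue_on \<Omega>. tracefree (G x)"
    and eq: "\<And>\<phi> i j. test \<Omega> \<phi> \<Longrightarrow> integral\<^sup>L (lebesgue_on \<Omega>) (\<lambda>x. G x $ i $ j * \<phi> x) =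
          - integral\<^sup>L (lebesgue_on \<Omega>) (\<lambda>x. v x $ j * pd i \<phi> x)
          + (if i = j then 1/3 else 0) *
              integral\<^sup>L (lebesgue_on \<Omega>) (\<lambda>x. \<Sum>k\<in>UNIV. v x $ k * pd k \<phi> x)"
    using assms by (auto simp: is_d0_def)
  have "curl_distr \<Omega> G i j \<phi> + curl_distr \<Omega> G j i \<phi> = 0" if \<phi>: "test \<Omega> \<phi>" for \<phi> i j
  proof -
    define a where "a j k l = integral\<^sup>L (lebesgue_on \<Omega>) (\<lambda>x. v x $ j * pd l (pd k \<phi>) x)" for j k l
    define b where "b k = integral\<^sup>L (lebesgue_on \<Omega>) (\<lambda>x. \<Sum>m\<in>UNIV. v x $ m * pd m (pd k \<phi>) x)" for k
    have a: "a j k l = a j l k" for j k l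
      unfolding a_def by (simp add: pd_commute[OF test_smooth[OF \<phi>], of k l])
    have c: "curl_distr \<Omega> G i j \<phi> = - (\<Sum>k\<in>UNIV. eps i k j * b k) / 3" for i j
    proof -
      have "curl_distr \<Omega> G i j \<phi> = (\<Sum>k\<in>UNIV. \<Sum>l\<in>UNIV. eps i k l * (a j k l - (if l = j then 1/3 else 0) * b k))"
        unfolding curl_distr_def eq[OF test_pd[OF \<phi>]] a_def b_def by (simp add: algebra_simps)
      also have "\<dots> = (\<Sum>k\<in>UNIV. \<Sum>l\<in>UNIV. eps i k l * a j k l)
          - (\<Sum>k\<in>UNIV. \<Sum>l\<in>UNIV. if l = j then eps i k l * b k / 3 else 0)"
        unfolding sum_subtractf[symmetric] by (intro sum.cong refl) (simp add: algebra_simps)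
      also have "(\<Sum>k\<in>UNIV. \<Sum>l\<in>UNIV. eps i k l * a j k l) = 0"
        by (intro sum_skew_sym_eq_0 eps_skew(1) a)
      finally show ?thesis by (simp add: sum_divide_distrib)
    qed
    have "(\<Sum>k\<in>UNIV. eps j k i * b k) = - (\<Sum>k\<in>UNIV. eps i k j * b k)"
      unfolding sum_negf[symmetric] using eps_skew(2) by (intro sum.cong refl) (metis mult_minus_left)
    then show ?thesis by (simp add: c)
  qed
  moreover have "AE x in lebesgue_on \<Omega>. symm (0 :: mat3)" by (simp add: symm_def transpose_def zero_vec_def)
  ultimately show ?thesis using G by (simp add: is_d1_def L2_zero)
qed

text \<open>Second derivatives are symmetric in \<open>i\<close> and \<open>j\<close>, so the double
  divergence of the symmetric part equals that of the curl itself. There \<open>j\<close> and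
  \<open>k\<close> are both derivative indices and both indices of \<open>eps\<close>, so the sum
  over them cancels.\<close>

lemma d2_d1:
  assumes "is_d1 \<Omega> A S"
  shows "is_d2 \<Omega> S (\<lambda>x. 0)"
proof -
  have S: "L2 \<Omega> S" "AE x in lebesgue_on \<Omega>. symm (S x)"
    and eq: "\<And>\<phi> i j. test \<Omega> \<phi> \<Longrightarrow> integral\<^sup>L (lebesgue_on \<Omega>) (\<lambda>x. S x $ i $ j * \<phi> x) =
          (curl_distr \<Omega> A i j \<phi> + curl_distr \<Omega> A j i \<phi>) / 2"
    using assms by (auto simp: is_d1_def)
  have "(\<Sum>i\<in>UNIV. \<Sum>j\<in>UNIV. integral\<^sup>L (lebesgue_on \<Omega>) (\<lambda>x. S x $ j $ i * pd i (pd j \<phi>) x)) = 0"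
    if \<phi>: "test \<Omega> \<phi>" for \<phi>
  proof -
    define c where "c i j = curl_distr \<Omega> A j i (pd i (pd j \<phi>))" for i j
    have sm: "smooth \<phi>" by (rule test_smooth[OF \<phi>])
    have c0: "(\<Sum>j\<in>UNIV. c i j) = 0" for i
    proof -
      define B where "B l j k = - integral\<^sup>L (lebesgue_on \<Omega>) (\<lambda>x. A x $ l $ i * pd k (pd i (pd j \<phi>)) x)" for l j k
      have B: "B l j k = B l k j" for l j k
        unfolding B_def using pd_commute[OF sm] pd_commute[OF smooth_pd[OF sm]] by metis
      have "(\<Sum>j\<in>UNIV. c i j) = (\<Sum>j\<in>UNIV. \<Sum>k\<in>UNIV. \<Sum>l\<in>UNIV. eps j k l * B l j k)"
        by (simp add: c_def curl_distr_def B_def)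
      also have "\<dots> = (\<Sum>j\<in>UNIV. \<Sum>l\<in>UNIV. \<Sum>k\<in>UNIV. eps j k l * B l j k)"
        by (intro sum.cong refl sum.swap)
      also have "\<dots> = (\<Sum>l\<in>UNIV. \<Sum>j\<in>UNIV. \<Sum>k\<in>UNIV. eps j k l * B l j k)" by (rule sum.swap)
      also have "\<dots> = 0"
        by (intro sum.neutral ballI sum_skew_sym_eq_0 eps_skew(3) B)
      finally show ?thesis .
    qed
    have "(\<Sum>i\<in>UNIV. \<Sum>j\<in>UNIV. integral\<^sup>L (lebesgue_on \<Omega>) (\<lambda>x. S x $ j $ i * pd i (pd j \<phi>) x))
        = (\<Sum>i\<in>UNIV. \<Sum>j\<in>UNIV. (c i j + c j i) / 2)"
      unfolding eq[OF test_pd[OF test_pd[OF \<phi>]]] c_def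
      by (intro sum.cong refl) (metis pd_commute[OF sm])
    also have "\<dots> = ((\<Sum>i\<in>UNIV. \<Sum>j\<in>UNIV. c i j) + (\<Sum>i\<in>UNIV. \<Sum>j\<in>UNIV. c j i)) / 2"
      by (simp add: sum.distrib sum_divide_distrib add_divide_distrib)
    also have "(\<Sum>i\<in>UNIV. \<Sum>j\<in>UNIV. c j i) = (\<Sum>i\<in>UNIV. \<Sum>j\<in>UNIV. c i j)" by (rule sum.swap)
    finally show ?thesis by (simp add: c0)
  qed
  then show ?thesis using S by (simp add: is_d2_def L2_zero)
qed

end

section \<open>Test families and the passage from functions to classes\<close>

abbreviation unitm :: "3 \<Rightarrow> 3 \<Rightarrow> mat3" where "unitm i j \<equiv> axis i (axis j 1)"

text \<open>The field that represents the functional \<open>curl_distr\<close>: its inner product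
  with \<open>A\<close> is \<open>curl_distr \<Omega> A i j \<phi>\<close>, see
  \<open>L2inner_curl_field\<close>.\<close>

definition curl_field :: "3 \<Rightarrow> 3 \<Rightarrow> (pt \<Rightarrow> real) \<Rightarrow> pt \<Rightarrow> mat3" where
  "curl_field i j \<phi> x = (\<Sum>k\<in>UNIV. \<Sum>l\<in>UNIV. (- eps i k l * pd k \<phi> x) *\<^sub>R unitm l j)"

text \<open>The second entry is minus the column-wise divergence of the deviator of
  \<open>\<phi> unitm i j\<close>, the formal adjoint of \<open>dev grad\<close>. The first entry is
  in general not trace-free for \<open>i = j\<close>; the constraint is carried by \<open>K1\<close>
  instead.\<close>

definition test0 :: "pt set \<Rightarrow> ((pt \<Rightarrow> mat3) \<times> (pt \<Rightarrow> real^3)) set" where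
  "test0 \<Omega> = {(\<lambda>x. \<phi> x *\<^sub>R unitm i j,
     \<lambda>x. - (pd i \<phi> x *\<^sub>R axis j 1) + (if i = j then 1/3 else 0) *\<^sub>R (\<Sum>k\<in>UNIV. pd k \<phi> x *\<^sub>R axis k 1)) | \<phi> i j. test \<Omega> \<phi>}"

definition test1 :: "pt set \<Rightarrow> ((pt \<Rightarrow> mat3) \<times> (pt \<Rightarrow> mat3)) set" where
  "test1 \<Omega> = {(\<lambda>x. \<phi> x *\<^sub>R unitm i j,
     \<lambda>x. (1/2) *\<^sub>R (curl_field i j \<phi> x + curl_field j i \<phi> x)) | \<phi> i j. test \<Omega> \<phi>}"

definition test2 :: "pt set \<Rightarrow> ((pt \<Rightarrow> real) \<times> (pt \<Rightarrow> mat3)) set" where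
  "test2 \<Omega> = {(\<phi>, \<lambda>x. \<Sum>i\<in>UNIV. \<Sum>j\<in>UNIV. pd i (pd j \<phi>) x *\<^sub>R unitm j i) | \<phi>. test \<Omega> \<phi>}"

lemma subspace_tracefree: "subspace (Collect tracefree)"
  by (auto simp: subspace_def tracefree_def trace_def sum.distrib simp flip: sum_distrib_left)

lemma subspace_symm: "subspace (Collect symm)"
  by (auto simp: subspace_def symm_def transpose_def vec_eq_iff)

context open_domain
begin

lemma weak_graph_emb_iff:
  fixes u :: "pt \<Rightarrow> 'b::euclidean_space" and p :: "pt \<Rightarrow> 'c::euclidean_space"
  assumes "\<And>a b. (a, b) \<in> T \<Longrightarrow> L2 \<Omega> a \<and> L2 \<Omega> b" "L2 \<Omega> u" "L2 \<Omega> p"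
  shows "(emb \<Omega> u, emb \<Omega> p) \<in> weak_graph (Kspace \<Omega> P) (Kspace \<Omega> P') (map_prod (emb \<Omega>) (emb \<Omega>) ` T) \<longleftrightarrow>
    (AE x in lebesgue_on \<Omega>. u x \<in> P) \<and> (AE x in lebesgue_on \<Omega>. p x \<in> P') \<and>
    (\<forall>(a, b)\<in>T. L2inner \<Omega> p a = L2inner \<Omega> u b)"
proof -
  have "inner (emb \<Omega> p) (emb \<Omega> (fst y)) = inner (emb \<Omega> u) (emb \<Omega> (snd y)) \<longleftrightarrow>
      L2inner \<Omega> p (fst y) = L2inner \<Omega> u (snd y)" if "y \<in> T" for y
    using assms(1)[of "fst y" "snd y"] assms(2,3) that by (simp add: inner_emb)
  then show ?thesis
    using assms(2,3) by (simp add: weak_graph_def emb_Kspace_iff case_prod_unfold)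
qed

text \<open>Every pair in \<open>D\<close> has square-integrable representatives by
  \<open>D_sub\<close>, so quantifying over functions \<open>u\<close>, \<open>p\<close> with
  \<open>DF u p\<close> or over elements of \<open>D\<close> amounts to the same.\<close>

lemma adjoint_graph_emb_iff:
  fixes w :: "pt \<Rightarrow> 'c::euclidean_space" and z :: "pt \<Rightarrow> 'b::euclidean_space"
  assumes D: "\<And>u p. DF u p \<longleftrightarrow> L2 \<Omega> u \<and> L2 \<Omega> p \<and> (emb \<Omega> u, emb \<Omega> p) \<in> D"
    and D_sub: "D \<subseteq> Kspace \<Omega> P \<times> Kspace \<Omega> P'" and "L2 \<Omega> w" "L2 \<Omega> z"
  shows "(emb \<Omega> w, emb \<Omega> z) \<in> adjoint_graph (Kspace \<Omega> P) (Kspace \<Omega> P') D \<longleftrightarrow>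
    (AE x in lebesgue_on \<Omega>. w x \<in> P') \<and> (AE x in lebesgue_on \<Omega>. z x \<in> P) \<and>
    (\<forall>u p. DF u p \<longrightarrow> L2inner \<Omega> p w = L2inner \<Omega> u z)"
proof -
  have "(\<forall>(u, p)\<in>D. inner p (emb \<Omega> w) = inner u (emb \<Omega> z)) \<longleftrightarrow>
     (\<forall>u p. DF u p \<longrightarrow> L2inner \<Omega> p w = L2inner \<Omega> u z)"
  proof (intro iffI allI impI ballI)
    fix u p assume a: "\<forall>(u, p)\<in>D. inner p (emb \<Omega> w) = inner u (emb \<Omega> z)" "DF u p"
    then have "inner (emb \<Omega> p) (emb \<Omega> w) = inner (emb \<Omega> u) (emb \<Omega> z)" using D[of u p] by auto
    then show "L2inner \<Omega> p w = L2inner \<Omega> u z" using a(2) D assms(3,4) by (simp add: inner_emb)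
  next
    fix up assume a: "\<forall>u p. DF u p \<longrightarrow> L2inner \<Omega> p w = L2inner \<Omega> u z" "up \<in> D"
    then obtain u p where up: "up = (emb \<Omega> u, emb \<Omega> p)" "L2 \<Omega> u" "L2 \<Omega> p"
      using D_sub by (fastforce simp: Kspace_def)
    then have "L2inner \<Omega> p w = L2inner \<Omega> u z" using a D[of u p] by simp
    then show "case up of (u, p) \<Rightarrow> inner p (emb \<Omega> w) = inner u (emb \<Omega> z)"
      using up assms(3,4) by (simp add: inner_emb)
  qed
  then show ?thesis using assms(3,4) by (simp add: adjoint_graph_def emb_Kspace_iff)
qed

lemma L2_curl_field: "test \<Omega> \<phi> \<Longrightarrow> L2 \<Omega> (curl_field i j \<phi>)"
  unfolding curl_field_def scaleR_scaleR[symmetric]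
  by (intro L2_sum L2_scaleR L2_test_scaleR test_pd) auto

lemma test0_L2: "(a, b) \<in> test0 \<Omega> \<Longrightarrow> L2 \<Omega> a \<and> L2 \<Omega> b"
  unfolding test0_def
  by clarify (intro conjI L2_add L2_minus L2_sum L2_scaleR L2_test_scaleR test_pd finite)

lemma test1_L2: "(a, b) \<in> test1 \<Omega> \<Longrightarrow> L2 \<Omega> a \<and> L2 \<Omega> b"
  unfolding test1_def
  by (auto intro!: L2_add L2_scaleR[of _ "1/2"] L2_test_scaleR L2_curl_field simp del: scaleR_add_right)

lemma test2_L2: "(a, b) \<in> test2 \<Omega> \<Longrightarrow> L2 \<Omega> a \<and> L2 \<Omega> b"
  unfolding test2_def
  by (auto intro!: L2_sum L2_test L2_test_scaleR test_pd)

lemma L2inner_unitm: "L2inner \<Omega> G (\<lambda>x. \<phi> x *\<^sub>R unitm i j) = integral\<^sup>L (lebesgue_on \<Omega>) (\<lambda>x. G x $ i $ j * \<phi> x)"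
  by (simp add: L2inner_def inner_axis mult.commute)

lemma L2inner_add_right: "L2 \<Omega> f \<Longrightarrow> L2 \<Omega> g \<Longrightarrow> L2 \<Omega> h \<Longrightarrow>
    L2inner \<Omega> f (\<lambda>x. g x + h x) = L2inner \<Omega> f g + L2inner \<Omega> f h"
  for f g h :: "pt \<Rightarrow> 'b::euclidean_space"
  by (simp add: inner_emb[symmetric] L2_add emb_add inner_add_right)

lemma L2inner_scaleR_right: "L2inner \<Omega> f (\<lambda>x. c *\<^sub>R g x) = c * L2inner \<Omega> f g"
  by (simp add: L2inner_def)

lemma L2inner_sum_right: "finite I \<Longrightarrow> L2 \<Omega> f \<Longrightarrow> (\<And>i. i \<in> I \<Longrightarrow> L2 \<Omega> (g i)) \<Longrightarrow>
    L2inner \<Omega> f (\<lambda>x. \<Sum>i\<in>I. g i x) = (\<Sum>i\<in>I. L2inner \<Omega> f (g i))"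
  for f :: "pt \<Rightarrow> 'b::euclidean_space"
proof (induction I rule: finite_induct)
  case empty
  show ?case by (simp add: L2inner_def)
next
  case (insert i I)
  then show ?case by (simp add: L2inner_add_right L2_sum)
qed

lemma L2inner_curl_field:
  assumes "L2 \<Omega> A" "test \<Omega> \<phi>"
  shows "L2inner \<Omega> A (curl_field i j \<phi>) = curl_distr \<Omega> A i j \<phi>"
proof -
  have l: "L2 \<Omega> (\<lambda>x. (- eps i k l) *\<^sub>R (pd k \<phi> x *\<^sub>R unitm l j))" for k l
    using assms by (intro L2_scaleR L2_test_scaleR test_pd)
  have "L2inner \<Omega> A (curl_field i j \<phi>) = (\<Sum>k\<in>UNIV. \<Sum>l\<in>UNIV. L2inner \<Omega> A (\<lambda>x. (- eps i k l) *\<^sub>R (pd k \<phi> x *\<^sub>R unitm l j)))"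
    unfolding curl_field_def scaleR_scaleR[symmetric]
    by (simp only: L2inner_sum_right[OF _ assms(1)] l L2_sum finite)
  then show ?thesis
    unfolding curl_distr_def L2inner_scaleR_right L2inner_unitm by simp
qed

section \<open>The complex of operators on the domain\<close>

definition "K0 = Kspace \<Omega> (UNIV :: (real^3) set)"
definition "K1 = Kspace \<Omega> (Collect tracefree)"
definition "K2 = Kspace \<Omega> (Collect symm)"
definition "K3 = Kspace \<Omega> (UNIV :: real set)"
definition "T0 = map_prod (emb \<Omega>) (emb \<Omega>) ` test0 \<Omega>"
definition "T1 = map_prod (emb \<Omega>) (emb \<Omega>) ` test1 \<Omega>"
definition "T2 = map_prod (emb \<Omega>) (emb \<Omega>) ` test2 \<Omega>"
definition "D0 = weak_graph K0 K1 T0"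
definition "D1 = weak_graph K1 K2 T1"
definition "D2 = weak_graph K2 K3 T2"
definition "D0s = adjoint_graph K0 K1 D0"
definition "D1s = adjoint_graph K1 K2 D1"
definition "D2s = adjoint_graph K2 K3 D2"

text \<open>Testing with the pairs of \<open>test0\<close> reproduces the distributional identity
  entry by entry. If one of the fields is not in \<open>L2\<close>, both sides are false.\<close>

lemma is_d0_iff: "is_d0 \<Omega> v G \<longleftrightarrow> L2 \<Omega> v \<and> L2 \<Omega> G \<and> (emb \<Omega> v, emb \<Omega> G) \<in> D0"
proof (cases "L2 \<Omega> v \<and> L2 \<Omega> G")
  case True
  have b: "L2inner \<Omega> v (\<lambda>x. - (pd i \<phi> x *\<^sub>R axis j 1) + (if i = j then 1/3 else 0) *\<^sub>R (\<Sum>k\<in>UNIV. pd k \<phi> x *\<^sub>R axis k 1))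
     = - integral\<^sup>L (lebesgue_on \<Omega>) (\<lambda>x. v x $ j * pd i \<phi> x)
          + (if i = j then 1/3 else 0) *
              integral\<^sup>L (lebesgue_on \<Omega>) (\<lambda>x. \<Sum>k\<in>UNIV. v x $ k * pd k \<phi> x)" if \<phi>: "test \<Omega> \<phi>" for \<phi> i j
  proof -
    have 1: "inner (v x) (\<Sum>k\<in>UNIV. pd k \<phi> x *\<^sub>R axis k 1) = (\<Sum>k\<in>UNIV. v x $ k * pd k \<phi> x)" for x
      by (simp add: inner_sum_right inner_axis mult.commute)
    have 2: "inner (v x) (pd i \<phi> x *\<^sub>R axis j 1) = v x $ j * pd i \<phi> x" for x
      by (simp add: inner_axis mult.commute)
    have "L2inner \<Omega> v (\<lambda>x. - (pd i \<phi> x *\<^sub>R axis j 1) + (if i = j then 1/3 else 0) *\<^sub>R (\<Sum>k\<in>UNIV. pd k \<phi> x *\<^sub>R axis k 1))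
      = L2inner \<Omega> v (\<lambda>x. (-1) *\<^sub>R (pd i \<phi> x *\<^sub>R axis j 1)) + L2inner \<Omega> v (\<lambda>x. (if i = j then 1/3 else 0) *\<^sub>R (\<Sum>k\<in>UNIV. pd k \<phi> x *\<^sub>R axis k 1))"
      using True \<phi> by (subst L2inner_add_right[symmetric]) (auto intro!: L2_zero L2_minus L2_scaleR L2_sum L2_test_scaleR test_pd)
    then show ?thesis unfolding L2inner_scaleR_right by (simp only: L2inner_def 1 2)
  qed
  have "(\<forall>(a, b)\<in>test0 \<Omega>. L2inner \<Omega> G a = L2inner \<Omega> v b) \<longleftrightarrow>
    (\<forall>\<phi>. test \<Omega> \<phi> \<longrightarrow> (\<forall>i j. L2inner \<Omega> G (\<lambda>x. \<phi> x *\<^sub>R unitm i j) = L2inner \<Omega> v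
      (\<lambda>x. - (pd i \<phi> x *\<^sub>R axis j 1) + (if i = j then 1/3 else 0) *\<^sub>R (\<Sum>k\<in>UNIV. pd k \<phi> x *\<^sub>R axis k 1))))"
    unfolding test0_def by blast
  also have "\<dots> \<longleftrightarrow> (\<forall>\<phi>. test \<Omega> \<phi> \<longrightarrow> (\<forall>i j.
        integral\<^sup>L (lebesgue_on \<Omega>) (\<lambda>x. G x $ i $ j * \<phi> x) =
          - integral\<^sup>L (lebesgue_on \<Omega>) (\<lambda>x. v x $ j * pd i \<phi> x)
          + (if i = j then 1/3 else 0) *
              integral\<^sup>L (lebesgue_on \<Omega>) (\<lambda>x. \<Sum>k\<in>UNIV. v x $ k * pd k \<phi> x)))"
    by (simp only: b L2inner_unitm cong: imp_cong)
  finally show ?thesis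
    using True weak_graph_emb_iff[OF test0_L2, of _ v G UNIV "Collect tracefree"]
    unfolding is_d0_def D0_def K0_def K1_def T0_def by simp
qed (auto simp: is_d0_def)

lemma is_d1_iff: "is_d1 \<Omega> A S \<longleftrightarrow> L2 \<Omega> A \<and> L2 \<Omega> S \<and> (emb \<Omega> A, emb \<Omega> S) \<in> D1"
proof (cases "L2 \<Omega> A \<and> L2 \<Omega> S")
  case True
  have b: "L2inner \<Omega> A (\<lambda>x. (1/2) *\<^sub>R (curl_field i j \<phi> x + curl_field j i \<phi> x))
     = (curl_distr \<Omega> A i j \<phi> + curl_distr \<Omega> A j i \<phi>) / 2" if \<phi>: "test \<Omega> \<phi>" for \<phi> i j
    unfolding L2inner_scaleR_right using True \<phi>
    by (simp add: L2inner_add_right L2_curl_field L2inner_curl_field)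
  have "(\<forall>(a, b)\<in>test1 \<Omega>. L2inner \<Omega> S a = L2inner \<Omega> A b) \<longleftrightarrow>
    (\<forall>\<phi>. test \<Omega> \<phi> \<longrightarrow> (\<forall>i j.
        integral\<^sup>L (lebesgue_on \<Omega>) (\<lambda>x. S x $ i $ j * \<phi> x) =
          (curl_distr \<Omega> A i j \<phi> + curl_distr \<Omega> A j i \<phi>) / 2))"
    unfolding L2inner_unitm[symmetric] test1_def by (fastforce simp: b)
  then show ?thesis
    using True weak_graph_emb_iff[OF test1_L2, of _ A S "Collect tracefree" "Collect symm"]
    unfolding is_d1_def D1_def K2_def K1_def T1_def by simp
qed (auto simp: is_d1_def)

lemma is_d2_iff: "is_d2 \<Omega> \<sigma> r \<longleftrightarrow> L2 \<Omega> \<sigma> \<and> L2 \<Omega> r \<and> (emb \<Omega> \<sigma>, emb \<Omega> r) \<in> D2"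
proof (cases "L2 \<Omega> \<sigma> \<and> L2 \<Omega> r")
  case True
  have b: "L2inner \<Omega> \<sigma> (\<lambda>x. \<Sum>i\<in>UNIV. \<Sum>j\<in>UNIV. pd i (pd j \<phi>) x *\<^sub>R unitm j i)
     = (\<Sum>i\<in>UNIV. \<Sum>j\<in>UNIV. integral\<^sup>L (lebesgue_on \<Omega>) (\<lambda>x. \<sigma> x $ j $ i * pd i (pd j \<phi>) x))"
    if \<phi>: "test \<Omega> \<phi>" for \<phi>
    using True \<phi> by (simp add: L2inner_sum_right L2_sum L2_test_scaleR test_pd L2inner_unitm)
  have "(\<forall>(a, b)\<in>test2 \<Omega>. L2inner \<Omega> r a = L2inner \<Omega> \<sigma> b) \<longleftrightarrow>
    (\<forall>\<phi>. test \<Omega> \<phi> \<longrightarrow>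
        integral\<^sup>L (lebesgue_on \<Omega>) (\<lambda>x. r x * \<phi> x) =
          (\<Sum>i\<in>UNIV. \<Sum>j\<in>UNIV. integral\<^sup>L (lebesgue_on \<Omega>) (\<lambda>x. \<sigma> x $ j $ i * pd i (pd j \<phi>) x)))"
    unfolding test2_def by (fastforce simp: b L2inner_def[of _ r])
  then show ?thesis
    using True weak_graph_emb_iff[OF test2_L2, of _ \<sigma> r "Collect symm" UNIV]
    unfolding is_d2_def D2_def K2_def K3_def T2_def by simp
qed (auto simp: is_d2_def)

lemma is_d0adj_iff: "is_d0adj \<Omega> w z \<longleftrightarrow> L2 \<Omega> w \<and> L2 \<Omega> z \<and> (emb \<Omega> w, emb \<Omega> z) \<in> D0s"
proof -
  have "D0 \<subseteq> Kspace \<Omega> UNIV \<times> Kspace \<Omega> (Collect tracefree)"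
    by (auto simp: D0_def weak_graph_def K0_def K1_def)
  from adjoint_graph_emb_iff[OF is_d0_iff this, of w z] show ?thesis
    unfolding is_d0adj_def D0s_def K0_def K1_def by auto
qed

lemma is_d1adj_iff: "is_d1adj \<Omega> w z \<longleftrightarrow> L2 \<Omega> w \<and> L2 \<Omega> z \<and> (emb \<Omega> w, emb \<Omega> z) \<in> D1s"
proof -
  have "D1 \<subseteq> Kspace \<Omega> (Collect tracefree) \<times> Kspace \<Omega> (Collect symm)"
    by (auto simp: D1_def weak_graph_def K1_def K2_def)
  from adjoint_graph_emb_iff[OF is_d1_iff this, of w z] show ?thesis
    unfolding is_d1adj_def D1s_def K1_def K2_def by auto
qed

lemma is_d2adj_iff: "is_d2adj \<Omega> w z \<longleftrightarrow> L2 \<Omega> w \<and> L2 \<Omega> z \<and> (emb \<Omega> w, emb \<Omega> z) \<in> D2s"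
proof -
  have "D2 \<subseteq> Kspace \<Omega> (Collect symm) \<times> Kspace \<Omega> UNIV"
    by (auto simp: D2_def weak_graph_def K2_def K3_def)
  from adjoint_graph_emb_iff[OF is_d2_iff this, of w z] show ?thesis
    unfolding is_d2adj_def D2s_def K2_def K3_def by auto
qed

lemma Kspace_cases:
  assumes "x \<in> Kspace \<Omega> P"
  obtains f where "L2 \<Omega> f" "x = emb \<Omega> f"
  using assms by (auto simp: Kspace_def)

sublocale hc: hilbert_complex K0 K1 K2 K3 T0 T1 T2 D0 D1 D2 D0s D1s D2s
proof (rule hilbert_complex.intro)
  show "closed K0" "closed K1" "closed K2" "closed K3"
    unfolding K0_def K1_def K2_def K3_def
    by (intro closed_Kspace subspace_UNIV subspace_tracefree subspace_symm)+
  show "subspace K0" "subspace K1" "subspace K2" "subspace K3"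
    unfolding K0_def K1_def K2_def K3_def
    by (intro subspace_Kspace subspace_UNIV subspace_tracefree subspace_symm)+
  show "(y, 0) \<in> D1" if xy: "(x, y) \<in> D0" for x y
  proof -
    have "x \<in> K0" "y \<in> K1" using xy by (auto simp: D0_def weak_graph_def)
    then obtain v G where "L2 \<Omega> v" "x = emb \<Omega> v" "L2 \<Omega> G" "y = emb \<Omega> G"
      unfolding K0_def K1_def by (metis Kspace_cases)
    then show ?thesis using xy d1_d0[of v G] is_d0_iff is_d1_iff emb_zero by metis
  qed
  show "(y, 0) \<in> D2" if xy: "(x, y) \<in> D1" for x y
  proof -
    have "x \<in> K1" "y \<in> K2" using xy by (auto simp: D1_def weak_graph_def)
    then obtain A S where "L2 \<Omega> A" "x = emb \<Omega> A" "L2 \<Omega> S" "y = emb \<Omega> S"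
      unfolding K1_def K2_def by (metis Kspace_cases)
    then show ?thesis using xy d2_d1[of A S] is_d1_iff is_d2_iff emb_zero by metis
  qed
qed (simp_all add: D0_def D1_def D2_def D0s_def D1s_def D2s_def)

end

section \<open>The Cauchy problem\<close>

context open_domain
begin

lemma L2_Pair_iff:
  fixes f :: "pt \<Rightarrow> 'b::euclidean_space" and g :: "pt \<Rightarrow> 'c::euclidean_space"
  shows "L2 \<Omega> (\<lambda>x. (f x, g x)) \<longleftrightarrow> L2 \<Omega> f \<and> L2 \<Omega> g"
proof
  assume L: "L2 \<Omega> (\<lambda>x. (f x, g x))"
  then have m: "(\<lambda>x. (f x, g x)) \<in> borel_measurable (lebesgue_on \<Omega>)"
    and i: "integrable (lebesgue_on \<Omega>) (\<lambda>x. (norm (f x, g x))\<^sup>2)"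
    by (auto simp: L2_def)
  have "(fst :: 'b \<times> 'c \<Rightarrow> 'b) \<in> borel_measurable borel" "(snd :: 'b \<times> 'c \<Rightarrow> 'c) \<in> borel_measurable borel"
    by (intro borel_measurable_continuous_onI continuous_intros)+
  from measurable_compose[OF m this(1)] measurable_compose[OF m this(2)]
  have fg[measurable]: "f \<in> borel_measurable (lebesgue_on \<Omega>)" "g \<in> borel_measurable (lebesgue_on \<Omega>)"
    by simp_all
  have "integrable (lebesgue_on \<Omega>) (\<lambda>x. (norm (f x))\<^sup>2)" "integrable (lebesgue_on \<Omega>) (\<lambda>x. (norm (g x))\<^sup>2)"
    by (rule Bochner_Integration.integrable_bound[OF i]; simp add: norm_Pair)+
  with fg show "L2 \<Omega> f \<and> L2 \<Omega> g" by (simp add: L2_def)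
next
  assume "L2 \<Omega> f \<and> L2 \<Omega> g"
  then show "L2 \<Omega> (\<lambda>x. (f x, g x))"
    by (auto simp: L2_def norm_Pair intro!: borel_measurable_Pair)
qed

lemma L2norm_Pair:
  fixes f :: "pt \<Rightarrow> 'b::euclidean_space" and g :: "pt \<Rightarrow> 'c::euclidean_space"
  assumes "L2 \<Omega> f" "L2 \<Omega> g"
  shows "L2norm \<Omega> (\<lambda>x. (f x, g x)) = sqrt ((L2norm \<Omega> f)\<^sup>2 + (L2norm \<Omega> g)\<^sup>2)"
  using assms by (simp add: L2norm_def L2_def norm_Pair)

text \<open>Modulo null sets this maps the states isometrically onto \<open>hc.K\<close>
  (\<open>norm_toX\<close>, \<open>toX_surj\<close>). The target is a product of four spaces of
  classes, not classes of quadruples, because the abstract complex lives on a product.\<close>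

definition toX :: "(pt \<Rightarrow> xval) \<Rightarrow> (pt, real^3) lsq \<times> (pt, mat3) lsq \<times> (pt, mat3) lsq \<times> (pt, real) lsq" where
  "toX U = (emb \<Omega> (lam0 U), emb \<Omega> (compA U), emb \<Omega> (compg U), emb \<Omega> (lam3 U))"

lemmas comp_defs = lam0_def compA_def compg_def lam3_def

lemma X_eta: "U = (\<lambda>x. (lam0 U x, compA U x, compg U x, lam3 U x))"
  by (simp add: comp_defs)

lemma L2_X_iff: "L2 \<Omega> U \<longleftrightarrow> L2 \<Omega> (lam0 U) \<and> L2 \<Omega> (compA U) \<and> L2 \<Omega> (compg U) \<and> L2 \<Omega> (lam3 U)"
  by (subst X_eta) (simp only: L2_Pair_iff)

lemma norm_toX: assumes "L2 \<Omega> U" shows "norm (toX U) = L2norm \<Omega> U"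
proof -
  have "L2norm \<Omega> U = L2norm \<Omega> (\<lambda>x. (lam0 U x, compA U x, compg U x, lam3 U x))"
    using X_eta[of U] by simp
  then show ?thesis
    using assms by (simp add: L2_X_iff L2_Pair_iff L2norm_Pair toX_def norm_Pair norm_emb)
qed

lemma toX_diff: "L2 \<Omega> U \<Longrightarrow> L2 \<Omega> V \<Longrightarrow> toX (\<lambda>x. U x - V x) = toX U - toX V"
proof -
  have "lam0 (\<lambda>x. U x - V x) = (\<lambda>x. lam0 U x - lam0 V x)" "compA (\<lambda>x. U x - V x) = (\<lambda>x. compA U x - compA V x)"
    "compg (\<lambda>x. U x - V x) = (\<lambda>x. compg U x - compg V x)" "lam3 (\<lambda>x. U x - V x) = (\<lambda>x. lam3 U x - lam3 V x)"
    by (auto simp: comp_defs)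
  then show "L2 \<Omega> U \<Longrightarrow> L2 \<Omega> V \<Longrightarrow> toX (\<lambda>x. U x - V x) = toX U - toX V"
    by (simp add: toX_def L2_X_iff emb_diff)
qed

lemma toX_scaleR: "L2 \<Omega> U \<Longrightarrow> toX (\<lambda>x. c *\<^sub>R U x) = c *\<^sub>R toX U"
proof -
  have "lam0 (\<lambda>x. c *\<^sub>R U x) = (\<lambda>x. c *\<^sub>R lam0 U x)" "compA (\<lambda>x. c *\<^sub>R U x) = (\<lambda>x. c *\<^sub>R compA U x)"
    "compg (\<lambda>x. c *\<^sub>R U x) = (\<lambda>x. c *\<^sub>R compg U x)" "lam3 (\<lambda>x. c *\<^sub>R U x) = (\<lambda>x. c *\<^sub>R lam3 U x)"
    by (auto simp: comp_defs)
  then show "L2 \<Omega> U \<Longrightarrow> toX (\<lambda>x. c *\<^sub>R U x) = c *\<^sub>R toX U"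
    using emb_scaleR[of "lam3 U" c] by (simp add: toX_def L2_X_iff emb_scaleR)
qed

lemma toX_eq_iff:
  assumes "L2 \<Omega> U" "L2 \<Omega> V"
  shows "toX U = toX V \<longleftrightarrow> (AE x in lebesgue_on \<Omega>. U x = V x)"
proof -
  have "toX U = toX V \<longleftrightarrow> (AE x in lebesgue_on \<Omega>. lam0 U x = lam0 V x) \<and> (AE x in lebesgue_on \<Omega>. compA U x = compA V x)
     \<and> (AE x in lebesgue_on \<Omega>. compg U x = compg V x) \<and> (AE x in lebesgue_on \<Omega>. lam3 U x = lam3 V x)"
    using assms by (simp add: toX_def L2_X_iff emb_eq_iff)
  also have "\<dots> \<longleftrightarrow> (AE x in lebesgue_on \<Omega>. lam0 U x = lam0 V x \<and> compA U x = compA V x \<and> compg U x = compg V x \<and> lam3 U x = lam3 V x)"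
    by (simp only: AE_conj_iff)
  also have "\<dots> \<longleftrightarrow> (AE x in lebesgue_on \<Omega>. U x = V x)"
    by (simp add: comp_defs prod_eq_iff)
  finally show ?thesis .
qed

lemma inX_iff: "inX \<Omega> U \<longleftrightarrow> L2 \<Omega> U \<and> toX U \<in> hc.K"
  unfolding inX_def toX_def hc.K_def unfolding K0_def K1_def K2_def K3_def
  by (auto simp: L2_X_iff emb_Kspace_iff)

lemma toX_surj:
  assumes "u \<in> hc.K"
  shows "\<exists>U. inX \<Omega> U \<and> toX U = u"
proof -
  obtain u0 u1 u2 u3 where u: "u = (u0, u1, u2, u3)" "u0 \<in> K0" "u1 \<in> K1" "u2 \<in> K2" "u3 \<in> K3"
    using assms by (auto simp: hc.K_def)
  obtain f0 f1 f2 f3 where f: "L2 \<Omega> f0" "u0 = emb \<Omega> f0" "L2 \<Omega> f1" "u1 = emb \<Omega> f1"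
    "L2 \<Omega> f2" "u2 = emb \<Omega> f2" "L2 \<Omega> f3" "u3 = emb \<Omega> f3"
    using u(2-) unfolding K0_def K1_def K2_def K3_def by (metis Kspace_cases)
  define U where "U = (\<lambda>x. (f0 x, f1 x, f2 x, f3 x))"
  have "lam0 U = f0" "compA U = f1" "compg U = f2" "lam3 U = f3" by (auto simp: U_def comp_defs)
  then have "L2 \<Omega> U" "toX U = u" using f u by (auto simp: L2_X_iff toX_def)
  then show ?thesis using assms inX_iff by blast
qed

text \<open>Forward, the quadruple of values is embedded componentwise. Backward, the values of the
  abstract operators have to be realised by functions, and \<open>toX_eq_iff\<close> absorbs the
  null set on which \<open>V\<close> may differ from them.\<close>

lemma isL_iff: "isL \<Omega> U V \<longleftrightarrow> L2 \<Omega> U \<and> L2 \<Omega> V \<and> (toX U, toX V) \<in> hc.L"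
proof
  assume "isL \<Omega> U V"
  then obtain G S r z0 z1 z2 where U: "inX \<Omega> U"
    and d: "is_d0 \<Omega> (lam0 U) G" "is_d1 \<Omega> (compA U) S" "is_d2 \<Omega> (compg U) r"
      "is_d0adj \<Omega> (compA U) z0" "is_d1adj \<Omega> (compg U) z1" "is_d2adj \<Omega> (lam3 U) z2"
    and V: "AE x in lebesgue_on \<Omega>. V x = (z0 x, - G x - z1 x, S x + z2 x, - r x)"
    unfolding isL_def by blast
  define W where "W = (\<lambda>x. (z0 x, - G x - z1 x, S x + z2 x, - r x))"
  have l: "L2 \<Omega> G" "L2 \<Omega> S" "L2 \<Omega> r" "L2 \<Omega> z0" "L2 \<Omega> z1" "L2 \<Omega> z2"
    using d by (auto simp: is_d0_iff is_d1_iff is_d2_iff is_d0adj_iff is_d1adj_iff is_d2adj_iff)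
  have W: "lam0 W = z0" "compA W = (\<lambda>x. - G x - z1 x)" "compg W = (\<lambda>x. S x + z2 x)" "lam3 W = (\<lambda>x. - r x)"
    by (auto simp: W_def comp_defs)
  have LW: "L2 \<Omega> W" unfolding L2_X_iff W by (intro conjI l L2_diff L2_minus L2_add)
  have "AE x in lebesgue_on \<Omega>. W x = V x" using V by (auto simp: W_def elim: AE_mp)
  then have LV: "L2 \<Omega> V" and "toX W = toX V"
    using L2_cong_AE[OF LW] toX_eq_iff[OF LW] by auto
  moreover have "toX W = (emb \<Omega> z0, - emb \<Omega> G - emb \<Omega> z1, emb \<Omega> S + emb \<Omega> z2, - emb \<Omega> r)"
    unfolding toX_def W using l by (simp add: emb_diff emb_add emb_minus L2_minus)
  moreover have "(toX U, (emb \<Omega> z0, - emb \<Omega> G - emb \<Omega> z1, emb \<Omega> S + emb \<Omega> z2, - emb \<Omega> r)) \<in> hc.L"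
    using d unfolding hc.L_def toX_def is_d0_iff is_d1_iff is_d2_iff is_d0adj_iff is_d1adj_iff is_d2adj_iff
    by blast
  ultimately show "L2 \<Omega> U \<and> L2 \<Omega> V \<and> (toX U, toX V) \<in> hc.L" using U by (simp add: inX_iff)
next
  assume *: "L2 \<Omega> U \<and> L2 \<Omega> V \<and> (toX U, toX V) \<in> hc.L"
  then obtain G' S' r' z0' z1' z2' where e: "toX V = (z0', - G' - z1', S' + z2', - r')"
    and d': "(emb \<Omega> (lam0 U), G') \<in> D0" "(emb \<Omega> (compA U), S') \<in> D1" "(emb \<Omega> (compg U), r') \<in> D2"
     "(emb \<Omega> (compA U), z0') \<in> D0s" "(emb \<Omega> (compg U), z1') \<in> D1s" "(emb \<Omega> (lam3 U), z2') \<in> D2s"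
    unfolding hc.L_def toX_def by blast
  have "G' \<in> K1" "S' \<in> K2" "r' \<in> K3" "z0' \<in> K0" "z1' \<in> K1" "z2' \<in> K2"
    using hc.D_K d'(1-3) hc.Ds_K d'(4-6) by blast+
  then obtain G S r z0 z1 z2 where f: "L2 \<Omega> G" "G' = emb \<Omega> G" "L2 \<Omega> S" "S' = emb \<Omega> S" "L2 \<Omega> r" "r' = emb \<Omega> r"
    "L2 \<Omega> z0" "z0' = emb \<Omega> z0" "L2 \<Omega> z1" "z1' = emb \<Omega> z1" "L2 \<Omega> z2" "z2' = emb \<Omega> z2"
    unfolding K0_def K1_def K2_def K3_def by (metis Kspace_cases)
  define W where "W = (\<lambda>x. (z0 x, - G x - z1 x, S x + z2 x, - r x))"
  have W: "lam0 W = z0" "compA W = (\<lambda>x. - G x - z1 x)" "compg W = (\<lambda>x. S x + z2 x)" "lam3 W = (\<lambda>x. - r x)"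
    by (auto simp: W_def comp_defs)
  have LW: "L2 \<Omega> W" unfolding L2_X_iff W by (intro conjI f L2_diff L2_minus L2_add)
  have "toX W = toX V"
    unfolding e toX_def[of W] W using f by (simp add: emb_diff emb_add emb_minus L2_minus)
  then have "AE x in lebesgue_on \<Omega>. V x = W x" using toX_eq_iff[of V W] LW * by simp
  moreover have "inX \<Omega> U" using * hc.L_K by (auto simp: inX_iff)
  moreover have "is_d0 \<Omega> (lam0 U) G" "is_d1 \<Omega> (compA U) S" "is_d2 \<Omega> (compg U) r"
      "is_d0adj \<Omega> (compA U) z0" "is_d1adj \<Omega> (compg U) z1" "is_d2adj \<Omega> (lam3 U) z2"
    using d' f * by (simp_all add: is_d0_iff is_d1_iff is_d2_iff is_d0adj_iff is_d1adj_iff is_d2adj_iff L2_X_iff)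
  ultimately show "isL \<Omega> U V" unfolding isL_def W_def by blast
qed

section \<open>Regularity in time, read on classes\<close>

lemma L2cont_iff:
  assumes "\<And>t. t \<in> {0..T} \<Longrightarrow> L2 \<Omega> (F t)"
  shows "L2cont \<Omega> T F \<longleftrightarrow> continuous_on {0..T} (\<lambda>t. toX (F t))"
proof -
  have "((\<lambda>s. L2norm \<Omega> (\<lambda>x. F s x - F t x)) \<longlongrightarrow> 0) (at t within {0..T}) \<longleftrightarrow>
      ((\<lambda>s. toX (F s)) \<longlongrightarrow> toX (F t)) (at t within {0..T})" if t: "t \<in> {0..T}" for t
  proof -
    have "L2norm \<Omega> (\<lambda>x. F s x - F t x) = dist (toX (F s)) (toX (F t))" if "s \<in> {0..T}" for s
      using assms[OF that] assms[OF t] by (simp add: dist_norm toX_diff L2_diff flip: norm_toX)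
    then have "((\<lambda>s. L2norm \<Omega> (\<lambda>x. F s x - F t x)) \<longlongrightarrow> 0) (at t within {0..T}) \<longleftrightarrow>
      ((\<lambda>s. dist (toX (F s)) (toX (F t))) \<longlongrightarrow> 0) (at t within {0..T})"
      by (intro Lim_cong_within) auto
    then show ?thesis using tendsto_dist_iff[of "\<lambda>s. toX (F s)" "toX (F t)"] by simp
  qed
  then show ?thesis by (simp add: L2cont_def continuous_on_def)
qed

lemma L2deriv_iff:
  assumes "\<And>t. t \<in> {0..T} \<Longrightarrow> L2 \<Omega> (F t)" "\<And>t. t \<in> {0..T} \<Longrightarrow> L2 \<Omega> (F' t)"
  shows "L2deriv \<Omega> T F F' \<longleftrightarrow>
    (\<forall>t\<in>{0..T}. ((\<lambda>t. toX (F t)) has_vector_derivative toX (F' t)) (at t within {0..T}))"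
proof -
  have "((\<lambda>s. L2norm \<Omega> (\<lambda>x. (1 / (s - t)) *\<^sub>R (F s x - F t x) - F' t x)) \<longlongrightarrow> 0) (at t within {0..T}) \<longleftrightarrow>
     ((\<lambda>t. toX (F t)) has_vector_derivative toX (F' t)) (at t within {0..T})" if t: "t \<in> {0..T}" for t
  proof -
    \<comment> \<open>The comparison is made only for \<open>s \<noteq> t\<close>, so the value of
      \<open>1 / (s - t)\<close> at \<open>s = t\<close> never enters the limit.\<close>
    have "L2norm \<Omega> (\<lambda>x. (1 / (s - t)) *\<^sub>R (F s x - F t x) - F' t x)
      = norm ((toX (F s) - toX (F t)) - (s - t) *\<^sub>R toX (F' t)) / norm (s - t)"
      if s: "s \<in> {0..T}" "s \<noteq> t" for s
    proof -
      note l = assms(1)[OF s(1)] assms(1)[OF t] assms(2)[OF t]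
      have "L2norm \<Omega> (\<lambda>x. (1 / (s - t)) *\<^sub>R (F s x - F t x) - F' t x)
         = norm ((1 / (s - t)) *\<^sub>R (toX (F s) - toX (F t)) - toX (F' t))"
        using l by (simp add: norm_toX[symmetric] toX_diff toX_scaleR L2_diff L2_scaleR)
      also have "(1 / (s - t)) *\<^sub>R (toX (F s) - toX (F t)) - toX (F' t)
         = (1 / (s - t)) *\<^sub>R ((toX (F s) - toX (F t)) - (s - t) *\<^sub>R toX (F' t))"
        using s(2) by (simp add: scaleR_diff_right)
      finally show ?thesis by (simp add: divide_inverse mult.commute)
    qed
    then have "((\<lambda>s. L2norm \<Omega> (\<lambda>x. (1 / (s - t)) *\<^sub>R (F s x - F t x) - F' t x)) \<longlongrightarrow> 0) (at t within {0..T}) \<longleftrightarrow>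
      ((\<lambda>s. norm ((toX (F s) - toX (F t)) - (s - t) *\<^sub>R toX (F' t)) / norm (s - t)) \<longlongrightarrow> 0) (at t within {0..T})"
      by (intro Lim_cong_within) auto
    then show ?thesis
      unfolding has_vector_derivative_def has_derivative_iff_norm
      by (simp add: bounded_linear_scaleR_left)
  qed
  then show ?thesis by (simp add: L2deriv_def)
qed

lemma is_solutionI:
  assumes L: "\<And>t. t \<in> {0..T} \<Longrightarrow> isL \<Omega> (U t) (U' t)"
    and deriv: "\<And>t. t \<in> {0..T} \<Longrightarrow> ((\<lambda>t. toX (U t)) has_vector_derivative toX (U' t)) (at t within {0..T})"
    and cont: "continuous_on {0..T} (\<lambda>t. toX (U' t))"
    and init: "AE x in lebesgue_on \<Omega>. U 0 x = U0 x"
  shows "is_solution \<Omega> T U0 U"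
proof -
  have l: "L2 \<Omega> (U t)" "L2 \<Omega> (U' t)" "inX \<Omega> (U t)" "inX \<Omega> (U' t)" if "t \<in> {0..T}" for t
    using L[OF that] hc.L_K by (auto simp: isL_iff inX_iff)
  have "continuous_on {0..T} (\<lambda>t. toX (U t))"
    using deriv by (meson continuous_on_eq_continuous_within has_vector_derivative_continuous)
  then have c: "L2cont \<Omega> T U" "L2cont \<Omega> T U'" using l cont L2cont_iff by blast+
  have d: "L2deriv \<Omega> T U U'" using l deriv L2deriv_iff by blast
  show ?thesis
    unfolding is_solution_def C0_DL_def C1_X_def using l c d L init by blast
qed

lemma is_solutionD:
  assumes "is_solution \<Omega> T U0 U"
  obtains u' where "\<And>t. t \<in> {0..T} \<Longrightarrow> L2 \<Omega> (U t)" "\<And>t. t \<in> {0..T} \<Longrightarrow> (toX (U t), u' t) \<in> hc.L"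
    "\<And>t. t \<in> {0..T} \<Longrightarrow> ((\<lambda>t. toX (U t)) has_vector_derivative u' t) (at t within {0..T})"
    "AE x in lebesgue_on \<Omega>. U 0 x = U0 x"
proof -
  obtain U' where U': "L2deriv \<Omega> T U U'" "\<And>t. t \<in> {0..T} \<Longrightarrow> isL \<Omega> (U t) (U' t)"
    and "AE x in lebesgue_on \<Omega>. U 0 x = U0 x"
    using assms by (auto simp: is_solution_def)
  moreover have "\<forall>t\<in>{0..T}. ((\<lambda>t. toX (U t)) has_vector_derivative toX (U' t)) (at t within {0..T})"
    using U' by (subst L2deriv_iff[symmetric]) (auto simp: isL_iff)
  ultimately show ?thesis using that[of "\<lambda>t. toX (U' t)"] by (auto simp: isL_iff)
qed

lemma solution_unique:
  assumes "is_solution \<Omega> T U0 U" "is_solution \<Omega> T U0 V" "t \<in> {0..T}"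
  shows "AE x in lebesgue_on \<Omega>. V t x = U t x"
proof -
  obtain u' where u: "\<And>t. t \<in> {0..T} \<Longrightarrow> L2 \<Omega> (U t)" "\<And>t. t \<in> {0..T} \<Longrightarrow> (toX (U t), u' t) \<in> hc.L"
    "\<And>t. t \<in> {0..T} \<Longrightarrow> ((\<lambda>t. toX (U t)) has_vector_derivative u' t) (at t within {0..T})"
    "AE x in lebesgue_on \<Omega>. U 0 x = U0 x" using is_solutionD[OF assms(1)] by blast
  obtain v' where v: "\<And>t. t \<in> {0..T} \<Longrightarrow> L2 \<Omega> (V t)" "\<And>t. t \<in> {0..T} \<Longrightarrow> (toX (V t), v' t) \<in> hc.L"
    "\<And>t. t \<in> {0..T} \<Longrightarrow> ((\<lambda>t. toX (V t)) has_vector_derivative v' t) (at t within {0..T})"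
    "AE x in lebesgue_on \<Omega>. V 0 x = U0 x" using is_solutionD[OF assms(2)] by blast
  have "AE x in lebesgue_on \<Omega>. V 0 x = U 0 x" using u(4) v(4) by eventually_elim simp
  moreover have "0 \<in> {0..T}" using assms(3) by auto
  ultimately have "toX (V 0) = toX (U 0)" using toX_eq_iff u(1) v(1) by blast
  from skew_evolution_unique[OF hc.subspace_L hc.L_skew v(2,3) u(2,3) this assms(3)]
  have "toX (V t) = toX (U t)" by blast
  then show ?thesis using toX_eq_iff u(1) v(1) assms(3) by blast
qed

lemma domain_dense: "DL_dense \<Omega> \<Longrightarrow> hc.K \<subseteq> closure (fst ` hc.L)"
proof
  fix u assume D: "DL_dense \<Omega>" and "u \<in> hc.K"
  then obtain U where U: "inX \<Omega> U" "toX U = u" using toX_surj by blast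
  show "u \<in> closure (fst ` hc.L)"
    unfolding closure_approachable
  proof (intro allI impI)
    fix e :: real assume "e > 0"
    then obtain W V where W: "isL \<Omega> W V" "L2norm \<Omega> (\<lambda>x. U x - W x) < e"
      using D U unfolding DL_dense_def inDL_def by blast
    then have "dist (toX W) u < e"
      using U by (simp add: isL_iff inX_iff dist_commute dist_norm norm_toX[symmetric] L2_diff toX_diff norm_minus_commute)
    moreover have "toX W \<in> fst ` hc.L" using W(1) by (force simp: isL_iff)
    ultimately show "\<exists>y\<in>fst ` hc.L. dist y u < e" by blast
  qed
qed

section \<open>The constrained system\<close>

lemma lam0_embed0: "lam0 (embed0 AG t) = (\<lambda>x. 0)" and compA_embed0: "compA (embed0 AG t) = (\<lambda>x. fst (AG t x))"
  and compg_embed0: "compg (embed0 AG t) = (\<lambda>x. snd (AG t x))" and lam3_embed0: "lam3 (embed0 AG t) = (\<lambda>x. 0)"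
  by (auto simp: embed0_def comp_defs)

lemmas embed0_comps = lam0_embed0 compA_embed0 compg_embed0 lam3_embed0

lemma L2deriv_embed0_iff: "L2deriv \<Omega> T (embed0 AG) (embed0 AG') \<longleftrightarrow> L2deriv \<Omega> T AG AG'"
proof -
  have "norm ((1 / (s - t)) *\<^sub>R (embed0 AG s x - embed0 AG t x) - embed0 AG' t x)
      = norm ((1 / (s - t)) *\<^sub>R (AG s x - AG t x) - AG' t x)" for s t x
    by (simp add: embed0_def norm_prod_def)
  then show ?thesis by (simp add: L2deriv_def L2norm_def)
qed

text \<open>Transfers uniqueness: a reduced solution padded with zero multipliers solves the full
  system, where \<open>solution_unique\<close> applies. The full equations for the two multipliers
  become the two constraints.\<close>

lemma is_solution_embed0:
  assumes red: "is_reduced_solution \<Omega> T (compA U0) (compg U0) AG"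
    and init: "AE x in lebesgue_on \<Omega>. lam0 U0 x = 0" "AE x in lebesgue_on \<Omega>. lam3 U0 x = 0"
  shows "is_solution \<Omega> T U0 (embed0 AG)"
proof -
  obtain AG' where AG': "L2deriv \<Omega> T AG AG'"
    and eqs: "\<And>t. t \<in> {0..T} \<Longrightarrow> is_d0adj \<Omega> (\<lambda>x. fst (AG t x)) (\<lambda>x. 0) \<and>
        (\<exists>z1. is_d1adj \<Omega> (\<lambda>x. snd (AG t x)) z1 \<and>
              (AE x in lebesgue_on \<Omega>. fst (AG' t x) + z1 x = 0)) \<and>
        (\<exists>S. is_d1 \<Omega> (\<lambda>x. fst (AG t x)) S \<and>
              (AE x in lebesgue_on \<Omega>. snd (AG' t x) - S x = 0)) \<and>
        is_d2 \<Omega> (\<lambda>x. snd (AG t x)) (\<lambda>x. 0)"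
    and C: "C0_DL \<Omega> T (embed0 AG)" "C1_X \<Omega> T (embed0 AG)"
    and A0: "AE x in lebesgue_on \<Omega>. AG 0 x = (compA U0 x, compg U0 x)"
    using red unfolding is_reduced_solution_def by blast
  have z: "is_d0 \<Omega> (\<lambda>x. 0) (\<lambda>x. 0)" "is_d2adj \<Omega> (\<lambda>x. 0) (\<lambda>x. 0)"
    by (auto simp: is_d0_iff is_d2adj_iff L2_zero emb_zero hc.D_zero hc.Ds_zero)
  have "isL \<Omega> (embed0 AG t) (embed0 AG' t)" if t: "t \<in> {0..T}" for t
  proof -
    obtain z1 S where e: "is_d0adj \<Omega> (\<lambda>x. fst (AG t x)) (\<lambda>x. 0)" "is_d1adj \<Omega> (\<lambda>x. snd (AG t x)) z1"
      "AE x in lebesgue_on \<Omega>. fst (AG' t x) + z1 x = 0" "is_d1 \<Omega> (\<lambda>x. fst (AG t x)) S"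
      "AE x in lebesgue_on \<Omega>. snd (AG' t x) - S x = 0" "is_d2 \<Omega> (\<lambda>x. snd (AG t x)) (\<lambda>x. 0)"
      using eqs[OF t] by blast
    have "AE x in lebesgue_on \<Omega>. embed0 AG' t x = (0, - 0 - z1 x, S x + 0, - 0)"
      using e(3,5) by eventually_elim (simp add: embed0_def eq_neg_iff_add_eq_0)
    moreover have "inX \<Omega> (embed0 AG t)" using C(2) t by (simp add: C1_X_def)
    ultimately show ?thesis
      using e(1,2,4,6) z unfolding isL_def embed0_comps by blast
  qed
  moreover have "AE x in lebesgue_on \<Omega>. embed0 AG 0 x = U0 x"
    using A0 init by eventually_elim (simp add: embed0_def comp_defs prod_eq_iff)
  moreover have "L2deriv \<Omega> T (embed0 AG) (embed0 AG')" using AG' L2deriv_embed0_iff by blast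
  ultimately show ?thesis using C unfolding is_solution_def by blast
qed

text \<open>The multipliers of \<open>U t\<close> vanish only almost everywhere, while
  \<open>embed0\<close> sets them to \<open>0\<close> literally; so regularity is transferred
  through the classes, on which both fields agree.\<close>

lemma is_reduced_solutionI:
  assumes dense: "DL_dense \<Omega>"
    and L: "\<And>t. t \<in> {0..T} \<Longrightarrow> isL \<Omega> (U t) (U' t)"
    and deriv: "\<And>t. t \<in> {0..T} \<Longrightarrow> ((\<lambda>t. toX (U t)) has_vector_derivative toX (U' t)) (at t within {0..T})"
    and cont: "continuous_on {0..T} (\<lambda>t. toX (U' t))"
    and init: "AE x in lebesgue_on \<Omega>. U 0 x = U0 x" and T: "T > 0"
    and N: "\<And>t. t \<in> {0..T} \<Longrightarrow> toX (U t) \<in> hc.N"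
  shows "is_reduced_solution \<Omega> T (compA U0) (compg U0) (\<lambda>t x. (compA (U t) x, compg (U t) x))"
proof -
  define AG where "AG = (\<lambda>t x. (compA (U t) x, compg (U t) x))"
  define AG' where "AG' = (\<lambda>t x. (compA (U' t) x, compg (U' t) x))"
  have l: "L2 \<Omega> (compA (U t))" "L2 \<Omega> (compg (U t))" "L2 \<Omega> (compA (U' t))" "L2 \<Omega> (compg (U' t))"
    if "t \<in> {0..T}" for t
    using L[OF that] by (auto simp: isL_iff L2_X_iff)
  have g: "toX (U t) = (0, emb \<Omega> (compA (U t)), emb \<Omega> (compg (U t)), 0)
      \<and> toX (U' t) = (0, emb \<Omega> (compA (U' t)), emb \<Omega> (compg (U' t)), 0)
      \<and> (emb \<Omega> (compA (U t)), 0) \<in> D0s \<and> (emb \<Omega> (compg (U t)), - emb \<Omega> (compA (U' t))) \<in> D1s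
      \<and> (emb \<Omega> (compA (U t)), emb \<Omega> (compg (U' t))) \<in> D1 \<and> (emb \<Omega> (compg (U t)), 0) \<in> D2"
    if t: "t \<in> {0..T}" for t
  proof -
    have "(toX (U t), toX (U' t)) \<in> hc.L" using L[OF t] by (simp add: isL_iff)
    from hc.L_graph_N[OF domain_dense[OF dense] this N[OF t]]
    obtain A g z S where "toX (U t) = (0, A, g, 0)" "toX (U' t) = (0, - z, S, 0)"
      "(A, 0) \<in> D0s" "(g, z) \<in> D1s" "(A, S) \<in> D1" "(g, 0) \<in> D2" .
    then show ?thesis unfolding toX_def by auto
  qed
  have e: "toX (embed0 AG t) = toX (U t)" "toX (embed0 AG' t) = toX (U' t)" if "t \<in> {0..T}" for t
    using g[OF that] by (simp_all add: toX_def[of "embed0 _ _"] embed0_comps AG_def AG'_def emb_zero)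
  have le: "L2 \<Omega> (embed0 AG t)" "L2 \<Omega> (embed0 AG' t)" if "t \<in> {0..T}" for t
    using l[OF that] by (simp_all add: L2_X_iff embed0_comps AG_def AG'_def L2_zero)
  have deriv': "((\<lambda>t. toX (embed0 AG t)) has_vector_derivative toX (embed0 AG' t)) (at t within {0..T})"
    if t: "t \<in> {0..T}" for t
    using has_vector_derivative_transform[OF t e(1) deriv[OF t]] e(2)[OF t] by simp
  have z: "0 \<in> {0..T}" using T by simp
  have init': "AE x in lebesgue_on \<Omega>. embed0 AG 0 x = U0 x"
  proof -
    have "AE x in lebesgue_on \<Omega>. embed0 AG 0 x = U 0 x"
      using e(1)[OF z] le(1)[OF z] L[OF z] by (subst toX_eq_iff[symmetric]) (auto simp: isL_iff)
    then show ?thesis using init by eventually_elim simp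
  qed
  have sol: "is_solution \<Omega> T U0 (embed0 AG)"
  proof (rule is_solutionI[OF _ deriv' _ init'])
    show "isL \<Omega> (embed0 AG t) (embed0 AG' t)" if "t \<in> {0..T}" for t
      using L[OF that] le[OF that] e[OF that] by (simp add: isL_iff)
    show "continuous_on {0..T} (\<lambda>t. toX (embed0 AG' t))"
      using cont by (rule continuous_on_eq) (simp add: e)
  qed
  have "L2deriv \<Omega> T (embed0 AG) (embed0 AG')" using L2deriv_iff[of T "embed0 AG" "embed0 AG'"] le deriv' by blast
  then have dAG: "L2deriv \<Omega> T AG AG'" by (simp add: L2deriv_embed0_iff)
  have "AE x in lebesgue_on \<Omega>. AG 0 x = (compA U0 x, compg U0 x)"
    using init by eventually_elim (simp add: AG_def comp_defs)
  moreover have "is_d0adj \<Omega> (\<lambda>x. fst (AG t x)) (\<lambda>x. 0) \<and>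
        (\<exists>z1. is_d1adj \<Omega> (\<lambda>x. snd (AG t x)) z1 \<and>
              (AE x in lebesgue_on \<Omega>. fst (AG' t x) + z1 x = 0)) \<and>
        (\<exists>S. is_d1 \<Omega> (\<lambda>x. fst (AG t x)) S \<and>
              (AE x in lebesgue_on \<Omega>. snd (AG' t x) - S x = 0)) \<and>
        is_d2 \<Omega> (\<lambda>x. snd (AG t x)) (\<lambda>x. 0)" if t: "t \<in> {0..T}" for t
  proof (intro conjI exI)
    show "is_d1adj \<Omega> (\<lambda>x. snd (AG t x)) (\<lambda>x. - compA (U' t) x)"
      using g[OF t] l[OF t] by (simp add: is_d1adj_iff AG_def emb_minus L2_minus)
    show "is_d1 \<Omega> (\<lambda>x. fst (AG t x)) (compg (U' t))"
      using g[OF t] l[OF t] by (simp add: is_d1_iff AG_def)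
  qed (use g[OF t] l[OF t] in \<open>simp_all add: is_d0adj_iff is_d2_iff AG_def AG'_def L2_zero emb_zero\<close>)
  ultimately show ?thesis
    using sol dAG unfolding is_reduced_solution_def is_solution_def AG_def[symmetric] by blast
qed

end

theorem theorem3p4:
  fixes \<Omega> :: "(real^3) set" and T :: real and U0 :: "real^3 \<Rightarrow> xval"
  assumes "open \<Omega>" and "connected \<Omega>" and "\<Omega> \<noteq> {}"
    and "T > 0"
    and "DL_dense \<Omega>"
    and "inDL \<Omega> U0"
  shows "\<exists>U. is_solution \<Omega> T U0 U
     \<and> (\<forall>V. is_solution \<Omega> T U0 V \<longrightarrow> (\<forall>t\<in>{0..T}. AE x in lebesgue_on \<Omega>. V t x = U t x))
     \<and> (\<forall>t\<in>{0..T}. L2norm \<Omega> (U t) \<le> L2norm \<Omega> U0)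
     \<and> (((AE x in lebesgue_on \<Omega>. lam0 U0 x = 0) \<and> (AE x in lebesgue_on \<Omega>. lam3 U0 x = 0) \<and>
          is_d0adj \<Omega> (compA U0) (\<lambda>x. 0) \<and> is_d2 \<Omega> (compg U0) (\<lambda>x. 0)) \<longrightarrow>
        (\<forall>t\<in>{0..T}. AE x in lebesgue_on \<Omega>. lam0 (U t) x = 0 \<and> lam3 (U t) x = 0)
        \<and> is_reduced_solution \<Omega> T (compA U0) (compg U0) (\<lambda>t x. (compA (U t) x, compg (U t) x))
        \<and> (\<forall>AG. is_reduced_solution \<Omega> T (compA U0) (compg U0) AG \<longrightarrow>
             (\<forall>t\<in>{0..T}. AE x in lebesgue_on \<Omega>. AG t x = (compA (U t) x, compg (U t) x))))"
proof -
  interpret open_domain \<Omega> by (rule open_domain.intro[OF assms(1)])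
  have dense: "hc.K \<subseteq> closure (fst ` hc.L)" by (rule domain_dense[OF assms(5)])
  obtain V0 where V0: "isL \<Omega> U0 V0" using assms(6) by (auto simp: inDL_def)
  then have LU0: "L2 \<Omega> U0" and "(toX U0, toX V0) \<in> hc.L" by (auto simp: isL_iff)
  from hc.complex_evolution_exists[OF dense this(2)]
  obtain u u' where u: "u 0 = toX U0" and uL: "\<And>t. t \<ge> 0 \<Longrightarrow> (u t, u' t) \<in> hc.L"
    and un: "\<And>t. t \<ge> 0 \<Longrightarrow> norm (u t) \<le> norm (toX U0)"
    and ud: "\<And>t. t \<ge> 0 \<Longrightarrow> (u has_vector_derivative u' t) (at t within {0..})"
    and uc: "continuous_on {0..} u'"
    and uN: "toX U0 \<in> hc.N \<Longrightarrow> \<forall>t\<ge>0. u t \<in> hc.N"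
    by blast
  \<comment> \<open>A representative is picked separately at each time; regularity in time concerns
    the classes only, so the choices need no coherence.\<close>
  define U where "U t = (SOME F. inX \<Omega> F \<and> toX F = u t)" for t
  define U' where "U' t = (SOME F. inX \<Omega> F \<and> toX F = u' t)" for t
  have U: "inX \<Omega> (U t)" "toX (U t) = u t" "inX \<Omega> (U' t)" "toX (U' t) = u' t" if "t \<ge> 0" for t
  proof -
    have "u t \<in> hc.K" "u' t \<in> hc.K" using uL[OF that] hc.L_K by auto
    then show "inX \<Omega> (U t)" "toX (U t) = u t" "inX \<Omega> (U' t)" "toX (U' t) = u' t"
      unfolding U_def U'_def using someI_ex[OF toX_surj] by blast+
  qed
  have sub: "{0..T} \<subseteq> {0..}" by auto
  have L: "isL \<Omega> (U t) (U' t)" if "t \<in> {0..T}" for t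
    using U[of t] uL[of t] that by (simp add: isL_iff inX_iff)
  have deriv: "((\<lambda>t. toX (U t)) has_vector_derivative toX (U' t)) (at t within {0..T})" if t: "t \<in> {0..T}" for t
  proof (rule has_vector_derivative_transform[OF t])
    show "toX (U s) = u s" if "s \<in> {0..T}" for s using U that by simp
    show "(u has_vector_derivative toX (U' t)) (at t within {0..T})"
      using has_vector_derivative_within_subset[OF ud sub, of t] U t by simp
  qed
  have cont: "continuous_on {0..T} (\<lambda>t. toX (U' t))"
    using continuous_on_subset[OF uc sub] by (rule continuous_on_eq) (simp add: U)
  have init: "AE x in lebesgue_on \<Omega>. U 0 x = U0 x"
    using U(1,2)[of 0] u LU0 by (subst toX_eq_iff[symmetric]) (auto simp: inX_iff)
  have sol: "is_solution \<Omega> T U0 U" by (rule is_solutionI[OF L deriv cont init])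
  have bound: "L2norm \<Omega> (U t) \<le> L2norm \<Omega> U0" if "t \<in> {0..T}" for t
    using un[of t] U[of t] that LU0 by (simp add: inX_iff flip: norm_toX)
  have reduced: "(\<forall>t\<in>{0..T}. AE x in lebesgue_on \<Omega>. lam0 (U t) x = 0 \<and> lam3 (U t) x = 0)
      \<and> is_reduced_solution \<Omega> T (compA U0) (compg U0) (\<lambda>t x. (compA (U t) x, compg (U t) x))
      \<and> (\<forall>AG. is_reduced_solution \<Omega> T (compA U0) (compg U0) AG \<longrightarrow>
           (\<forall>t\<in>{0..T}. AE x in lebesgue_on \<Omega>. AG t x = (compA (U t) x, compg (U t) x)))"
    if h: "AE x in lebesgue_on \<Omega>. lam0 U0 x = 0" "AE x in lebesgue_on \<Omega>. lam3 U0 x = 0"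
      "is_d0adj \<Omega> (compA U0) (\<lambda>x. 0)" "is_d2 \<Omega> (compg U0) (\<lambda>x. 0)"
  proof (intro conjI allI impI ballI)
    \<comment> \<open>The four extra hypotheses say exactly that the class of \<open>U0\<close> lies
      in \<open>hc.N\<close>.\<close>
    have "emb \<Omega> (lam0 U0) = emb \<Omega> (\<lambda>x. 0)" "emb \<Omega> (lam3 U0) = emb \<Omega> (\<lambda>x. 0)"
      using h(1,2) LU0 by (simp_all add: emb_eq_iff L2_X_iff L2_zero)
    then have "toX U0 \<in> hc.N"
      using h(3,4) by (simp add: hc.N_def toX_def emb_zero is_d0adj_iff is_d2_iff)
    with uN U have N: "toX (U t) \<in> hc.N" if "t \<in> {0..T}" for t using that by simp
    show "is_reduced_solution \<Omega> T (compA U0) (compg U0) (\<lambda>t x. (compA (U t) x, compg (U t) x))"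
      by (rule is_reduced_solutionI[OF assms(5) L deriv cont init assms(4) N])
    fix t assume t: "t \<in> {0..T}"
    have "L2 \<Omega> (U t)" using L[OF t] by (simp add: isL_iff)
    moreover have "emb \<Omega> (lam0 (U t)) = emb \<Omega> (\<lambda>x. 0)" "emb \<Omega> (lam3 (U t)) = emb \<Omega> (\<lambda>x. 0)"
      using N[OF t] by (simp_all add: hc.N_def toX_def emb_zero)
    ultimately show "AE x in lebesgue_on \<Omega>. lam0 (U t) x = 0 \<and> lam3 (U t) x = 0"
      by (simp add: emb_eq_iff L2_X_iff L2_zero)
  next
    fix AG t assume AG: "is_reduced_solution \<Omega> T (compA U0) (compg U0) AG" and t: "t \<in> {0..T}"
    \<comment> \<open>The padded solution and \<open>U\<close> solve the same Cauchy problem;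
      comparing the two middle components gives the claim.\<close>
    have "AE x in lebesgue_on \<Omega>. embed0 AG t x = U t x"
      by (rule solution_unique[OF sol is_solution_embed0[OF AG h(1,2)] t])
    then show "AE x in lebesgue_on \<Omega>. AG t x = (compA (U t) x, compg (U t) x)"
      by eventually_elim (simp add: embed0_def comp_defs prod_eq_iff)
  qed
  show ?thesis
    by (intro exI[of _ U] conjI allI impI ballI; (elim conjE)?)
       (use sol solution_unique[OF sol] bound reduced in blast)+
qed

end
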